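(* Let $\Phi$ be a homogeneous Poisson point process on $\mathbb{R}^2$ of intensity $\lambda>0$, with i.i.d. nonnegative shadowing marks $\{S_x\}_{x\in\Phi}$ (generic variable $S$, $\mathbf{E}[S]=1$, $\mathbf{E}[S^{2/\beta}]<\infty$) and, independent of the shadowing, i.i.d. exponential mean-$1$ (Rayleigh) fading marks $\{F_x\}_{x\in\Phi}$. Let the path-loss function be $\ell(r)=(Kr)^\beta$ with constants $K>0$, $\beta>2$, and let the noise power be a constant $W\ge0$. Let $\tilde P_c(T)$ be the coverage probability under fading, with respect to the base station of smallest fading-averaged propagation-loss (defined in the context). Then for every $T>0$, $$\tilde P_c(T)=\frac{2}{\beta}\int_0^\infty t^{\frac2\beta-1}\,e^{-tTWa^{-\beta/2}}\,e^{-t^{2/\beta}}\exp\left(-\frac2\beta\,\frac{T\,t^{2/\beta}\,{}_2F_1(1,1-2/\beta;2-2/\beta;-T)}{1-2/\beta}\right)dt,$$ where $a=\lambda\pi\,\mathbf{E}[S^{2/\beta}]/K^2$ and ${}_2F_1$ is the Gauss hypergeometric function.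
   Context: Given $\Phi$, the families $\{S_x\}$ and $\{F_x\}$ are independent of each other and each is i.i.d. The typical user is at the origin. Let $Y_1<Y_2<\cdots$ be the increasing order statistics of the (fading-averaged) propagation-losses $\{\ell(|x|)/S_x:x\in\Phi\}$ and let $F_n$ be the fading variable $F_x$ of the station $x$ whose propagation-loss is $Y_n$. Fading affects the SINR but not the choice of the serving station, which is the one with propagation-loss $Y_1$. The coverage probability under fading is $$\tilde P_c(T)=\mathbf{P}\left\{\frac{Y_1^{-1}F}{W+I-Y_1^{-1}F}>T\right\},\qquad F=F_1,\quad I=\sum_{n\ge1}\frac{F_n}{Y_n}$$ (the total received power, including fading). For $z<1$ and $c>b>0$ the hypergeometric function is given by $${}_2F_1(a',b;c;z)=\frac{\Gamma(c)}{\Gamma(b)\Gamma(c-b)}\int_0^1 w^{b-1}(1-w)^{c-b-1}(1-zw)^{-a'}\,dw.$$ *)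

theory Defs
  imports "HOL-Probability.Probability"
begin

section \<open>Stationary Poisson processes with independent marks\<close>

text \<open>A point process is a random locally finite set of points. The Poisson law is spelled out, since
  the parameter of \<^const>\<open>poisson_pmf\<close> must be positive whereas \<open>A\<close> may be a null set.\<close>

definition homogeneous_poisson_process ::
    "'w measure \<Rightarrow> real \<Rightarrow> ('w \<Rightarrow> ('a::euclidean_space) set) \<Rightarrow> bool" where
  "homogeneous_poisson_process M lam \<Phi> \<longleftrightarrow>
     (AE w in M. \<forall>A. bounded A \<longrightarrow> finite (\<Phi> w \<inter> A)) \<and>
     (\<forall>A\<in>sets borel. bounded A \<longrightarrow>
        (\<lambda>w. card (\<Phi> w \<inter> A)) \<in> measurable M (count_space UNIV) \<and>
        (\<forall>k. measure M {w\<in>space M. card (\<Phi> w \<inter> A) = k} =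
             (lam * measure lborel A) ^ k / fact k * exp (- (lam * measure lborel A)))) \<and>
     (\<forall>A :: nat \<Rightarrow> 'a set. disjoint_family A \<longrightarrow> (\<forall>i. A i \<in> sets borel \<and> bounded (A i)) \<longrightarrow>
        prob_space.indep_vars M (\<lambda>_. count_space UNIV) (\<lambda>i w. card (\<Phi> w \<inter> A i)) UNIV)"

text \<open>\<open>S w x\<close> and \<open>F w x\<close> are the two marks of the point \<open>x \<in> \<Phi> w\<close> (values at other points are irrelevant).
  Given \<open>\<Phi>\<close>, the families of marks are independent of each other and i.i.d. with laws \<open>DS\<close>
  and \<open>DF\<close>: along some measurable enumeration of the (almost surely infinitely many) points, the
  sequence of points, the sequence of first marks and the sequence of second marks have joint law
  \<open>law (X) \<Otimes> DS\<^sup>\<nat> \<Otimes> DF\<^sup>\<nat>\<close>.\<close>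

definition independent_iid_marks ::
    "'w measure \<Rightarrow> ('w \<Rightarrow> ('a::euclidean_space) set) \<Rightarrow> ('w \<Rightarrow> 'a \<Rightarrow> real) \<Rightarrow> ('w \<Rightarrow> 'a \<Rightarrow> real) \<Rightarrow>
     real measure \<Rightarrow> real measure \<Rightarrow> bool" where
  "independent_iid_marks M \<Phi> S F DS DF \<longleftrightarrow>
     (\<exists>X :: nat \<Rightarrow> 'w \<Rightarrow> 'a.
        (AE w in M. bij_betw (\<lambda>n. X n w) UNIV (\<Phi> w)) \<and>
        (\<forall>n. X n \<in> borel_measurable M) \<and>
        (\<forall>n. (\<lambda>w. S w (X n w)) \<in> borel_measurable M) \<and>
        (\<forall>n. (\<lambda>w. F w (X n w)) \<in> borel_measurable M) \<and>
        distr M (PiM UNIV (\<lambda>_. borel) \<Otimes>\<^sub>M (PiM UNIV (\<lambda>_. borel) \<Otimes>\<^sub>M PiM UNIV (\<lambda>_. borel)))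
            (\<lambda>w. (\<lambda>n. X n w, \<lambda>n. S w (X n w), \<lambda>n. F w (X n w))) =
        distr M (PiM UNIV (\<lambda>_. borel)) (\<lambda>w n. X n w) \<Otimes>\<^sub>M
          (PiM UNIV (\<lambda>_. DS) \<Otimes>\<^sub>M PiM UNIV (\<lambda>_. DF)))"

section \<open>The network seen from the typical user at the origin\<close>

definition path_loss :: "real \<Rightarrow> real \<Rightarrow> real \<Rightarrow> real" where
  "path_loss K \<beta> r = (K * r) powr \<beta>"

text \<open>In this section \<open>l\<close> is the path-loss function, and \<open>\<phi>\<close>, \<open>s\<close>, \<open>f\<close> are realisations of the
  stations, the shadowing and the fading. Losses live in \<^typ>\<open>ennreal\<close> so that a station with
  zero shadowing mark has loss \<open>\<infinity>\<close> rather than \<open>0\<close>.\<close>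

definition propagation_loss ::
    "(real \<Rightarrow> real) \<Rightarrow> ('a::real_normed_vector \<Rightarrow> real) \<Rightarrow> 'a \<Rightarrow> ennreal" where
  "propagation_loss l s x = ennreal (l (norm x)) / ennreal (s x)"

text \<open>The strictly increasing enumeration of the set of losses, starting at index \<open>0\<close>: the
  mathematical \<open>Y\<^sub>n\<close> and \<open>F\<^sub>n\<close>, \<open>n \<ge> 1\<close>, are \<open>order_loss l \<phi> s (n - 1)\<close> and
  \<open>order_fading l \<phi> s f (n - 1)\<close>. In the model, ties have probability zero.\<close>

primrec order_loss ::
    "(real \<Rightarrow> real) \<Rightarrow> 'a::real_normed_vector set \<Rightarrow> ('a \<Rightarrow> real) \<Rightarrow> nat \<Rightarrow> ennreal" where
  "order_loss l \<phi> s 0 = (INF x\<in>\<phi>. propagation_loss l s x)"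
| "order_loss l \<phi> s (Suc n) =
     (INF x\<in>{x\<in>\<phi>. order_loss l \<phi> s n < propagation_loss l s x}. propagation_loss l s x)"

definition order_fading ::
    "(real \<Rightarrow> real) \<Rightarrow> 'a::real_normed_vector set \<Rightarrow> ('a \<Rightarrow> real) \<Rightarrow> ('a \<Rightarrow> real) \<Rightarrow> nat \<Rightarrow> real" where
  "order_fading l \<phi> s f n = f (THE x. x \<in> \<phi> \<and> propagation_loss l s x = order_loss l \<phi> s n)"

definition received_power ::
    "(real \<Rightarrow> real) \<Rightarrow> 'a::real_normed_vector set \<Rightarrow> ('a \<Rightarrow> real) \<Rightarrow> ('a \<Rightarrow> real) \<Rightarrow> nat \<Rightarrow> real" where
  "received_power l \<phi> s f n = order_fading l \<phi> s f n / enn2real (order_loss l \<phi> s n)"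

definition total_power ::
    "(real \<Rightarrow> real) \<Rightarrow> 'a::real_normed_vector set \<Rightarrow> ('a \<Rightarrow> real) \<Rightarrow> ('a \<Rightarrow> real) \<Rightarrow> real" where
  "total_power l \<phi> s f = (\<Sum>n. received_power l \<phi> s f n)"

definition SINR ::
    "(real \<Rightarrow> real) \<Rightarrow> real \<Rightarrow> 'a::real_normed_vector set \<Rightarrow> ('a \<Rightarrow> real) \<Rightarrow> ('a \<Rightarrow> real) \<Rightarrow> real" where
  "SINR l W \<phi> s f =
     received_power l \<phi> s f 0 / (W + total_power l \<phi> s f - received_power l \<phi> s f 0)"

text \<open>The order statistics are meaningful only almost surely, so the coverage event is an event only up
  to a null set; hence the completion, which does not change the probability of events of \<open>M\<close>.\<close>

definition coverage_probability ::
    "'w measure \<Rightarrow> (real \<Rightarrow> real) \<Rightarrow> real \<Rightarrow> ('w \<Rightarrow> 'a::real_normed_vector set) \<Rightarrow>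
     ('w \<Rightarrow> 'a \<Rightarrow> real) \<Rightarrow> ('w \<Rightarrow> 'a \<Rightarrow> real) \<Rightarrow> real \<Rightarrow> real" where
  "coverage_probability M l W \<Phi> S F T =
     measure (completion M) {w\<in>space M. SINR l W (\<Phi> w) (S w) (F w) > T}"

section \<open>The Gauss hypergeometric function\<close>

text \<open>Euler's integral, valid for \<open>z < 1\<close> and \<open>c > b > 0\<close>.\<close>

definition hyp2F1 :: "real \<Rightarrow> real \<Rightarrow> real \<Rightarrow> real \<Rightarrow> real" where
  "hyp2F1 a b c z = Gamma c / (Gamma b * Gamma (c - b)) *
     (LBINT w:{0<..<1}. w powr (b - 1) * (1 - w) powr (c - b - 1) * (1 - z * w) powr (- a))"

end

theory Submission
  imports Defs
begin

text \<open>With \<open>\<delta> = \<beta> / 2\<close>, the displacement theorem turns the losses \<open>L\<^sub>j\<close> into points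
  \<open>z\<^sub>j = a * L\<^sub>j powr (1 / \<delta>)\<close> of a Poisson process of unit intensity on the half-line; only its
  Laplace functional is used. Let \<open>Z\<close> be the smallest point. Since the fading of the serving station is
  memoryless, the conditional coverage probability given the losses is
  \<open>(1 + T) * exp (- T * W * (Z / a) powr \<delta>) * H Z\<close>, where
  \<open>H y = (\<Prod>\<^sub>j 1 / (1 + T * (y / z\<^sub>j) powr \<delta>))\<close> runs over all stations: the factor \<open>1 + T\<close>
  compensates for the serving one. For fixed \<open>y\<close> the Laplace functional gives the mean of \<open>H y\<close> on
  \<open>{Z \<ge> s}\<close>, hence the density in \<open>s\<close>, and a dyadic discretisation of \<open>Z\<close> puts \<open>y = s = Z\<close>.
  What remains is an integral over the half-line, which the substitution \<open>t = z powr \<delta>\<close> brings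
  into the stated form.\<close>

section \<open>Infinite products of numbers in the unit interval and the Laplace functional\<close>

text \<open>Everything about the losses enters through means of
  \<open>iprod (\<lambda>j. v (P j w))\<close> with \<open>v\<close> valued in [0, 1]. Partial
  products of such factors decrease, so \<open>iprod\<close> needs no summability, and factors equal
  to 0 are allowed: a void event is itself such a product. Suitable test functions give absence of
  ties, infinitely many stations, summability of the powers and the law of the smallest loss; the
  joint law of the order statistics is never computed. The condition \<open>v 0 = 1\<close> lets
  stations of infinite loss drop out. The obstacle is that the serving station must be both
  conditioned on and removed from the interference, while the Laplace functional treats all stations
  alike. Letting the product run over all stations keeps it symmetric; at \<open>y = Z\<close> the
  serving station contributes exactly \<open>1 / (1 + T)\<close>. But then \<open>y\<close> is
  random, and the functional is available only for constant \<open>y\<close>. On a dyadic cell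
  \<open>y\<close> is frozen at the left endpoint, and rounding down keeps the limits monotone or
  dominated.\<close>

definition iprod :: "(nat \<Rightarrow> real) \<Rightarrow> real" where
  "iprod u = lim (\<lambda>J. \<Prod>j<J. u j)"

lemma decseq_partial_prod:
  fixes u :: "nat \<Rightarrow> real"
  assumes "\<And>j. 0 \<le> u j" "\<And>j. u j \<le> 1"
  shows "decseq (\<lambda>J. \<Prod>j<J. u j)"
  by (rule decseq_SucI) (simp add: assms mult_right_le_one_le prod_nonneg)

lemma iprod_tendsto:
  assumes "\<And>j. 0 \<le> u j" "\<And>j. u j \<le> 1"
  shows "(\<lambda>J. \<Prod>j<J. u j) \<longlonglongrightarrow> iprod u"
proof -
  have "convergent (\<lambda>J. \<Prod>j<J. u j)"
    by (rule Bseq_monoseq_convergent)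
      (auto intro!: BseqI'[where K=1] decseq_imp_monoseq decseq_partial_prod
        simp: assms prod_nonneg prod_le_1)
  then show ?thesis
    unfolding iprod_def by (simp add: convergent_LIMSEQ_iff)
qed

lemma iprod_measurable [measurable (raw)]:
  assumes [measurable]: "\<And>j. (\<lambda>x. u x j) \<in> borel_measurable M"
  shows "(\<lambda>x. iprod (u x)) \<in> borel_measurable M"
  unfolding iprod_def by measurable

lemma iprod_le_partial:
  assumes "\<And>j. 0 \<le> u j" "\<And>j. u j \<le> 1"
  shows "iprod u \<le> (\<Prod>j<J. u j)"
  by (rule decseq_ge[OF decseq_partial_prod iprod_tendsto]) (use assms in auto)

lemma iprod_bounds:
  assumes "\<And>j. 0 \<le> u j" "\<And>j. u j \<le> 1"
  shows "0 \<le> iprod u" "iprod u \<le> 1"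
proof -
  show "0 \<le> iprod u"
    by (rule LIMSEQ_le_const[OF iprod_tendsto]) (use assms in \<open>auto intro!: prod_nonneg\<close>)
  show "iprod u \<le> 1"
    using iprod_le_partial[of u 0] assms by simp
qed

lemma iprod_mono:
  assumes "\<And>j. 0 \<le> u j" "\<And>j. u j \<le> v j" "\<And>j. v j \<le> 1"
  shows "iprod u \<le> iprod v"
proof (rule LIMSEQ_le[OF iprod_tendsto iprod_tendsto])
  show "\<exists>N. \<forall>n\<ge>N. (\<Prod>j<n. u j) \<le> (\<Prod>j<n. v j)"
    using assms by (auto intro!: prod_mono)
qed (use assms in \<open>auto intro: order_trans\<close>)

lemma iprod_eventually_const:
  assumes "\<And>j. j \<ge> J \<Longrightarrow> u j = 1"
  shows "iprod u = (\<Prod>j<J. u j)"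
proof -
  have "(\<Prod>j<n. u j) = (\<Prod>j<J. u j)" if "n \<ge> J" for n
    by (rule prod.mono_neutral_right) (use that assms in auto)
  then have "(\<lambda>n. \<Prod>j<n. u j) \<longlonglongrightarrow> (\<Prod>j<J. u j)"
    by (intro tendsto_eventually eventually_sequentiallyI[of J]) blast
  then show ?thesis
    unfolding iprod_def by (rule limI)
qed

lemma iprod_1 [simp]: "iprod (\<lambda>_. 1) = 1"
  by (simp add: iprod_eventually_const[of 0])

lemma iprod_split:
  assumes "\<And>j. 0 \<le> u j" "\<And>j. u j \<le> 1"
  shows "iprod u = u k * iprod (u(k := 1))"
proof -
  have "(\<lambda>n. u k * (\<Prod>j<n. (u(k := 1)) j)) \<longlonglongrightarrow> u k * iprod (u(k := 1))"
    by (intro tendsto_mult_left iprod_tendsto) (auto simp: assms)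
  moreover have "u k * (\<Prod>j<n. (u(k := 1)) j) = (\<Prod>j<n. u j)" if "n > k" for n
    using that by (subst (1 2) prod.remove[of _ k]) (auto intro!: prod.cong)
  then have "\<forall>\<^sub>F n in sequentially. u k * (\<Prod>j<n. (u(k := 1)) j) = (\<Prod>j<n. u j)"
    using eventually_gt_at_top[of k] by (rule eventually_mono[rotated])
  ultimately have "(\<lambda>n. \<Prod>j<n. u j) \<longlonglongrightarrow> u k * iprod (u(k := 1))"
    by (rule Lim_transform_eventually)
  with iprod_tendsto[of u] assms show ?thesis
    by (auto intro: LIMSEQ_unique)
qed

lemma iprod_eq_0:
  assumes "\<And>j. 0 \<le> u j" "\<And>j. u j \<le> 1" "u k = 0"
  shows "iprod u = 0"
  using iprod_split[of u k] assms by simp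

text \<open>The limits in \<open>n\<close> and in the number of factors are both decreasing, so they can be interchanged.\<close>

lemma iprod_decreasing_limit:
  assumes U: "\<And>n j. 0 \<le> U n j" "\<And>n j. U n j \<le> 1" and dec: "\<And>j. decseq (\<lambda>n. U n j)"
    and lim: "\<And>j. (\<lambda>n. U n j) \<longlonglongrightarrow> u j"
  shows "(\<lambda>n. iprod (U n)) \<longlonglongrightarrow> iprod u"
proof (rule order_tendstoI)
  have u: "0 \<le> u j" "u j \<le> 1" for j
    by (rule LIMSEQ_le_const[OF lim] LIMSEQ_le_const2[OF lim], use U in auto)+
  have le: "u j \<le> U n j" for n j
    by (rule decseq_ge[OF dec lim])
  show "\<forall>\<^sub>F n in sequentially. b < iprod (U n)" if "b < iprod u" for b
    using that iprod_mono[OF u(1) le U(2)] by (auto intro!: always_eventually intro: less_le_trans)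
  show "\<forall>\<^sub>F n in sequentially. iprod (U n) < b" if less: "iprod u < b" for b
  proof -
    \<comment> \<open>A finite partial product already lies below \<open>b\<close>; the remaining
      factors can only lower \<open>iprod (U n)\<close>, and finitely many factors pass to the
      limit.\<close>
    obtain J where J: "(\<Prod>j<J. u j) < b"
      using order_tendstoD(2)[OF iprod_tendsto less, OF u]
      by (auto simp: eventually_sequentially)
    have "(\<lambda>n. \<Prod>j<J. U n j) \<longlonglongrightarrow> (\<Prod>j<J. u j)"
      by (intro tendsto_prod lim)
    from order_tendstoD(2)[OF this J] show ?thesis
      by eventually_elim (use iprod_le_partial[of "U _" J] U in \<open>auto intro: le_less_trans\<close>)
  qed
qed

text \<open>Passes from the enumeration \<open>X\<close> to the counts that the Poisson law
  describes: only finitely many points lie in \<open>B\<close>, so the order of the factors is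
  irrelevant and they can be grouped by the level \<open>k\<close>.\<close>

lemma iprod_bij_eq_prod_card:
  fixes c :: "nat \<Rightarrow> real"
  assumes bij: "bij_betw X UNIV \<phi>" and fin: "finite (\<phi> \<inter> B)"
    and k: "\<And>x. x \<in> B \<Longrightarrow> k x < N"
  shows "iprod (\<lambda>j. if X j \<in> B then c (k (X j)) else 1)
    = (\<Prod>i<N. c i ^ card (\<phi> \<inter> {x \<in> B. k x = i}))"
proof -
  let ?J = "{j. X j \<in> B}"
  have inj: "inj X" and im: "X ` ?J = \<phi> \<inter> B"
    using bij by (auto simp: bij_betw_def)
  have finJ: "finite ?J"
    using fin im inj by (metis finite_imageD inj_on_subset subset_UNIV)
  then obtain J where J: "?J \<subseteq> {..<J}"
    by (metis finite_nat_iff_bounded)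
  have "iprod (\<lambda>j. if X j \<in> B then c (k (X j)) else 1)
      = (\<Prod>j<J. if X j \<in> B then c (k (X j)) else 1)"
    by (rule iprod_eventually_const) (use J in auto)
  also have "\<dots> = (\<Prod>j\<in>?J. c (k (X j)))"
    by (rule prod.mono_neutral_cong_right) (use J in auto)
  also have "\<dots> = (\<Prod>x\<in>\<phi> \<inter> B. c (k x))"
    unfolding im[symmetric] by (subst prod.reindex) (use inj in \<open>auto simp: inj_on_def\<close>)
  also have "\<dots> = (\<Prod>i<N. \<Prod>x\<in>{x \<in> \<phi> \<inter> B. k x = i}. c (k x))"
    by (rule prod.group[symmetric]) (use fin k in auto)
  also have "\<dots> = (\<Prod>i<N. c i ^ card (\<phi> \<inter> {x \<in> B. k x = i}))"
    by (intro prod.cong refl) (simp add: Int_def conj_ac)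
  finally show ?thesis .
qed

section \<open>Laplace functional of a Poisson process\<close>

lemma poisson_generating_function:
  fixes N :: "'w \<Rightarrow> nat"
  assumes "prob_space M" and N [measurable]: "N \<in> measurable M (count_space UNIV)"
    and P: "\<And>k. measure M {w \<in> space M. N w = k} = m ^ k / fact k * exp (- m)"
    and "0 \<le> m" "0 \<le> c"
  shows "(\<integral>w. c ^ N w \<partial>M) = exp (- (1 - c) * m)"
proof -
  interpret prob_space M by fact
  \<comment> \<open>The weights are spelled out because \<open>m\<close> may be 0; then they put
    mass 1 on 0, with \<open>0 ^ 0 = 1\<close>. The same convention makes the case
    \<open>c = 0\<close> the void probability.\<close>
  have D: "distr M (count_space UNIV) N
      = density (count_space UNIV) (\<lambda>k. ennreal (m ^ k / fact k * exp (- m)))"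
  proof (rule measure_eqI_countable[where A = UNIV])
    fix k :: nat
    have "emeasure (distr M (count_space UNIV) N) {k} = emeasure M {w \<in> space M. N w = k}"
      by (subst emeasure_distr) (auto intro!: arg_cong[where f = "emeasure M"])
    also have "\<dots> = ennreal (m ^ k / fact k * exp (- m))"
      by (simp add: emeasure_eq_measure P)
    finally show "emeasure (distr M (count_space UNIV) N) {k}
      = emeasure (density (count_space UNIV) (\<lambda>k. ennreal (m ^ k / fact k * exp (- m)))) {k}"
      by (subst emeasure_density) (auto simp: nn_integral_indicator_singleton)
  qed (auto simp: emeasure_eq_measure)
  have "(\<lambda>k. (c * m) ^ k /\<^sub>R fact k * exp (- m)) sums (exp (c * m) * exp (- m))"
    by (intro sums_mult2 exp_converges)
  also have "(\<lambda>k. (c * m) ^ k /\<^sub>R fact k * exp (- m)) = (\<lambda>k. m ^ k / fact k * exp (- m) * c ^ k)"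
    by (simp add: power_mult_distrib divide_inverse mult_ac)
  also have "exp (c * m) * exp (- m) = exp (- (1 - c) * m)"
    by (simp only: exp_add[symmetric]) (simp add: algebra_simps)
  finally have s: "(\<lambda>k. m ^ k / fact k * exp (- m) * c ^ k) sums exp (- (1 - c) * m)" .
  have "(\<integral>\<^sup>+w. ennreal (c ^ N w) \<partial>M) = (\<integral>\<^sup>+k. ennreal (c ^ k) \<partial>distr M (count_space UNIV) N)"
    by (subst nn_integral_distr) auto
  also have "\<dots> = (\<Sum>k. ennreal (m ^ k / fact k * exp (- m)) * ennreal (c ^ k))"
    unfolding D by (subst nn_integral_density) (simp_all add: nn_integral_count_space_nat)
  also have "\<dots> = (\<Sum>k. ennreal (m ^ k / fact k * exp (- m) * c ^ k))"
    using assms by (intro suminf_cong ennreal_mult[symmetric]) auto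
  also have "\<dots> = ennreal (exp (- (1 - c) * m))"
    using assms by (intro suminf_ennreal_eq s) auto
  finally show ?thesis
    using assms by (subst integral_eq_nn_integral) auto
qed

text \<open>Counts in disjoint sets are independent, so the mean of the product splits into
  generating functions of single Poisson variables.\<close>

lemma poisson_step_functional:
  fixes A :: "nat \<Rightarrow> 'a::euclidean_space set"
  assumes "prob_space M" and hp: "homogeneous_poisson_process M lam \<Phi>" and lam: "lam > 0"
    and dj: "disjoint_family A" and A: "\<And>i. A i \<in> sets borel" "\<And>i. bounded (A i)"
    and c: "\<And>i. 0 \<le> c i" "\<And>i. c i \<le> 1"
  shows "(\<integral>w. (\<Prod>i<N. c i ^ card (\<Phi> w \<inter> A i)) \<partial>M)
    = exp (- (lam * (\<Sum>i<N. (1 - c i) * measure lborel (A i))))"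
proof -
  interpret prob_space M by fact
  have [measurable]: "(\<lambda>w. card (\<Phi> w \<inter> A i)) \<in> measurable M (count_space UNIV)" for i
    using hp A unfolding homogeneous_poisson_process_def by auto
  have P: "measure M {w\<in>space M. card (\<Phi> w \<inter> A i) = k} =
        (lam * measure lborel (A i)) ^ k / fact k * exp (- (lam * measure lborel (A i)))" for i k
    using hp A unfolding homogeneous_poisson_process_def by auto
  have "indep_vars (\<lambda>_. count_space UNIV) (\<lambda>i w. card (\<Phi> w \<inter> A i)) UNIV"
    using hp A dj unfolding homogeneous_poisson_process_def by auto
  then have "indep_vars (\<lambda>_. borel) (\<lambda>i w. c i ^ card (\<Phi> w \<inter> A i)) {..<N}"
    by (intro indep_vars_compose2[where Y = "\<lambda>i k. c i ^ k" and X = "\<lambda>i w. card (\<Phi> w \<inter> A i)"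
          and M' = "\<lambda>_. count_space UNIV"]) (auto intro: indep_vars_subset)
  then have "(\<integral>w. (\<Prod>i<N. c i ^ card (\<Phi> w \<inter> A i)) \<partial>M)
      = (\<Prod>i<N. \<integral>w. c i ^ card (\<Phi> w \<inter> A i) \<partial>M)"
  proof (rule indep_vars_lebesgue_integral[OF finite_lessThan])
    show "integrable M (\<lambda>w. c i ^ card (\<Phi> w \<inter> A i))" for i
      by (rule integrable_const_bound[where B = 1]) (use c in \<open>auto simp: power_le_one\<close>)
  qed
  also have "\<dots> = (\<Prod>i<N. exp (- (1 - c i) * (lam * measure lborel (A i))))"
    using lam c by (intro prod.cong refl poisson_generating_function[OF \<open>prob_space M\<close>])
      (auto simp: P)
  also have "\<dots> = exp (- (lam * (\<Sum>i<N. (1 - c i) * measure lborel (A i))))"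
    by (simp only: exp_sum[OF finite_lessThan, symmetric] sum_distrib_left sum_negf[symmetric])
      (simp add: algebra_simps)
  finally show ?thesis .
qed

text \<open>Inside the ball of radius \<open>n\<close>, \<open>1 - v\<close> is rounded down to the
  grid of step \<open>1 / 2 ^ n\<close>; outside it is replaced by 0. The resulting
  \<open>V n\<close> takes finitely many values and decreases to \<open>v\<close>. Hence the
  products converge by \<open>iprod_decreasing_limit\<close>, and the integrals of
  \<open>1 - V n\<close> are dominated by \<open>1 - v\<close>.\<close>

lemma poisson_laplace_functional:
  fixes X :: "nat \<Rightarrow> 'w \<Rightarrow> 'a::euclidean_space" and v :: "'a \<Rightarrow> real"
  assumes "prob_space M" and hp: "homogeneous_poisson_process M lam \<Phi>" and lam: "lam > 0"
    and bij: "AE w in M. bij_betw (\<lambda>n. X n w) UNIV (\<Phi> w)"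
    and X [measurable]: "\<And>n. X n \<in> borel_measurable M"
    and v [measurable]: "v \<in> borel_measurable borel"
    and v01: "\<And>x. 0 \<le> v x" "\<And>x. v x \<le> 1"
    and int: "integrable lborel (\<lambda>x. 1 - v x)"
  shows "(\<integral>w. iprod (\<lambda>j. v (X j w)) \<partial>M) = exp (- (lam * (\<integral>x. 1 - v x \<partial>lborel)))"
proof -
  interpret prob_space M by fact
  define k where "k n x = nat \<lfloor>2 ^ n * (1 - v x)\<rfloor>" for n :: nat and x
  define A where "A n i = {x \<in> {x. norm x < real n}. k n x = i}" for n i
  \<comment> \<open>\<open>max 0\<close> keeps the weights nonnegative at levels above
    \<open>2 ^ n\<close>, since \<open>poisson_step_functional\<close> asks for bounds at every
    index.\<close>
  define c where "c n i = max 0 (1 - real i / 2 ^ n)" for n i :: nat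
  define V where "V n x = (if x \<in> {x. norm x < real n} then c n (k n x) else 1)" for n x
  have [measurable]: "k n \<in> measurable borel (count_space UNIV)" for n
    unfolding k_def by measurable
  have A: "A n i \<in> sets borel" "bounded (A n i)" for n i
  proof -
    show "A n i \<in> sets borel"
      unfolding A_def by measurable
    show "bounded (A n i)"
      by (rule bounded_subset[OF bounded_ball[of 0 "real n"]]) (auto simp: A_def)
  qed
  have bdd: "bounded {x::'a. norm x < real n}" for n
    by (rule bounded_subset[OF bounded_ball[of 0 "real n"]]) auto
  have dj: "disjoint_family (A n)" for n
    by (auto simp: A_def disjoint_family_on_def)
  have [measurable]: "V n \<in> borel_measurable borel" for n
    unfolding V_def c_def by measurable
  have V01: "0 \<le> V n x" "V n x \<le> 1" for n x
    by (auto simp: V_def c_def)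
  have k_le: "k n x \<le> 2 ^ n" for n x
  proof -
    have "2 ^ n * (1 - v x) \<le> 2 ^ n"
      by (intro mult_left_le) (use v01 in auto)
    then have "\<lfloor>2 ^ n * (1 - v x)\<rfloor> \<le> 2 ^ n"
      unfolding floor_le_iff by (simp only: of_int_power of_int_numeral)
    then show ?thesis
      unfolding k_def by (simp add: nat_le_iff)
  qed
  have k_eq: "real (k n x) = of_int \<lfloor>2 ^ n * (1 - v x)\<rfloor>" for n x
    unfolding k_def using v01[of x] by simp
  have ck: "c n (k n x) = 1 - real (k n x) / 2 ^ n" for n x
    using k_le[of n x] by (simp add: c_def field_simps)
  have V_ge: "v x \<le> V n x" for n x
  proof -
    have "real (k n x) \<le> 2 ^ n * (1 - v x)"
      unfolding k_eq by linarith
    then show ?thesis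
      using v01 by (auto simp: V_def ck field_simps)
  qed
  have V_dec: "decseq (\<lambda>n. V n x)" for x
  proof (rule decseq_SucI)
    fix n
    \<comment> \<open>Halving the grid step refines the rounding: twice a floor never exceeds the
      floor of the double.\<close>
    have "2 * k n x \<le> k (Suc n) x"
    proof -
      have "2 * \<lfloor>2 ^ n * (1 - v x)\<rfloor> \<le> \<lfloor>2 * (2 ^ n * (1 - v x))\<rfloor>"
        by linarith
      then show ?thesis
        unfolding k_def by (simp add: mult.assoc)
    qed
    then have "real (2 * k n x) \<le> real (k (Suc n) x)"
      by (simp only: of_nat_le_iff)
    then show "V (Suc n) x \<le> V n x"
      by (auto simp: V_def ck field_simps)
  qed
  have V_lim: "(\<lambda>n. V n x) \<longlonglongrightarrow> v x" for x
  proof (rule tendsto_sandwich[of "\<lambda>_. v x" _ _ "\<lambda>n. v x + (1 / 2) ^ n"])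
    obtain m :: nat where m: "norm x < real m"
      using reals_Archimedean2 by blast
    show "\<forall>\<^sub>F n in sequentially. V n x \<le> v x + (1 / 2) ^ n"
      using eventually_ge_at_top[of m]
    proof eventually_elim
      case (elim n)
      have "2 ^ n * (1 - v x) \<le> real (k n x) + 1"
        unfolding k_eq by linarith
      then have "1 - v x \<le> (real (k n x) + 1) / 2 ^ n"
        by (simp add: pos_le_divide_eq mult.commute)
      moreover have "x \<in> {x. norm x < real n}"
        using m elim by simp
      ultimately show ?case
        by (simp add: V_def ck add_divide_distrib power_one_over)
    qed
    show "(\<lambda>n. v x + (1 / 2) ^ n) \<longlonglongrightarrow> v x"
      using tendsto_add[OF tendsto_const[of "v x"] LIMSEQ_realpow_zero[of "1/2"]] by simp
  qed (use V_ge in auto)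
  have eq: "(\<integral>w. iprod (\<lambda>j. V n (X j w)) \<partial>M) = exp (- (lam * (\<integral>x. 1 - V n x \<partial>lborel)))" for n
  proof -
    \<comment> \<open>Levels run from 0 to \<open>2 ^ n\<close> inclusive, hence
      \<open>Suc (2 ^ n)\<close> groups; the top level occurs where \<open>v\<close>
      vanishes.\<close>
    have "AE w in M. iprod (\<lambda>j. V n (X j w))
        = (\<Prod>i<Suc (2 ^ n). c n i ^ card (\<Phi> w \<inter> A n i))"
    proof -
      have "AE w in M. \<forall>B. bounded B \<longrightarrow> finite (\<Phi> w \<inter> B)"
        using hp unfolding homogeneous_poisson_process_def by auto
      then show ?thesis
        using bij
      proof eventually_elim
        case (elim w)
        then show ?case
          unfolding V_def A_def
          by (intro iprod_bij_eq_prod_card) (auto simp: less_Suc_eq_le k_le bdd)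
      qed
    qed
    then have "(\<integral>w. iprod (\<lambda>j. V n (X j w)) \<partial>M)
        = (\<integral>w. (\<Prod>i<Suc (2 ^ n). c n i ^ card (\<Phi> w \<inter> A n i)) \<partial>M)"
    proof (intro integral_cong_AE)
      have [measurable]: "(\<lambda>w. card (\<Phi> w \<inter> A n i)) \<in> measurable M (count_space UNIV)" for i
        using hp A unfolding homogeneous_poisson_process_def by auto
      show "(\<lambda>w. \<Prod>i<Suc (2 ^ n). c n i ^ card (\<Phi> w \<inter> A n i)) \<in> borel_measurable M"
        by measurable
    qed measurable
    also have "\<dots> = exp (- (lam * (\<Sum>i<Suc (2 ^ n). (1 - c n i) * measure lborel (A n i))))"
      by (rule poisson_step_functional[OF \<open>prob_space M\<close> hp lam dj A])
        (auto simp: c_def)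
    also have "(\<Sum>i<Suc (2 ^ n). (1 - c n i) * measure lborel (A n i))
        = (\<integral>x. (\<Sum>i<Suc (2 ^ n). (1 - c n i) * indicator (A n i) x) \<partial>lborel)"
    proof -
      have "integrable lborel (indicator (A n i) :: 'a \<Rightarrow> real)" for i
        using A emeasure_bounded_finite[of "A n i"] by (intro integrable_real_indicator) auto
      then show ?thesis
        by (subst Bochner_Integration.integral_sum) auto
    qed
    also have "\<dots> = (\<integral>x. 1 - V n x \<partial>lborel)"
    proof (intro Bochner_Integration.integral_cong refl)
      fix x
      show "(\<Sum>i<Suc (2 ^ n). (1 - c n i) * indicator (A n i) x) = 1 - V n x"
      proof (cases "x \<in> {x. norm x < real n}")
        case True
        then have "(\<Sum>i<Suc (2 ^ n). (1 - c n i) * indicator (A n i) x)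
            = (\<Sum>i<Suc (2 ^ n). if i = k n x then 1 - c n i else 0)"
          by (intro sum.cong refl) (auto simp: A_def)
        also have "\<dots> = 1 - V n x"
          using True k_le[of n x] by (subst sum.delta) (auto simp: V_def)
        finally show ?thesis .
      qed (auto simp: A_def V_def)
    qed
    finally show ?thesis .
  qed
  have "(\<lambda>n. \<integral>w. iprod (\<lambda>j. V n (X j w)) \<partial>M) \<longlonglongrightarrow> (\<integral>w. iprod (\<lambda>j. v (X j w)) \<partial>M)"
  proof (rule integral_dominated_convergence[where w = "\<lambda>_. 1"])
    show "AE w in M. (\<lambda>n. iprod (\<lambda>j. V n (X j w))) \<longlonglongrightarrow> iprod (\<lambda>j. v (X j w))"
      by (intro AE_I2 iprod_decreasing_limit V01 V_dec V_lim)
    show "AE w in M. norm (iprod (\<lambda>j. V n (X j w))) \<le> 1" for n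
      using iprod_bounds[of "\<lambda>j. V n (X j _)"] V01 by auto
  qed auto
  moreover have "(\<lambda>n. \<integral>x. 1 - V n x \<partial>lborel) \<longlonglongrightarrow> (\<integral>x. 1 - v x \<partial>lborel)"
  proof (rule integral_dominated_convergence[where w = "\<lambda>x. 1 - v x"])
    show "AE x in lborel. (\<lambda>n. 1 - V n x) \<longlonglongrightarrow> 1 - v x"
      by (intro AE_I2 tendsto_intros V_lim)
    show "AE x in lborel. norm (1 - V n x) \<le> 1 - v x" for n
      using V01 V_ge by auto
  qed (use int in auto)
  then have "(\<lambda>n. exp (- (lam * (\<integral>x. 1 - V n x \<partial>lborel))))
      \<longlonglongrightarrow> exp (- (lam * (\<integral>x. 1 - v x \<partial>lborel)))"
    by (intro tendsto_intros)
  ultimately show ?thesis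
    unfolding eq by (rule LIMSEQ_unique)
qed

section \<open>Averages over i.i.d. marks and over the plane\<close>

lemma integral_iprod_PiM:
  fixes g :: "nat \<Rightarrow> 'b \<Rightarrow> real"
  assumes "prob_space D" and g [measurable]: "\<And>j. g j \<in> borel_measurable D"
    and g01: "\<And>j x. 0 \<le> g j x" "\<And>j x. g j x \<le> 1"
  shows "(\<integral>s. iprod (\<lambda>j. g j (s j)) \<partial>PiM UNIV (\<lambda>_. D)) = iprod (\<lambda>j. \<integral>x. g j x \<partial>D)"
proof -
  interpret D: prob_space D by fact
  interpret P: product_prob_space "\<lambda>_::nat. D" UNIV ..
  have int: "integrable D (g j)" for j
    by (rule D.integrable_const_bound[where B = 1]) (use g01 in auto)
  have "(\<lambda>J. \<integral>s. (\<Prod>j<J. g j (s j)) \<partial>PiM UNIV (\<lambda>_. D))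
      \<longlonglongrightarrow> (\<integral>s. iprod (\<lambda>j. g j (s j)) \<partial>PiM UNIV (\<lambda>_. D))"
  proof (rule integral_dominated_convergence[where w = "\<lambda>_. 1"])
    show "AE s in PiM UNIV (\<lambda>_. D). (\<lambda>J. \<Prod>j<J. g j (s j)) \<longlonglongrightarrow> iprod (\<lambda>j. g j (s j))"
      by (intro AE_I2 iprod_tendsto g01)
    show "AE s in PiM UNIV (\<lambda>_. D). norm (\<Prod>j<J. g j (s j)) \<le> 1" for J
      using g01 by (auto intro!: AE_I2 simp: abs_prod prod_le_1 prod_nonneg)
  qed auto
  \<comment> \<open>A finite product depends on finitely many coordinates, and the infinite product
    measure restricts to the finite one on them, where Fubini applies.\<close>
  moreover have "(\<integral>s. (\<Prod>j<J. g j (s j)) \<partial>PiM UNIV (\<lambda>_. D)) = (\<Prod>j<J. \<integral>x. g j x \<partial>D)" for J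
  proof -
    have "(\<Prod>j<J. \<integral>x. g j x \<partial>D) = (\<integral>s. (\<Prod>j<J. g j (s j)) \<partial>PiM {..<J} (\<lambda>_. D))"
      by (rule P.product_integral_prod[symmetric]) (use int in auto)
    also have "\<dots> = (\<integral>s. (\<Prod>j<J. g j (s j))
        \<partial>distr (PiM UNIV (\<lambda>_. D)) (PiM {..<J} (\<lambda>_. D)) (\<lambda>s. restrict s {..<J}))"
      by (subst P.distr_PiM_restrict_finite) auto
    also have "\<dots> = (\<integral>s. (\<Prod>j<J. g j (s j)) \<partial>PiM UNIV (\<lambda>_. D))"
      by (subst integral_distr) auto
    finally show ?thesis ..
  qed
  ultimately have "(\<lambda>J. \<Prod>j<J. \<integral>x. g j x \<partial>D)
      \<longlonglongrightarrow> (\<integral>s. iprod (\<lambda>j. g j (s j)) \<partial>PiM UNIV (\<lambda>_. D))"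
    by simp
  moreover have "(\<lambda>J. \<Prod>j<J. \<integral>x. g j x \<partial>D) \<longlonglongrightarrow> iprod (\<lambda>j. \<integral>x. g j x \<partial>D)"
    by (intro iprod_tendsto D.integral_le_const Bochner_Integration.integral_nonneg int g01) (use g01 in auto)
  ultimately show ?thesis
    by (rule LIMSEQ_unique)
qed

text \<open>The area of a disc is linear in its squared radius, so the image of planar Lebesgue
  measure under the squared norm is \<open>pi\<close> times Lebesgue measure on the half-line.
  Agreement on the sets \<open>{..t}\<close> suffices.\<close>

lemma nn_integral_norm_square_plane:
  fixes h :: "real \<Rightarrow> ennreal"
  assumes [measurable]: "h \<in> borel_measurable borel"
  shows "(\<integral>\<^sup>+(x::real^2). h ((norm x)\<^sup>2) \<partial>lborel) = ennreal pi * (\<integral>\<^sup>+z\<in>{0<..}. h z \<partial>lborel)"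
proof -
  let ?D = "density lborel (\<lambda>z::real. ennreal pi * indicator {0<..} z)"
  have area: "emeasure (distr lborel borel (\<lambda>x::real^2. (norm x)\<^sup>2)) {..t} = ennreal (pi * max 0 t)" for t
  proof -
    have "emeasure (distr lborel borel (\<lambda>x::real^2. (norm x)\<^sup>2)) {..t}
        = emeasure lborel {x::real^2. (norm x)\<^sup>2 \<le> t}"
      by (subst emeasure_distr) (auto intro!: arg_cong[where f = "emeasure lborel"])
    also have "\<dots> = ennreal (pi * max 0 t)"
    proof (cases "t \<ge> 0")
      case True
      then have "{x::real^2. (norm x)\<^sup>2 \<le> t} = cball 0 (sqrt t)"
        by (auto simp: real_le_rsqrt sqrt_ge_absD dest: real_le_rsqrt)
      then show ?thesis
        using True by (simp add: emeasure_cball unit_ball_vol_2)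
    next
      case False
      then have "{x::real^2. (norm x)\<^sup>2 \<le> t} = {}"
        by (auto simp: not_le intro: less_le_trans)
      then show ?thesis
        using False by simp
    qed
    finally show ?thesis .
  qed
  have dens: "emeasure ?D {..t} = ennreal (pi * max 0 t)" for t
  proof -
    have "emeasure ?D {..t} = (\<integral>\<^sup>+z. ennreal pi * indicator {0<..t} z \<partial>lborel)"
      by (subst emeasure_density) (auto intro!: nn_integral_cong split: split_indicator)
    also have "\<dots> = ennreal pi * emeasure lborel {0<..t}"
      by (subst nn_integral_cmult_indicator) auto
    also have "\<dots> = ennreal (pi * max 0 t)"
      by (cases "t \<ge> 0") (auto simp: ennreal_mult)
    finally show ?thesis .
  qed
  have sets_atMost: "sets (borel :: real measure) = sigma_sets UNIV (range (\<lambda>a. {..a}))"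
    by (subst borel_eq_atMost) (rule sets_measure_of, simp)
  have D: "distr lborel borel (\<lambda>x::real^2. (norm x)\<^sup>2) = ?D"
  proof (rule measure_eqI_generator_eq[where E = "range (\<lambda>a. {..a})" and \<Omega> = UNIV
        and A = "\<lambda>n. {..real n}"])
    show "Int_stable (range (\<lambda>a::real. {..a}))"
      by (auto simp: Int_stable_def)
    show "sets (distr lborel borel (\<lambda>x::real^2. (norm x)\<^sup>2)) = sigma_sets UNIV (range (\<lambda>a. {..a}))"
      "sets ?D = sigma_sets UNIV (range (\<lambda>a. {..a}))"
      by (simp_all add: sets_atMost)
    show "(\<Union>i. {..real i}) = UNIV"
      by (auto intro: real_arch_simple)
  qed (auto simp: area dens)
  have "(\<integral>\<^sup>+(x::real^2). h ((norm x)\<^sup>2) \<partial>lborel) = (\<integral>\<^sup>+z. h z \<partial>distr lborel borel (\<lambda>x::real^2. (norm x)\<^sup>2))"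
    by (subst nn_integral_distr) auto
  also have "\<dots> = (\<integral>\<^sup>+z. ennreal pi * (h z * indicator {0<..} z) \<partial>lborel)"
    unfolding D by (subst nn_integral_density) (auto intro!: nn_integral_cong simp: mult_ac)
  also have "\<dots> = ennreal pi * (\<integral>\<^sup>+z\<in>{0<..}. h z \<partial>lborel)"
    by (subst nn_integral_cmult) auto
  finally show ?thesis .
qed

text \<open>For a fixed mark \<open>s\<close>, the substitution \<open>(norm x) ^ 2 = c * z\<close>
  turns the power into \<open>z powr - \<delta>\<close>, so \<open>s\<close> survives only in the
  factor \<open>s powr (1 / \<delta>)\<close>. With \<open>h 0 = 0\<close> both sides vanish for
  \<open>s = 0\<close>.\<close>

lemma nn_integral_path_loss_plane:
  fixes h :: "real \<Rightarrow> ennreal"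
  assumes [measurable]: "h \<in> borel_measurable borel"
    and h0: "h 0 = 0" and "s \<ge> 0" "K > 0" "\<delta> > 0"
  shows "(\<integral>\<^sup>+(x::real^2). h (s / path_loss K (2 * \<delta>) (norm x)) \<partial>lborel)
    = ennreal (pi * s powr (1 / \<delta>) / K\<^sup>2) * (\<integral>\<^sup>+z\<in>{0<..}. h (z powr - \<delta>) \<partial>lborel)"
proof (cases "s = 0")
  case True
  then show ?thesis
    by (simp add: h0)
next
  case False
  with \<open>s \<ge> 0\<close> have s: "s > 0" by simp
  define c where "c = s powr (1 / \<delta>) / K\<^sup>2"
  have c: "c > 0"
    using s \<open>K > 0\<close> by (simp add: c_def)
  have "(\<integral>\<^sup>+(x::real^2). h (s / path_loss K (2 * \<delta>) (norm x)) \<partial>lborel)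
      = (\<integral>\<^sup>+(x::real^2). h (s / (K\<^sup>2 * (norm x)\<^sup>2) powr \<delta>) \<partial>lborel)"
  proof (intro nn_integral_cong)
    fix x :: "real^2"
    have "(K * norm x) powr (2 * \<delta>) = (K\<^sup>2 * (norm x)\<^sup>2) powr \<delta>"
      using \<open>K > 0\<close> by (cases "x = 0") (auto simp: powr_powr[symmetric] powr_numeral power_mult_distrib)
    then show "h (s / path_loss K (2 * \<delta>) (norm x)) = h (s / (K\<^sup>2 * (norm x)\<^sup>2) powr \<delta>)"
      by (simp add: path_loss_def)
  qed
  also have "\<dots> = ennreal pi * (\<integral>\<^sup>+r\<in>{0<..}. h (s / (K\<^sup>2 * r) powr \<delta>) \<partial>lborel)"
    by (rule nn_integral_norm_square_plane) measurable
  also have "(\<integral>\<^sup>+r\<in>{0<..}. h (s / (K\<^sup>2 * r) powr \<delta>) \<partial>lborel)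
      = ennreal c * (\<integral>\<^sup>+z. h (s / (K\<^sup>2 * (c * z)) powr \<delta>) * indicator {0<..} (c * z) \<partial>lborel)"
    using c by (subst nn_integral_real_affine[where c = c and t = 0]) auto
  also have "(\<integral>\<^sup>+z. h (s / (K\<^sup>2 * (c * z)) powr \<delta>) * indicator {0<..} (c * z) \<partial>lborel)
      = (\<integral>\<^sup>+z\<in>{0<..}. h (z powr - \<delta>) \<partial>lborel)"
  proof (intro nn_integral_cong)
    fix z :: real
    show "h (s / (K\<^sup>2 * (c * z)) powr \<delta>) * indicator {0<..} (c * z) = h (z powr - \<delta>) * indicator {0<..} z"
    proof (cases "z > 0")
      case True
      have "(K\<^sup>2 * (c * z)) powr \<delta> = (s powr (1 / \<delta>)) powr \<delta> * z powr \<delta>"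
        using \<open>K > 0\<close> True by (simp add: c_def powr_mult)
      also have "(s powr (1 / \<delta>)) powr \<delta> = s"
        using s \<open>\<delta> > 0\<close> by (simp add: powr_powr)
      finally show ?thesis
        using s c True by (simp add: powr_minus field_simps)
    next
      case False
      then show ?thesis
        using c by (simp add: zero_less_mult_iff)
    qed
  qed
  finally show ?thesis
    using c by (simp add: c_def ennreal_mult[symmetric] mult.assoc[symmetric])
qed

section \<open>The process of received powers\<close>

text \<open>The joint law is used only as two rules of iterated integration: given the points,
  average over the shadowing; given points and shadowing, average over the fading.\<close>

lemma independent_iid_marksE:
  fixes \<Phi> :: "'w \<Rightarrow> 'a::euclidean_space set"
  assumes "independent_iid_marks M \<Phi> S F DS DF"
    and "prob_space DS" "prob_space DF" and sets [simp]: "sets DS = sets borel" "sets DF = sets borel"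
  obtains X :: "nat \<Rightarrow> 'w \<Rightarrow> 'a" where
    "AE w in M. bij_betw (\<lambda>n. X n w) UNIV (\<Phi> w)"
    "\<And>n. X n \<in> borel_measurable M"
    "\<And>n. (\<lambda>w. S w (X n w)) \<in> borel_measurable M"
    "\<And>n. (\<lambda>w. F w (X n w)) \<in> borel_measurable M"
    "\<And>h. h \<in> borel_measurable (PiM UNIV (\<lambda>_. borel) \<Otimes>\<^sub>M PiM UNIV (\<lambda>_. borel)) \<Longrightarrow>
      (\<integral>\<^sup>+w. h (\<lambda>n. X n w, \<lambda>n. S w (X n w)) \<partial>M)
      = (\<integral>\<^sup>+w. \<integral>\<^sup>+s. h (\<lambda>n. X n w, s) \<partial>PiM UNIV (\<lambda>_. DS) \<partial>M)"
    "\<And>h. h \<in> borel_measurable (PiM UNIV (\<lambda>_. borel) \<Otimes>\<^sub>M (PiM UNIV (\<lambda>_. borel) \<Otimes>\<^sub>M PiM UNIV (\<lambda>_. borel))) \<Longrightarrow>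
      (\<integral>\<^sup>+w. h (\<lambda>n. X n w, \<lambda>n. S w (X n w), \<lambda>n. F w (X n w)) \<partial>M)
      = (\<integral>\<^sup>+w. \<integral>\<^sup>+f. h (\<lambda>n. X n w, \<lambda>n. S w (X n w), f) \<partial>PiM UNIV (\<lambda>_. DF) \<partial>M)"
proof -
  let ?BX = "PiM UNIV (\<lambda>_. borel) :: (nat \<Rightarrow> 'a) measure"
  let ?B = "PiM UNIV (\<lambda>_. borel) :: (nat \<Rightarrow> real) measure"
  let ?S = "PiM UNIV (\<lambda>_. DS) :: (nat \<Rightarrow> real) measure"
  let ?F = "PiM UNIV (\<lambda>_. DF) :: (nat \<Rightarrow> real) measure"
  from assms(1) obtain X :: "nat \<Rightarrow> 'w \<Rightarrow> 'a" where X: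
    "AE w in M. bij_betw (\<lambda>n. X n w) UNIV (\<Phi> w)"
    and [measurable]: "\<And>n. X n \<in> borel_measurable M"
    "\<And>n. (\<lambda>w. S w (X n w)) \<in> borel_measurable M"
    "\<And>n. (\<lambda>w. F w (X n w)) \<in> borel_measurable M"
    and law: "distr M (?BX \<Otimes>\<^sub>M (?B \<Otimes>\<^sub>M ?B)) (\<lambda>w. (\<lambda>n. X n w, \<lambda>n. S w (X n w), \<lambda>n. F w (X n w))) =
        distr M ?BX (\<lambda>w n. X n w) \<Otimes>\<^sub>M (?S \<Otimes>\<^sub>M ?F)"
    unfolding independent_iid_marks_def by blast
  interpret DS: prob_space ?S
    by (rule prob_space_PiM) (rule assms)
  interpret DF: prob_space ?F
    by (rule prob_space_PiM) (rule assms)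
  interpret DSF: pair_sigma_finite ?S ?F ..
  have [measurable_cong, simp]: "sets ?S = sets ?B" "sets ?F = sets ?B"
    by (auto intro!: sets_PiM_cong)
  have [measurable]: "(\<lambda>w n. X n w) \<in> measurable M ?BX" "(\<lambda>w n. S w (X n w)) \<in> measurable M ?B"
    "(\<lambda>w n. F w (X n w)) \<in> measurable M ?B"
    by (auto intro!: measurable_PiM_single')
  have full: "(\<integral>\<^sup>+w. h (\<lambda>n. X n w, \<lambda>n. S w (X n w), \<lambda>n. F w (X n w)) \<partial>M)
      = (\<integral>\<^sup>+w. \<integral>\<^sup>+s. \<integral>\<^sup>+f. h (\<lambda>n. X n w, s, f) \<partial>?F \<partial>?S \<partial>M)"
    if [measurable]: "h \<in> borel_measurable (?BX \<Otimes>\<^sub>M (?B \<Otimes>\<^sub>M ?B))" for h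
  proof -
    have "(\<integral>\<^sup>+w. h (\<lambda>n. X n w, \<lambda>n. S w (X n w), \<lambda>n. F w (X n w)) \<partial>M)
        = (\<integral>\<^sup>+y. h y \<partial>distr M (?BX \<Otimes>\<^sub>M (?B \<Otimes>\<^sub>M ?B)) (\<lambda>w. (\<lambda>n. X n w, \<lambda>n. S w (X n w), \<lambda>n. F w (X n w))))"
      by (subst nn_integral_distr) auto
    also have "\<dots> = (\<integral>\<^sup>+x. \<integral>\<^sup>+y. h (x, y) \<partial>(?S \<Otimes>\<^sub>M ?F) \<partial>distr M ?BX (\<lambda>w n. X n w))"
      unfolding law by (subst DSF.nn_integral_fst) auto
    also have "\<dots> = (\<integral>\<^sup>+w. \<integral>\<^sup>+y. h (\<lambda>n. X n w, y) \<partial>(?S \<Otimes>\<^sub>M ?F) \<partial>M)"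
      by (subst nn_integral_distr) auto
    also have "\<dots> = (\<integral>\<^sup>+w. \<integral>\<^sup>+s. \<integral>\<^sup>+f. h (\<lambda>n. X n w, s, f) \<partial>?F \<partial>?S \<partial>M)"
      by (intro nn_integral_cong DF.nn_integral_fst[symmetric]) measurable
    finally show ?thesis .
  qed
  have XS: "(\<integral>\<^sup>+w. h (\<lambda>n. X n w, \<lambda>n. S w (X n w)) \<partial>M) = (\<integral>\<^sup>+w. \<integral>\<^sup>+s. h (\<lambda>n. X n w, s) \<partial>?S \<partial>M)"
    if [measurable]: "h \<in> borel_measurable (?BX \<Otimes>\<^sub>M ?B)" for h
    using full[of "\<lambda>(x, s, f). h (x, s)"] by (simp add: DF.emeasure_space_1)
  have XSF: "(\<integral>\<^sup>+w. h (\<lambda>n. X n w, \<lambda>n. S w (X n w), \<lambda>n. F w (X n w)) \<partial>M)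
      = (\<integral>\<^sup>+w. \<integral>\<^sup>+f. h (\<lambda>n. X n w, \<lambda>n. S w (X n w), f) \<partial>?F \<partial>M)"
    if [measurable]: "h \<in> borel_measurable (?BX \<Otimes>\<^sub>M (?B \<Otimes>\<^sub>M ?B))" for h
    unfolding full[OF that] using XS[of "\<lambda>(x, s). \<integral>\<^sup>+f. h (x, s, f) \<partial>?F"] by simp
  show thesis
    by (rule that[OF X _ _ _ XS XSF]) auto
qed

text \<open>This is the displacement theorem for the independently marked process. Averaging the
  marks replaces \<open>v\<close> by its mean \<open>V\<close> at each location, the Poisson
  functional applies to \<open>V\<close>, and interchanging the integrals over marks and plane
  computes the exponent. Of the law of the shadowing only the mean of
  \<open>s powr (1 / \<delta>)\<close> remains.\<close>

lemma strength_laplace_functional: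
  fixes X :: "nat \<Rightarrow> 'w \<Rightarrow> real^2" and v :: "real \<Rightarrow> real"
  assumes "prob_space M" and hp: "homogeneous_poisson_process M lam \<Phi>" and lam: "lam > 0"
    and bij: "AE w in M. bij_betw (\<lambda>n. X n w) UNIV (\<Phi> w)"
    and X [measurable]: "\<And>n. X n \<in> borel_measurable M"
    and S [measurable]: "\<And>n. (\<lambda>w. S w (X n w)) \<in> borel_measurable M"
    and marks: "\<And>h. h \<in> borel_measurable (PiM UNIV (\<lambda>_. borel) \<Otimes>\<^sub>M PiM UNIV (\<lambda>_. borel)) \<Longrightarrow>
      (\<integral>\<^sup>+w. h (\<lambda>n. X n w, \<lambda>n. S w (X n w)) \<partial>M)
      = (\<integral>\<^sup>+w. \<integral>\<^sup>+s. h (\<lambda>n. X n w, s) \<partial>PiM UNIV (\<lambda>_. DS) \<partial>M)"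
    and "prob_space DS" and sets [simp, measurable_cong]: "sets DS = sets borel"
    and S0: "AE s in DS. 0 \<le> s"
    and S_int: "integrable DS (\<lambda>s. s powr (1 / \<delta>))"
    and "K > 0" "\<delta> > 0" "a > 0"
    and a: "a = lam * pi * (\<integral>s. s powr (1 / \<delta>) \<partial>DS) / K\<^sup>2"
    and v [measurable]: "v \<in> borel_measurable borel"
    and v01: "\<And>x. 0 \<le> v x" "\<And>x. v x \<le> 1" and v0: "v 0 = 1"
    and v_int: "set_integrable lborel {0<..} (\<lambda>z. 1 - v (z powr - \<delta>))"
  shows "(\<integral>w. iprod (\<lambda>j. v (S w (X j w) / a powr \<delta> / path_loss K (2 * \<delta>) (norm (X j w)))) \<partial>M)
    = exp (- (LBINT z:{0<..}. 1 - v (z powr - \<delta>)))"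
proof -
  interpret prob_space M by fact
  interpret DS: prob_space DS by fact
  interpret PS: prob_space "PiM UNIV (\<lambda>_::nat. DS)"
    by (rule prob_space_PiM) (rule assms)
  interpret LS: pair_sigma_finite DS "lborel :: (real^2) measure" ..
  have [measurable_cong, simp]: "sets (PiM UNIV (\<lambda>_::nat. DS)) = sets (PiM UNIV (\<lambda>_::nat. borel))"
    by (auto intro!: sets_PiM_cong)
  define p where "p s x = s / a powr \<delta> / path_loss K (2 * \<delta>) (norm x)" for s :: real and x :: "real^2"
  have p [measurable]: "(\<lambda>(s, x). p s x) \<in> borel_measurable (borel \<Otimes>\<^sub>M borel)"
    unfolding p_def path_loss_def by measurable
  define V where "V x = (\<integral>s. v (p s x) \<partial>DS)" for x
  have vp: "integrable DS (\<lambda>s. v (p s x))" for x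
    by (rule DS.integrable_const_bound[where B = 1]) (use v01 in auto)
  have V [measurable]: "V \<in> borel_measurable borel"
    unfolding V_def by measurable
  have V01: "0 \<le> V x" "V x \<le> 1" for x
    using v01 vp[of x] by (auto simp: V_def intro!: DS.integral_le_const)
  have mark: "(\<integral>w. iprod (\<lambda>j. v (p (S w (X j w)) (X j w))) \<partial>M) = (\<integral>w. iprod (\<lambda>j. V (X j w)) \<partial>M)"
  proof -
    let ?h = "\<lambda>(x, s). ennreal (iprod (\<lambda>j. v (p (s j) (x j))))"
    have [measurable]: "?h \<in> borel_measurable (PiM UNIV (\<lambda>_. borel) \<Otimes>\<^sub>M PiM UNIV (\<lambda>_. borel))"
      by measurable
    have "(\<integral>\<^sup>+w. ennreal (iprod (\<lambda>j. v (p (S w (X j w)) (X j w)))) \<partial>M)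
        = (\<integral>\<^sup>+w. \<integral>\<^sup>+s. ennreal (iprod (\<lambda>j. v (p (s j) (X j w)))) \<partial>PiM UNIV (\<lambda>_. DS) \<partial>M)"
      using marks[of ?h] by simp
    also have "\<dots> = (\<integral>\<^sup>+w. ennreal (iprod (\<lambda>j. V (X j w))) \<partial>M)"
    proof (intro nn_integral_cong)
      fix w
      have "(\<integral>\<^sup>+s. ennreal (iprod (\<lambda>j. v (p (s j) (X j w)))) \<partial>PiM UNIV (\<lambda>_. DS))
          = ennreal (\<integral>s. iprod (\<lambda>j. v (p (s j) (X j w))) \<partial>PiM UNIV (\<lambda>_. DS))"
        using v01 by (intro nn_integral_eq_integral PS.integrable_const_bound[where B = 1])
          (auto simp: iprod_bounds intro!: iprod_bounds)
      also have "\<dots> = ennreal (iprod (\<lambda>j. V (X j w)))"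
        unfolding V_def using v01
        by (subst integral_iprod_PiM[OF \<open>prob_space DS\<close>, of "\<lambda>j s. v (p s (X j w))"]) auto
      finally show "(\<integral>\<^sup>+s. ennreal (iprod (\<lambda>j. v (p (s j) (X j w)))) \<partial>PiM UNIV (\<lambda>_. DS))
        = ennreal (iprod (\<lambda>j. V (X j w)))" .
    qed
    finally show ?thesis
      using v01 V01 by (simp add: integral_eq_nn_integral iprod_bounds)
  qed
  let ?I = "\<integral>\<^sup>+z\<in>{0<..}. ennreal (1 - v (z powr - \<delta>)) \<partial>lborel"
  have I: "?I = ennreal (LBINT z:{0<..}. 1 - v (z powr - \<delta>))"
    using v_int v01 unfolding set_lebesgue_integral_def set_integrable_def
    by (subst nn_integral_eq_integral[symmetric])
      (auto intro!: nn_integral_cong split: split_indicator)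
  have "(\<integral>\<^sup>+x. ennreal (1 - V x) \<partial>lborel) = (\<integral>\<^sup>+x. \<integral>\<^sup>+s. ennreal (1 - v (p s x)) \<partial>DS \<partial>lborel)"
  proof (intro nn_integral_cong)
    fix x
    have "(\<integral>\<^sup>+s. ennreal (1 - v (p s x)) \<partial>DS) = ennreal (\<integral>s. 1 - v (p s x) \<partial>DS)"
      using v01 vp[of x] by (intro nn_integral_eq_integral) auto
    also have "\<dots> = ennreal (1 - V x)"
      using vp[of x] by (simp add: V_def DS.prob_space)
    finally show "ennreal (1 - V x) = (\<integral>\<^sup>+s. ennreal (1 - v (p s x)) \<partial>DS)" ..
  qed
  also have "\<dots> = (\<integral>\<^sup>+s. \<integral>\<^sup>+x. ennreal (1 - v (p s x)) \<partial>lborel \<partial>DS)"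
    by (rule LS.Fubini') measurable
  also have "\<dots> = (\<integral>\<^sup>+s. ennreal (pi / (a * K\<^sup>2)) * ennreal (s powr (1 / \<delta>)) * ?I \<partial>DS)"
  proof (rule nn_integral_cong_AE)
    show "AE s in DS. (\<integral>\<^sup>+x. ennreal (1 - v (p s x)) \<partial>lborel)
      = ennreal (pi / (a * K\<^sup>2)) * ennreal (s powr (1 / \<delta>)) * ?I"
      using S0
    proof eventually_elim
      case (elim s)
      have "(s / a powr \<delta>) powr (1 / \<delta>) = s powr (1 / \<delta>) / a"
        using elim \<open>a > 0\<close> \<open>\<delta> > 0\<close> by (simp add: powr_divide powr_powr)
      then have "pi * (s / a powr \<delta>) powr (1 / \<delta>) / K\<^sup>2 = pi / (a * K\<^sup>2) * s powr (1 / \<delta>)"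
        by simp
      then show ?case
        unfolding p_def
        using nn_integral_path_loss_plane[of "\<lambda>q. ennreal (1 - v q)" "s / a powr \<delta>" K \<delta>]
          v0 elim \<open>K > 0\<close> \<open>\<delta> > 0\<close> \<open>a > 0\<close> by (simp add: ennreal_mult[symmetric])
    qed
  qed
  also have "\<dots> = ennreal (pi / (a * K\<^sup>2)) * ennreal (\<integral>s. s powr (1 / \<delta>) \<partial>DS) * ?I"
    using S_int by (simp add: nn_integral_multc nn_integral_cmult nn_integral_eq_integral)
  \<comment> \<open>The constant \<open>a\<close> is chosen for this: the intensity
    \<open>lam\<close> cancels and the transformed points have unit rate.\<close>
  also have "ennreal (pi / (a * K\<^sup>2)) * ennreal (\<integral>s. s powr (1 / \<delta>) \<partial>DS) = ennreal (1 / lam)"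
  proof -
    have "pi / (a * K\<^sup>2) * (\<integral>s. s powr (1 / \<delta>) \<partial>DS) = 1 / lam"
    proof -
      have E: "(\<integral>s. s powr (1 / \<delta>) \<partial>DS) = a * K\<^sup>2 / (lam * pi)"
        using a lam \<open>K > 0\<close> by simp
      show ?thesis
        unfolding E using \<open>a > 0\<close> lam \<open>K > 0\<close> by simp
    qed
    then show ?thesis
      using \<open>a > 0\<close> by (simp add: ennreal_mult[symmetric])
  qed
  finally have *: "(\<integral>\<^sup>+x. ennreal (1 - V x) \<partial>lborel)
      = ennreal (1 / lam * (LBINT z:{0<..}. 1 - v (z powr - \<delta>)))"
    unfolding I using lam by (simp add: ennreal_mult'[symmetric])
  have int: "integrable lborel (\<lambda>x. 1 - V x)"
    using * V01 by (intro integrableI_nonneg) auto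
  have "0 \<le> (LBINT z:{0<..}. 1 - v (z powr - \<delta>))"
    unfolding set_lebesgue_integral_def using v01
    by (intro Bochner_Integration.integral_nonneg) (auto split: split_indicator)
  with * have "(\<integral>x. 1 - V x \<partial>lborel) = 1 / lam * (LBINT z:{0<..}. 1 - v (z powr - \<delta>))"
    using V01 lam by (subst integral_eq_nn_integral) auto
  then show ?thesis
    using mark poisson_laplace_functional[OF \<open>prob_space M\<close> hp lam bij X V V01 int] lam
    by (simp add: p_def)
qed

section \<open>Integrability of the interference and summability\<close>

lemma set_integrable_interference:
  fixes \<theta> \<delta> :: real
  assumes "\<theta> \<ge> 0" "\<delta> > 1"
  shows "set_integrable lborel {0<..} (\<lambda>z. \<theta> / (z powr \<delta> + \<theta>))"
proof -
  have "(\<integral>\<^sup>+z. ennreal (z powr - \<delta>) * indicator {1..} z \<partial>lborel)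
      = ennreal (0 - 1 powr (1 - \<delta>) / (1 - \<delta>))"
  proof (rule nn_integral_FTC_atLeast[where F = "\<lambda>z. z powr (1 - \<delta>) / (1 - \<delta>)" and f = "\<lambda>z. z powr - \<delta>"])
    show "DERIV (\<lambda>z. z powr (1 - \<delta>) / (1 - \<delta>)) z :> z powr - \<delta>" if "1 \<le> z" for z
    proof -
      have "((\<lambda>z. z powr (1 - \<delta>)) has_real_derivative (1 - \<delta>) * z powr (1 - \<delta> - 1)) (at z)"
        using that by (intro has_real_derivative_powr) auto
      from DERIV_cdivide[OF this, of "1 - \<delta>"] show ?thesis
        using \<open>\<delta> > 1\<close> by simp
    qed
    have "((\<lambda>z. z powr (1 - \<delta>)) \<longlongrightarrow> 0) at_top"
      using \<open>\<delta> > 1\<close> by (intro tendsto_neg_powr filterlim_ident) auto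
    then show "((\<lambda>z. z powr (1 - \<delta>) / (1 - \<delta>)) \<longlongrightarrow> 0) at_top"
      by (rule tendsto_divide_zero)
  qed auto
  then have int: "integrable lborel (\<lambda>z. indicator {1..} z * z powr - \<delta>)"
    using \<open>\<delta> > 1\<close>
    by (intro integrableI_nonneg) (auto simp: ennreal_mult mult.commute ennreal_indicator)
  \<comment> \<open>The majorant: the quotient is at most 1 near 0 and at most
    \<open>\<theta> * z powr - \<delta>\<close> further out, which is integrable since
    \<open>\<delta> > 1\<close>.\<close>
  have "integrable lborel (\<lambda>z. indicator {0..1} z + \<theta> * (indicator {1..} z * z powr - \<delta>))"
    by (intro Bochner_Integration.integrable_add integrable_mult_right int integrable_real_indicator) auto
  then show ?thesis
    unfolding set_integrable_def
  proof (rule Bochner_Integration.integrable_bound, goal_cases)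
    case 2
    have "norm (indicator {0<..} z *\<^sub>R (\<theta> / (z powr \<delta> + \<theta>)))
        \<le> norm (indicator {0..1} z + \<theta> * (indicator {1..} z * z powr - \<delta>))" for z :: real
    proof (cases "z > 0")
      case True
      then have p: "z powr \<delta> > 0"
        by simp
      have a: "\<theta> / (z powr \<delta> + \<theta>) \<le> 1" "0 \<le> \<theta> / (z powr \<delta> + \<theta>)"
        using p \<open>\<theta> \<ge> 0\<close> add_pos_nonneg[OF p \<open>\<theta> \<ge> 0\<close>] by (auto simp: divide_le_eq_1_pos)
      have b: "\<theta> / (z powr \<delta> + \<theta>) \<le> \<theta> * z powr - \<delta>"
        using p \<open>\<theta> \<ge> 0\<close> unfolding powr_minus divide_inverse
        by (intro mult_left_mono le_imp_inverse_le) auto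
      show ?thesis
        using True a b \<open>\<theta> \<ge> 0\<close> by (cases "z \<le> 1") (auto split: split_indicator)
    qed auto
    then show ?case
      by auto
  qed auto
qed

text \<open>The integrand increases with the parameter, so its value at parameter 1 dominates along
  the sequence.\<close>

lemma integral_interference_tendsto_0:
  fixes \<delta> :: real
  assumes "\<delta> > 1"
  shows "(\<lambda>n. LBINT z:{0<..}. (1 / real (Suc n)) / (z powr \<delta> + 1 / real (Suc n))) \<longlonglongrightarrow> 0"
proof -
  have "(\<lambda>n. \<integral>z. indicator {0<..} z *\<^sub>R ((1 / real (Suc n)) / (z powr \<delta> + 1 / real (Suc n))) \<partial>lborel)
    \<longlonglongrightarrow> (\<integral>z. 0 \<partial>(lborel :: real measure))"
  proof (rule integral_dominated_convergence[where w = "\<lambda>z. indicator {0<..} z *\<^sub>R (1 / (z powr \<delta> + 1))"])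
    show "integrable lborel (\<lambda>z. indicator {0<..} z *\<^sub>R (1 / (z powr \<delta> + 1)))"
      using set_integrable_interference[of 1 \<delta>] assms by (simp add: set_integrable_def)
    have "(\<lambda>n. indicator {0<..} z *\<^sub>R ((1 / real (Suc n)) / (z powr \<delta> + 1 / real (Suc n)))) \<longlonglongrightarrow> 0"
      for z :: real
    proof (cases "z > 0")
      case True
      have "(\<lambda>n. (1 / real (Suc n)) / (z powr \<delta> + 1 / real (Suc n))) \<longlonglongrightarrow> 0 / (z powr \<delta> + 0)"
        using True by (intro tendsto_intros LIMSEQ_Suc[OF lim_1_over_n]) auto
      then show ?thesis
        using True by simp
    qed auto
    then show "AE z in lborel. (\<lambda>n. indicator {0<..} z *\<^sub>R ((1 / real (Suc n)) / (z powr \<delta> + 1 / real (Suc n)))) \<longlonglongrightarrow> 0"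
      by simp
    have "norm (indicator {0<..} z *\<^sub>R ((1 / real (Suc n)) / (z powr \<delta> + 1 / real (Suc n))))
      \<le> indicator {0<..} z *\<^sub>R (1 / (z powr \<delta> + 1))" for n and z :: real
    proof -
      have "(1 / real (Suc n)) / (z powr \<delta> + 1 / real (Suc n)) = 1 / (real (Suc n) * z powr \<delta> + 1)"
        by (simp add: field_simps)
      also have "\<dots> \<le> 1 / (z powr \<delta> + 1)"
        by (intro divide_left_mono add_mono) (auto simp: mult_le_cancel_right1 add_nonneg_pos intro!: mult_pos_pos add_nonneg_pos)
      finally show ?thesis
        by (auto split: split_indicator)
    qed
    then show "AE z in lborel. norm (indicator {0<..} z *\<^sub>R ((1 / real (Suc n)) / (z powr \<delta> + 1 / real (Suc n))))
      \<le> indicator {0<..} z *\<^sub>R (1 / (z powr \<delta> + 1))" for n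
      by simp
  qed auto
  then show ?thesis
    by (simp add: set_lebesgue_integral_def)
qed

text \<open>Expanding \<open>\<Prod>j<n. 1 + \<theta> * p j\<close> leaves at least the linear
  terms, so up to the factor \<open>\<theta>\<close> the partial sums of \<open>p\<close> are
  bounded by the reciprocal of the infinite product.\<close>

lemma summable_if_iprod_pos:
  fixes p :: "nat \<Rightarrow> real"
  assumes p: "\<And>j. 0 \<le> p j" and "\<theta> > 0" and pos: "iprod (\<lambda>j. 1 / (1 + \<theta> * p j)) > 0"
  shows "summable p"
proof (rule summableI_nonneg_bounded[OF p])
  let ?c = "iprod (\<lambda>j. 1 / (1 + \<theta> * p j))"
  fix n
  have q: "0 < 1 + \<theta> * p j" for j
    using p[of j] \<open>\<theta> > 0\<close> by (simp add: add_pos_nonneg)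
  have "\<theta> * (\<Sum>j<n. p j) \<le> (\<Prod>j<n. 1 + \<theta> * p j)"
  proof -
    have "1 + (\<Sum>j<n. \<theta> * p j) \<le> (\<Prod>j<n. 1 + \<theta> * p j)"
    proof (induction n)
      case (Suc n)
      have "1 + (\<Sum>j<Suc n. \<theta> * p j) \<le> (1 + (\<Sum>j<n. \<theta> * p j)) * (1 + \<theta> * p n)"
        using p \<open>\<theta> > 0\<close> by (simp add: algebra_simps sum_nonneg)
      also have "\<dots> \<le> (\<Prod>j<n. 1 + \<theta> * p j) * (1 + \<theta> * p n)"
        using q[of n] by (intro mult_right_mono Suc) auto
      finally show ?case
        by simp
    qed simp
    then show ?thesis
      by (simp add: sum_distrib_left)
  qed
  also have "\<dots> \<le> 1 / ?c"
  proof -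
    have "?c \<le> (\<Prod>j<n. 1 / (1 + \<theta> * p j))"
      using q p \<open>\<theta> > 0\<close> by (intro iprod_le_partial) (auto simp: less_imp_le)
    also have "\<dots> = 1 / (\<Prod>j<n. 1 + \<theta> * p j)"
      by (simp add: prod_dividef)
    finally show ?thesis
      using pos prod_pos[of "{..<n}" "\<lambda>j. 1 + \<theta> * p j"] q by (simp add: field_simps)
  qed
  finally show "(\<Sum>j<n. p j) \<le> 1 / ?c / \<theta>"
    using \<open>\<theta> > 0\<close> pos_le_divide_eq[of \<theta> "\<Sum>j<n. p j" "1 / ?c"] by (simp add: mult.commute)
qed

text \<open>The terms tend to 0, so only finitely many are as large as \<open>p i\<close>. With
  \<open>B\<close> the indices of the terms below a threshold, this also finds the next largest
  term.\<close>

lemma summable_attains_maximum: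
  fixes p :: "nat \<Rightarrow> real"
  assumes "summable p" "i \<in> B" "0 < p i"
  shows "\<exists>k\<in>B. 0 < p k \<and> (\<forall>j\<in>B. p j \<le> p k)"
proof -
  have "\<forall>\<^sub>F j in sequentially. p j < p i"
    using order_tendstoD(2)[OF summable_LIMSEQ_zero[OF assms(1)] assms(3)] .
  then obtain J where J: "\<And>j. j \<ge> J \<Longrightarrow> p j < p i"
    by (auto simp: eventually_sequentially)
  have iJ: "i < J"
    using J[of i] by (meson less_irrefl not_less)
  let ?C = "B \<inter> {..<J}"
  have "Max (p ` ?C) \<in> p ` ?C"
    using iJ assms(2) by (intro Max_in) auto
  then obtain k where k: "k \<in> ?C" "p k = Max (p ` ?C)"
    by auto
  have le: "p j \<le> p k" if "j \<in> ?C" for j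
    using that k by auto
  have ik: "p i \<le> p k"
    using iJ assms(2) by (intro le) auto
  have "p j \<le> p k" if "j \<in> B" for j
    using le[of j] J[of j] ik that by (cases "j < J") auto
  with k ik assms(3) show ?thesis
    by (intro bexI[of _ k]) auto
qed

text \<open>\<open>P j\<close> is the fading-averaged received power of the \<open>j\<close>-th station, scaled so that the
  transformed losses \<open>P j powr (- 1 / \<delta>)\<close> form a Poisson process of unit intensity on \<open>{0<..}\<close>.
  A station with zero shadowing mark (infinite loss) has \<open>P j = 0\<close>.\<close>

locale poisson_strengths = prob_space M for M :: "'w measure" +
  fixes P :: "nat \<Rightarrow> 'w \<Rightarrow> real" and \<delta> :: real
  assumes \<delta>: "\<delta> > 1"
    and P_measurable [measurable]: "\<And>j. P j \<in> borel_measurable M"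
    and P_nonneg: "\<And>j w. 0 \<le> P j w"
    and laplace: "\<And>v. v \<in> borel_measurable borel \<Longrightarrow> (\<And>x. 0 \<le> v x) \<Longrightarrow> (\<And>x. v x \<le> 1) \<Longrightarrow> v 0 = 1 \<Longrightarrow>
      set_integrable lborel {0<..} (\<lambda>z. 1 - v (z powr - \<delta>)) \<Longrightarrow>
      (\<integral>w. iprod (\<lambda>j. v (P j w)) \<partial>M) = exp (- (LBINT z:{0<..}. 1 - v (z powr - \<delta>)))"
begin

text \<open>By \<open>summable_if_iprod_pos\<close> the product of the factors
  \<open>1 / (1 + \<theta> * P j w)\<close> vanishes wherever summability fails. Its mean is
  therefore a lower bound for the probability of summability, and this bound tends to 1 as \<theta>
  tends to 0.\<close>

lemma AE_summable: "AE w in M. summable (\<lambda>j. P j w)"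
proof -
  let ?A = "{w \<in> space M. (\<Sum>j. ennreal (P j w)) < top}"
  let ?v = "\<lambda>\<theta> q. 1 / (1 + \<theta> * max 0 q)"
  have A: "summable (\<lambda>j. P j w) \<longleftrightarrow> (\<Sum>j. ennreal (P j w)) < top" for w
    by (metis P_nonneg ennreal_suminf_neq_top less_top summable_suminf_not_top)
  have [measurable]: "?A \<in> sets M"
    by measurable
  have bound: "exp (- (LBINT z:{0<..}. \<theta> / (z powr \<delta> + \<theta>))) \<le> prob ?A" if "\<theta> > 0" for \<theta>
  proof -
    have v01: "0 \<le> ?v \<theta> q" "?v \<theta> q \<le> 1" for q
      using that by (auto simp: divide_le_eq_1)
    have eq: "1 - ?v \<theta> (z powr - \<delta>) = \<theta> / (z powr \<delta> + \<theta>)" if "z > 0" for z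
    proof -
      have "z powr \<delta> > 0"
        using that by simp
      then show ?thesis
        using \<open>\<theta> > 0\<close> by (simp add: powr_minus field_simps add_pos_pos) (simp add: add_divide_distrib[symmetric] add_pos_pos less_imp_neq[symmetric])
    qed
    have "set_integrable lborel {0<..} (\<lambda>z. 1 - ?v \<theta> (z powr - \<delta>))"
      using set_integrable_interference[of \<theta> \<delta>] \<delta> that eq
      by (subst set_integrable_cong[OF refl refl]) (auto simp: eq)
    then have "(\<integral>w. iprod (\<lambda>j. ?v \<theta> (P j w)) \<partial>M) = exp (- (LBINT z:{0<..}. 1 - ?v \<theta> (z powr - \<delta>)))"
      using v01 by (intro laplace) auto
    also have "(LBINT z:{0<..}. 1 - ?v \<theta> (z powr - \<delta>)) = (LBINT z:{0<..}. \<theta> / (z powr \<delta> + \<theta>))"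
      by (rule set_lebesgue_integral_cong) (use eq in auto)
    finally have "exp (- (LBINT z:{0<..}. \<theta> / (z powr \<delta> + \<theta>))) = (\<integral>w. iprod (\<lambda>j. ?v \<theta> (P j w)) \<partial>M)" ..
    also have "\<dots> \<le> (\<integral>w. indicator ?A w \<partial>M)"
    proof (rule integral_mono)
      show "integrable M (\<lambda>w. iprod (\<lambda>j. ?v \<theta> (P j w)))"
        using v01 by (intro integrable_const_bound[where B = 1]) (auto simp: iprod_bounds)
      fix w assume w: "w \<in> space M"
      show "iprod (\<lambda>j. ?v \<theta> (P j w)) \<le> indicator ?A w"
      proof (cases "iprod (\<lambda>j. ?v \<theta> (P j w)) > 0")
        case True
        then have "summable (\<lambda>j. P j w)"
          using P_nonneg that by (intro summable_if_iprod_pos[of _ \<theta>]) auto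
        then show ?thesis
          using w A iprod_bounds[OF v01] by simp
      qed (auto simp: indicator_def)
    qed (auto simp: less_top[symmetric] emeasure_finite)
    finally show ?thesis
      by simp
  qed
  have "exp (- (LBINT z:{0<..}. (1 / real (Suc n)) / (z powr \<delta> + 1 / real (Suc n)))) \<le> prob ?A" for n
    by (rule bound) simp
  moreover have "(\<lambda>n. exp (- (LBINT z:{0<..}. (1 / real (Suc n)) / (z powr \<delta> + 1 / real (Suc n)))))
      \<longlonglongrightarrow> exp (- 0)"
    by (intro tendsto_intros integral_interference_tendsto_0 \<delta>)
  ultimately have "exp (- 0) \<le> prob ?A"
    by (intro LIMSEQ_le_const2) auto
  then have "prob ?A = 1"
    using prob_le_1[of ?A] by simp
  then have "AE w in M. w \<in> ?A"
    by (subst AE_in_set_eq_1) auto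
  then show ?thesis
    by eventually_elim (simp add: A)
qed

text \<open>The product is \<open>c ^ N\<close> for the number \<open>N\<close> of transformed
  losses in \<open>{s..<t}\<close>, a Poisson variable of mean \<open>t - s\<close>. The case
  \<open>c = 0\<close> is the void probability.\<close>

lemma expectation_band:
  assumes c: "0 \<le> c" "c \<le> 1" and s: "0 \<le> s" "s \<le> t"
  shows "(\<integral>w. iprod (\<lambda>j. if 0 < P j w \<and> s \<le> P j w powr (- 1 / \<delta>) \<and> P j w powr (- 1 / \<delta>) < t then c else 1) \<partial>M)
    = exp (- ((1 - c) * (t - s)))"
proof -
  \<comment> \<open>Without \<open>0 < q\<close>, an infinite loss would count as the point 0,
    because \<open>0 powr _ = 0\<close>.\<close>
  let ?v = "\<lambda>q. if 0 < q \<and> s \<le> q powr (- 1 / \<delta>) \<and> q powr (- 1 / \<delta>) < t then c else 1"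
  have eq: "indicator {0<..} z *\<^sub>R (1 - ?v (z powr - \<delta>)) = (1 - c) * indicator ({s..<t} - {0}) z" for z :: real
  proof (cases "z > 0")
    case True
    then have "(z powr - \<delta>) powr (- 1 / \<delta>) = z"
      using \<delta> by (simp add: powr_powr)
    then show ?thesis
      using True by (simp add: indicator_def)
  next
    case False
    then show ?thesis
      using s by (auto simp: indicator_def)
  qed
  have int: "integrable lborel (indicator ({s..<t} - {0}) :: real \<Rightarrow> real)"
    by (intro integrable_real_indicator emeasure_bounded_finite bounded_subset[OF bounded_closed_interval[of s t]])
      auto
  have "measure lborel ({s..<t} - {0}) = t - s"
    using s by (subst measure_Diff_null_set) auto
  then have "(LBINT z:{0<..}. 1 - ?v (z powr - \<delta>)) = (1 - c) * (t - s)"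
    unfolding set_lebesgue_integral_def eq using int by simp
  moreover have "set_integrable lborel {0<..} (\<lambda>z. 1 - ?v (z powr - \<delta>))"
    unfolding set_integrable_def eq using int by simp
  ultimately show ?thesis
    using laplace[of ?v] c by simp
qed

text \<open>If \<open>N\<close> counts the points in a band of mass \<open>m\<close>, then \<open>2 + 2 * 0 ^ N - 4 / 2 ^ N\<close>
  dominates the indicator of \<open>N \<ge> 2\<close> and has mean \<open>2 * (1 - exp (- m / 2))\<^sup>2\<close>.\<close>

lemma prob_two_in_band:
  assumes s: "0 \<le> s" "s \<le> t"
  shows "prob {w \<in> space M. \<exists>i j. i \<noteq> j \<and> (\<forall>k\<in>{i, j}. 0 < P k w \<and> s \<le> P k w powr (- 1 / \<delta>) \<and> P k w powr (- 1 / \<delta>) < t)}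
    \<le> (t - s)\<^sup>2 / 2"
proof -
  define B where "B j w \<longleftrightarrow> 0 < P j w \<and> s \<le> P j w powr (- 1 / \<delta>) \<and> P j w powr (- 1 / \<delta>) < t" for j w
  have [measurable]: "Measurable.pred M (B j)" for j
    unfolding B_def by measurable
  let ?E = "{w \<in> space M. \<exists>i j. i \<noteq> j \<and> (\<forall>k\<in>{i, j}. B k w)}"
  let ?I = "\<lambda>c w. iprod (\<lambda>j. if B j w then c else 1)"
  have E [measurable]: "?E \<in> sets M"
    by measurable
  have I01: "0 \<le> ?I c w" "?I c w \<le> 1" if "0 \<le> c" "c \<le> 1" for c w
    by (rule iprod_bounds; use that in auto)+
  have int: "integrable M (?I c)" if "0 \<le> c" "c \<le> 1" for c
    using I01[OF that] by (intro integrable_const_bound[where B = 1]) auto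
  have "prob ?E = (\<integral>w. indicator ?E w \<partial>M)"
    by simp
  also have "\<dots> \<le> (\<integral>w. 2 + 2 * ?I 0 w - 4 * ?I (1/2) w \<partial>M)"
  proof (rule integral_mono)
    show "integrable M (\<lambda>w. 2 + 2 * ?I 0 w - 4 * ?I (1/2) w)"
      by (intro Bochner_Integration.integrable_add Bochner_Integration.integrable_diff integrable_mult_right int) auto
    fix w assume w: "w \<in> space M"
    have split: "?I c w = c * iprod ((\<lambda>j. if B j w then c else 1)(i := 1))" if "B i w" "0 \<le> c" "c \<le> 1" for c i
      using iprod_split[of "\<lambda>j. if B j w then c else 1" i] that by auto
    have le1: "iprod ((\<lambda>j. if B j w then 1/2 else 1)(i := 1)) \<le> 1" for i
      by (rule iprod_bounds) auto
    \<comment> \<open>With no point or one point in the band the bound equals 0; from two points on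
      it is at least \<open>2 - 4 * (1/4) = 1\<close>.\<close>
    show "indicator ?E w \<le> 2 + 2 * ?I 0 w - 4 * ?I (1/2) w"
    proof (cases "\<exists>i. B i w")
      case False
      then show ?thesis
        by (auto simp: indicator_def)
    next
      case True
      then obtain i where i: "B i w"
        by blast
      show ?thesis
      proof (cases "w \<in> ?E")
        case True
        then obtain i j where ij: "i \<noteq> j" "B i w" "B j w"
          by auto
        have "iprod ((\<lambda>k. if B k w then 1/2 else 1)(i := 1))
            = 1/2 * iprod ((\<lambda>k. if B k w then 1/2 else 1)(i := 1, j := 1))"
          using iprod_split[of "(\<lambda>k. if B k w then 1/2 else 1)(i := 1)" j] ij by auto
        also have "\<dots> \<le> 1/2 * 1"
          by (intro mult_left_mono iprod_bounds) auto
        finally have "?I (1/2) w \<le> 1/4"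
          using split[of i "1/2"] ij by simp
        then show ?thesis
          using I01[of 0 w] by (auto simp: indicator_def)
      next
        case False
        have "?I (1/2) w \<le> 1/2"
          using split[of i "1/2"] i le1[of i] by simp
        then show ?thesis
          using I01[of 0 w] False by (auto simp: indicator_def)
      qed
    qed
  qed (auto simp: less_top[symmetric] emeasure_finite)
  also have "\<dots> = 2 + 2 * exp (- (t - s)) - 4 * exp (- ((t - s) / 2))"
    using int[of 0] int[of "1/2"] expectation_band[of 0 s t] expectation_band[of "1/2" s t] s
    by (simp add: B_def prob_space field_simps)
  also have "\<dots> = 2 * (1 - exp (- ((t - s) / 2)))\<^sup>2"
    by (simp add: power2_eq_square algebra_simps exp_add[symmetric])
  also have "\<dots> \<le> 2 * ((t - s) / 2)\<^sup>2"
  proof -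
    have "1 - exp (- ((t - s) / 2)) \<le> (t - s) / 2"
      using exp_ge_add_one_self[of "- ((t - s) / 2)"] by linarith
    then show ?thesis
      using s by (intro mult_left_mono power_mono) auto
  qed
  also have "\<dots> = (t - s)\<^sup>2 / 2"
    by (simp add: power2_eq_square)
  finally show ?thesis
    by (simp add: B_def)
qed

text \<open>Cut \<open>{0..<m}\<close> into \<open>m * Suc n\<close> bands of length
  \<open>1 / Suc n\<close>. A tie below \<open>m\<close> puts two points into one band, so
  \<open>prob_two_in_band\<close> and the union bound give at most \<open>m / (2 * Suc n)\<close>,
  which tends to 0.\<close>

lemma AE_no_ties: "AE w in M. \<forall>i j. i \<noteq> j \<longrightarrow> P i w = P j w \<longrightarrow> P i w = 0"
proof -
  let ?z = "\<lambda>j w. P j w powr (- 1 / \<delta>)"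
  define E where "E m = {w \<in> space M. \<exists>i j. i \<noteq> j \<and> P i w = P j w \<and> 0 < P i w \<and> ?z i w < real m}" for m :: nat
  have [measurable]: "E m \<in> sets M" for m
    unfolding E_def by measurable
  have le: "prob (E m) \<le> (real m / 2) * (1 / real (Suc n))" for m n
  proof -
    let ?n = "real (Suc n)"
    define D where "D k = {w \<in> space M. \<exists>i j. i \<noteq> j \<and> (\<forall>l\<in>{i, j}. 0 < P l w \<and> real k / ?n \<le> ?z l w \<and> ?z l w < real (Suc k) / ?n)}" for k
    have [measurable]: "D k \<in> sets M" for k
      unfolding D_def by measurable
    have "E m \<subseteq> (\<Union>k<m * Suc n. D k)"
    proof
      fix w assume "w \<in> E m"
      then obtain i j where w: "w \<in> space M" and ij: "i \<noteq> j" "P i w = P j w" "0 < P i w" "?z i w < real m"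
        unfolding E_def by auto
      define k where "k = nat \<lfloor>?n * ?z i w\<rfloor>"
      have k: "real k \<le> ?n * ?z i w" "?n * ?z i w < real (Suc k)"
        unfolding k_def by (simp_all add: of_nat_nat) linarith
      then have "real k / ?n \<le> ?z i w" "?z i w < real (Suc k) / ?n"
        by (simp_all add: divide_le_eq less_divide_eq mult.commute)
      then have "w \<in> D k"
        using w ij(1,3) ij(2)[symmetric] unfolding D_def
        by (intro CollectI conjI exI[of _ i] exI[of _ j]) auto
      moreover have "real k < real (m * Suc n)"
      proof -
        have "?n * ?z i w < ?n * real m"
          using ij by (intro mult_strict_left_mono) auto
        with k(1) have "real k < real m * ?n"
          by (simp only: mult.commute)
        then show ?thesis
          by (simp only: of_nat_mult)
      qed
      ultimately show "w \<in> (\<Union>k<m * Suc n. D k)"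
        by (auto simp only: of_nat_less_iff lessThan_iff)
    qed
    then have "prob (E m) \<le> prob (\<Union>k<m * Suc n. D k)"
      by (intro finite_measure_mono) auto
    also have "\<dots> \<le> (\<Sum>k<m * Suc n. prob (D k))"
      by (rule finite_measure_subadditive_finite) auto
    also have "\<dots> \<le> (\<Sum>k<m * Suc n. (1 / ?n)\<^sup>2 / 2)"
    proof (rule sum_mono)
      fix k
      have "prob (D k) \<le> (real (Suc k) / ?n - real k / ?n)\<^sup>2 / 2"
        unfolding D_def by (intro prob_two_in_band) (auto simp: divide_simps)
      also have "real (Suc k) / ?n - real k / ?n = 1 / ?n"
        by (simp add: diff_divide_distrib[symmetric])
      finally show "prob (D k) \<le> (1 / ?n)\<^sup>2 / 2" .
    qed
    also have "\<dots> = (real m / 2) * (1 / ?n)"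
      by (simp only: sum_constant card_lessThan of_nat_mult)
        (simp add: power2_eq_square field_simps del: of_nat_Suc)
    finally show ?thesis .
  qed
  have lim: "(\<lambda>n. (real m / 2) * (1 / real (Suc n))) \<longlonglongrightarrow> (real m / 2) * 0" for m
    by (intro tendsto_mult_left LIMSEQ_Suc[OF lim_1_over_n])
  have "prob (E m) \<le> (real m / 2) * 0" for m
    by (rule LIMSEQ_le_const[OF lim]) (use le in blast)
  then have "E m \<in> null_sets M" for m
    by (simp add: null_sets_def emeasure_eq_measure measure_le_0_iff)
  then have "AE w in M. w \<notin> E m" for m
    by (rule AE_not_in)
  then have "AE w in M. \<forall>m. w \<notin> E m"
    by (simp add: AE_all_countable)
  then show ?thesis
    using AE_space
  proof eventually_elim
    case (elim w)
    show ?case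
    proof (intro allI impI)
      fix i j assume "i \<noteq> j" "P i w = P j w"
      moreover obtain m :: nat where "?z i w < real m"
        using reals_Archimedean2 by blast
      ultimately show "P i w = 0"
        using elim P_nonneg[of i w] unfolding E_def by fastforce
    qed
  qed
qed

text \<open>If there were finitely many finite losses, all transformed ones would lie below some
  \<open>m\<close>. Then the band from \<open>m\<close> to \<open>m + n\<close> would be empty for
  every \<open>n\<close>, an event of probability \<open>exp (- n)\<close>.\<close>

lemma AE_infinite_positive: "AE w in M. infinite {j. 0 < P j w}"
proof -
  let ?z = "\<lambda>j w. P j w powr (- 1 / \<delta>)"
  define E where "E m = {w \<in> space M. \<forall>j. 0 < P j w \<longrightarrow> ?z j w < real m}" for m :: nat
  have [measurable]: "E m \<in> sets M" for m
    unfolding E_def by measurable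
  have "prob (E m) \<le> exp (- real n)" for m n
  proof -
    let ?I = "\<lambda>w. iprod (\<lambda>j. if 0 < P j w \<and> real m \<le> ?z j w \<and> ?z j w < real (m + n) then 0 else 1)"
    have "prob (E m) = (\<integral>w. indicator (E m) w \<partial>M)"
      by simp
    also have "\<dots> \<le> (\<integral>w. ?I w \<partial>M)"
    proof (rule integral_mono)
      show "integrable M ?I"
        by (intro integrable_const_bound[where B = 1]) (auto simp: iprod_bounds)
      fix w
      show "indicator (E m) w \<le> ?I w"
      proof (cases "w \<in> E m")
        case True
        then have "?I w = iprod (\<lambda>_. 1)"
          unfolding E_def by (intro arg_cong[where f = iprod]) (auto simp: not_le fun_eq_iff)
        then show ?thesis
          by (simp add: indicator_def)
      qed (auto simp: iprod_bounds)
    qed (auto simp: less_top[symmetric] emeasure_finite)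
    also have "\<dots> = exp (- real n)"
      using expectation_band[of 0 "real m" "real (m + n)"] by simp
    finally show ?thesis .
  qed
  moreover have "(\<lambda>n. exp (- real n)) \<longlonglongrightarrow> 0"
    by (intro filterlim_compose[OF exp_at_bot] filterlim_compose[OF filterlim_uminus_at_bot_at_top]
        filterlim_real_sequentially)
  ultimately have "prob (E m) \<le> 0" for m
    by (intro LIMSEQ_le_const) auto
  then have "E m \<in> null_sets M" for m
    by (simp add: null_sets_def emeasure_eq_measure measure_le_0_iff)
  then have "AE w in M. w \<notin> E m" for m
    by (rule AE_not_in)
  then have "AE w in M. \<forall>m. w \<notin> E m"
    by (simp add: AE_all_countable)
  then show ?thesis
    using AE_space
  proof eventually_elim
    case (elim w)
    show ?case
    proof
      assume fin: "finite {j. 0 < P j w}"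
      obtain m :: nat where m: "Max (insert 0 ((\<lambda>j. ?z j w) ` {j. 0 < P j w})) < real m"
        using reals_Archimedean2 by blast
      then have "w \<in> E m"
        using fin elim unfolding E_def by (subst (asm) Max_less_iff) auto
      with elim show False
        by blast
    qed
  qed
qed

end

section \<open>The smallest loss and the interference\<close>

text \<open>For unit-rate points \<open>z\<^sub>j\<close>, \<open>exp (- loss_exponent \<delta> T y s)\<close> is the mean of
  \<open>\<Prod>\<^sub>j 1 / (1 + T * (y / z\<^sub>j) powr \<delta>)\<close> on the event that no \<open>z\<^sub>j\<close> is below \<open>s\<close>.\<close>

definition loss_exponent :: "real \<Rightarrow> real \<Rightarrow> real \<Rightarrow> real \<Rightarrow> real" where
  "loss_exponent \<delta> T y s =
    (LBINT z:{0<..}. if z < s then 1 else T * y powr \<delta> / (z powr \<delta> + T * y powr \<delta>))"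

lemma set_integrable_loss_exponent:
  fixes \<delta> T s y :: real
  assumes "\<delta> > 1" "T \<ge> 0"
  shows "set_integrable lborel {0<..}
    (\<lambda>z. if z < s then 1 else T * y powr \<delta> / (z powr \<delta> + T * y powr \<delta>))"
proof -
  have "integrable lborel (\<lambda>z. indicator {0<..<s} z +
      indicator {0<..} z *\<^sub>R (T * y powr \<delta> / (z powr \<delta> + T * y powr \<delta>)))"
    using set_integrable_interference[of "T * y powr \<delta>" \<delta>] assms unfolding set_integrable_def
    by (intro Bochner_Integration.integrable_add integrable_real_indicator emeasure_bounded_finite
        bounded_subset[OF bounded_closed_interval[of 0 s]]) auto
  then show ?thesis
    unfolding set_integrable_def
    by (rule Bochner_Integration.integrable_bound)
      (use assms in \<open>auto split: split_indicator intro!: add_increasing2\<close>)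
qed

text \<open>The integrand equals 1 below \<open>s\<close>. This yields the bound
  \<open>exp (- s)\<close>, uniform in \<open>y\<close>, for the dominated convergence in
  \<open>expectation_smallest_loss\<close>.\<close>

lemma loss_exponent_ge:
  assumes "\<delta> > 1" "T \<ge> 0" "s \<ge> 0"
  shows "s \<le> loss_exponent \<delta> T y s"
proof -
  have "s = (\<integral>z. indicator {0<..<s} z \<partial>lborel)"
    using assms by simp
  also have "\<dots> \<le> loss_exponent \<delta> T y s"
    using set_integrable_loss_exponent[of \<delta> T s y] assms
    unfolding loss_exponent_def set_lebesgue_integral_def set_integrable_def
    by (intro integral_mono integrable_real_indicator) (auto split: split_indicator)
  finally show ?thesis .
qed

lemma loss_exponent_measurable [measurable (raw)]:
  assumes [measurable]: "f \<in> borel_measurable M" "g \<in> borel_measurable M"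
  shows "(\<lambda>x. loss_exponent \<delta> T (f x) (g x)) \<in> borel_measurable M"
  unfolding loss_exponent_def set_lebesgue_integral_def by measurable

text \<open>Raising the cut-off past \<open>z\<close> lifts the integrand there from the quotient to
  1, so the exponent grows at rate
  \<open>z powr \<delta> / (z powr \<delta> + T * y powr \<delta>)\<close>, and
  \<open>- exp (- loss_exponent \<delta> T y z)\<close> is a primitive. The half-open interval
  matches a dyadic cell.\<close>

lemma exp_loss_exponent_diff:
  assumes "\<delta> > 1" "T > 0" "y \<ge> 0" "0 \<le> s" "s \<le> t"
  shows "(\<integral>\<^sup>+z\<in>{s..<t} \<inter> {0<..}. ennreal (z powr \<delta> / (z powr \<delta> + T * y powr \<delta>) * exp (- loss_exponent \<delta> T y z)) \<partial>lborel)
    = ennreal (exp (- loss_exponent \<delta> T y s) - exp (- loss_exponent \<delta> T y t))"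
proof -
  \<comment> \<open>The case \<open>y = 0\<close> occurs in the first dyadic cell. There the
    quotient is 1 for \<open>z > 0\<close> but \<open>0 / 0 = 0\<close> at \<open>z = 0\<close>; the
    constant value 1 makes \<open>u\<close> continuous.\<close>
  define u where "u z = (if y = 0 then 1 else z powr \<delta> / (z powr \<delta> + T * y powr \<delta>))" for z :: real
  define C where "C = loss_exponent \<delta> T y 0"
  have pos: "z powr \<delta> + T * y powr \<delta> > 0" if "y > 0" for z
    using that \<open>T > 0\<close> by (intro add_nonneg_pos) auto
  have u_eq: "u z = z powr \<delta> / (z powr \<delta> + T * y powr \<delta>)" if "z > 0" for z
    using that by (simp add: u_def)
  have cont: "continuous_on {0..r} u" for r
  proof (cases "y = 0")
    case False
    with \<open>y \<ge> 0\<close> have "y > 0"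
      by simp
    then have "z powr \<delta> + T * y powr \<delta> \<noteq> 0" for z
      using pos[of z] by simp
    then have "continuous_on {0..r} (\<lambda>z. z powr \<delta> / (z powr \<delta> + T * y powr \<delta>))"
      using \<open>\<delta> > 1\<close> by (intro continuous_on_divide continuous_on_add continuous_on_powr' continuous_intros) auto
    then show ?thesis
      using False by (simp add: u_def)
  qed (simp add: u_def)
  have u_nonneg: "0 \<le> u z" for z
    using \<open>T > 0\<close> by (auto simp: u_def intro!: divide_nonneg_nonneg)
  \<comment> \<open>The half-line integral is confined to the constant \<open>C\<close>; what
    depends on \<open>r\<close> is an integral over a compact interval.\<close>
  have L: "loss_exponent \<delta> T y r = C + integral {0..r} u" if "r \<ge> 0" for r
  proof -
    have "loss_exponent \<delta> T y r - C
        = (LBINT z:{0<..}. (if z < r then 1 else T * y powr \<delta> / (z powr \<delta> + T * y powr \<delta>))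
            - (if z < 0 then 1 else T * y powr \<delta> / (z powr \<delta> + T * y powr \<delta>)))"
      unfolding loss_exponent_def C_def
      using set_integrable_loss_exponent[of \<delta> T _ y] assms by (intro set_integral_diff(2)[symmetric]) auto
    also have "\<dots> = (LBINT z:{0..r}. u z)"
      unfolding set_lebesgue_integral_def
    proof (rule integral_cong_AE)
      have "AE z in lborel. z \<noteq> (0::real)" "AE z in lborel. z \<noteq> r"
        by (auto intro!: AE_lborel_singleton)
      then show "AE z in lborel. indicator {0<..} z *\<^sub>R ((if z < r then 1 else T * y powr \<delta> / (z powr \<delta> + T * y powr \<delta>))
            - (if z < 0 then 1 else T * y powr \<delta> / (z powr \<delta> + T * y powr \<delta>))) = indicator {0..r} z *\<^sub>R u z"
      proof eventually_elim
        case (elim z)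
        show ?case
        proof (cases "z > 0")
          case True
          have "z powr \<delta> + T * y powr \<delta> > 0"
            using True \<open>T > 0\<close> by (intro add_pos_nonneg) auto
          then have "1 - T * y powr \<delta> / (z powr \<delta> + T * y powr \<delta>) = z powr \<delta> / (z powr \<delta> + T * y powr \<delta>)"
            by (simp add: field_simps)
          then show ?thesis
            using True elim by (auto simp: u_eq indicator_def)
        qed (use elim in \<open>auto simp: indicator_def\<close>)
      qed
      show "(\<lambda>z. indicator {0..r} z *\<^sub>R u z) \<in> borel_measurable lborel"
        unfolding u_def by measurable
    qed measurable
    also have "\<dots> = integral {0..r} u"
      by (intro set_borel_integral_eq_integral(2) borel_integrable_atLeastAtMost' cont)
    finally show ?thesis
      by simp
  qed
  have der: "((\<lambda>r. integral {0..r} u) has_real_derivative u z) (at z within {s..t})" if "s \<le> z" "z \<le> t" for z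
    using that assms
    by (intro DERIV_subset[OF integral_has_real_derivative[OF cont[of t]]]) auto
  let ?E = "\<lambda>z. exp (- (C + integral {0..z} u))"
  have contE: "continuous_on {s..t} ?E"
    by (intro continuous_intros)
      (use DERIV_continuous[OF der] in \<open>auto simp: continuous_on_eq_continuous_within\<close>)
  have contuE: "continuous_on {s..t} (\<lambda>z. u z * ?E z)"
    using assms by (intro continuous_on_mult contE continuous_on_subset[OF cont[of t]]) auto
  have "(\<integral>z. indicator {s..t} z *\<^sub>R (u z * ?E z) \<partial>lborel) = - ?E t - - ?E s"
  proof (rule integral_FTC_atLeastAtMost[OF \<open>s \<le> t\<close> _ contuE])
    fix z assume z: "s \<le> z" "z \<le> t"
    have "((\<lambda>z. - ?E z) has_real_derivative u z * ?E z) (at z within {s..t})"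
      by (auto intro!: derivative_eq_intros der[OF z])
    then show "((\<lambda>z. - ?E z) has_vector_derivative u z * ?E z) (at z within {s..t})"
      by (simp add: has_real_derivative_iff_has_vector_derivative)
  qed
  moreover have "integrable lborel (\<lambda>z. indicator {s..t} z *\<^sub>R (u z * ?E z))"
    using borel_integrable_atLeastAtMost'[OF contuE] by (simp add: set_integrable_def)
  ultimately have "(\<integral>\<^sup>+z. ennreal (indicator {s..t} z *\<^sub>R (u z * ?E z)) \<partial>lborel) = ennreal (?E s - ?E t)"
    using u_nonneg by (subst nn_integral_eq_integral) auto
  moreover have "(\<integral>\<^sup>+z\<in>{s..<t} \<inter> {0<..}. ennreal (z powr \<delta> / (z powr \<delta> + T * y powr \<delta>) * exp (- loss_exponent \<delta> T y z)) \<partial>lborel)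
    = (\<integral>\<^sup>+z. ennreal (indicator {s..t} z *\<^sub>R (u z * ?E z)) \<partial>lborel)"
  proof (rule nn_integral_cong_AE)
    have "AE z in lborel. z \<noteq> (0::real)" "AE z in lborel. z \<noteq> t"
      by (auto intro!: AE_lborel_singleton)
    then show "AE z in lborel. ennreal (z powr \<delta> / (z powr \<delta> + T * y powr \<delta>) * exp (- loss_exponent \<delta> T y z)) * indicator ({s..<t} \<inter> {0<..}) z
      = ennreal (indicator {s..t} z *\<^sub>R (u z * ?E z))"
      by eventually_elim (use \<open>0 \<le> s\<close> in \<open>auto simp: u_eq L indicator_def\<close>)
  qed
  ultimately show ?thesis
    using assms by (simp add: L)
qed

text \<open>The integrand increases with \<open>y\<close>, so \<open>d n \<le> z\<close> makes its
  value at \<open>z\<close> a majorant.\<close>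

lemma loss_exponent_tendsto:
  assumes "\<delta> > 1" "T \<ge> 0" "z > 0" and d: "d \<longlonglongrightarrow> z" "\<And>n. 0 \<le> d n" "\<And>n. d n \<le> z"
  shows "(\<lambda>n. loss_exponent \<delta> T (d n) s) \<longlonglongrightarrow> loss_exponent \<delta> T z s"
  unfolding loss_exponent_def set_lebesgue_integral_def
proof (rule integral_dominated_convergence)
  let ?f = "\<lambda>y r. indicator {0<..} r *\<^sub>R (if r < s then 1 else T * y powr \<delta> / (r powr \<delta> + T * y powr \<delta>))"
  show "integrable lborel (?f z)"
    using set_integrable_loss_exponent[of \<delta> T s z] assms by (simp add: set_integrable_def)
  have "(\<lambda>n. ?f (d n) r) \<longlonglongrightarrow> ?f z r" for r
  proof (cases "r > 0")
    case True
    then have "r powr \<delta> + T * z powr \<delta> \<noteq> 0"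
      using \<open>T \<ge> 0\<close> by (intro less_imp_neq[symmetric] add_pos_nonneg) auto
    then have "(\<lambda>n. T * d n powr \<delta> / (r powr \<delta> + T * d n powr \<delta>)) \<longlonglongrightarrow> T * z powr \<delta> / (r powr \<delta> + T * z powr \<delta>)"
      using \<open>z > 0\<close> by (intro tendsto_intros d) auto
    then show ?thesis
      using True by simp
  qed auto
  then show "AE r in lborel. (\<lambda>n. ?f (d n) r) \<longlonglongrightarrow> ?f z r"
    by simp
  have "norm (?f (d n) r) \<le> ?f z r" for n r
  proof (cases "r > 0")
    case True
    then have p: "r powr \<delta> > 0"
      by simp
    have le: "T * d n powr \<delta> \<le> T * z powr \<delta>"
      using assms by (intro mult_left_mono powr_mono2) auto
    have "T * d n powr \<delta> / (r powr \<delta> + T * d n powr \<delta>) \<le> T * z powr \<delta> / (r powr \<delta> + T * z powr \<delta>)"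
    proof -
      have "0 < r powr \<delta> + T * d n powr \<delta>" "0 < r powr \<delta> + T * z powr \<delta>"
        using p \<open>T \<ge> 0\<close> by (auto intro!: add_pos_nonneg)
      then show ?thesis
        using mult_right_mono[OF le, of "r powr \<delta>"] p by (simp add: field_simps)
    qed
    then show ?thesis
      using True \<open>T \<ge> 0\<close> by (auto intro: divide_nonneg_nonneg)
  qed auto
  then show "AE r in lborel. norm (?f (d n) r) \<le> ?f z r" for n
    by simp
qed measurable

section \<open>Dyadic approximation from below\<close>

definition dyadic :: "nat \<Rightarrow> real \<Rightarrow> real" where
  "dyadic n z = real (nat \<lfloor>2 ^ n * z\<rfloor>) / 2 ^ n"

lemma dyadic_measurable [measurable (raw)]:
  assumes [measurable]: "f \<in> borel_measurable M"
  shows "(\<lambda>x. dyadic n (f x)) \<in> borel_measurable M"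
  unfolding dyadic_def by measurable

lemma dyadic_bounds:
  assumes "z \<ge> 0"
  shows "0 \<le> dyadic n z" "dyadic n z \<le> z" "z \<le> dyadic n z + (1 / 2) ^ n"
proof -
  have "real (nat \<lfloor>2 ^ n * z\<rfloor>) = of_int \<lfloor>2 ^ n * z\<rfloor>"
    using assms by simp
  then have "real (nat \<lfloor>2 ^ n * z\<rfloor>) \<le> 2 ^ n * z" "2 ^ n * z \<le> real (nat \<lfloor>2 ^ n * z\<rfloor>) + 1"
    by linarith+
  then show "dyadic n z \<le> z" "z \<le> dyadic n z + (1 / 2) ^ n"
    unfolding dyadic_def
    by (simp_all add: divide_le_eq power_one_over le_divide_eq mult.commute flip: add_divide_distrib)
qed (simp add: dyadic_def)

lemma dyadic_tendsto:
  assumes "z \<ge> 0"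
  shows "(\<lambda>n. dyadic n z) \<longlonglongrightarrow> z"
proof (rule tendsto_sandwich[of "\<lambda>n. z - (1 / 2) ^ n" _ _ "\<lambda>_. z"])
  show "(\<lambda>n. z - (1 / 2) ^ n) \<longlonglongrightarrow> z"
    using tendsto_diff[OF tendsto_const[of z] LIMSEQ_realpow_zero[of "1/2"]] by simp
  show "\<forall>\<^sub>F n in sequentially. z - (1 / 2) ^ n \<le> dyadic n z"
    using dyadic_bounds(3)[OF assms] by (auto intro!: always_eventually simp: algebra_simps)
qed (use dyadic_bounds(2)[OF assms] in auto)

text \<open>Because of this monotonicity the factors of \<open>fading_transform\<close> at the
  rounded argument decrease with \<open>n\<close>, as \<open>iprod_decreasing_limit\<close>
  requires.\<close>

lemma dyadic_incseq: "incseq (\<lambda>n. dyadic n z)"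
proof (rule incseq_SucI)
  fix n
  have "2 * \<lfloor>2 ^ n * z\<rfloor> \<le> \<lfloor>2 * (2 ^ n * z)\<rfloor>"
    by linarith
  then have "2 * nat \<lfloor>2 ^ n * z\<rfloor> \<le> nat \<lfloor>2 ^ Suc n * z\<rfloor>"
    by (simp add: mult.assoc)
  then have "real (2 * nat \<lfloor>2 ^ n * z\<rfloor>) \<le> real (nat \<lfloor>2 ^ Suc n * z\<rfloor>)"
    by (simp only: of_nat_le_iff)
  then show "dyadic n z \<le> dyadic (Suc n) z"
    by (simp add: dyadic_def field_simps)
qed

lemma dyadic_eq_iff:
  assumes "z \<ge> 0"
  shows "nat \<lfloor>2 ^ n * z\<rfloor> = k \<longleftrightarrow> real k / 2 ^ n \<le> z \<and> z < real (Suc k) / 2 ^ n"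
proof -
  have "nat \<lfloor>2 ^ n * z\<rfloor> = k \<longleftrightarrow> \<lfloor>2 ^ n * z\<rfloor> = int k"
    using assms by auto
  also have "\<dots> \<longleftrightarrow> real k \<le> 2 ^ n * z \<and> 2 ^ n * z < real k + 1"
    by (simp add: floor_eq_iff)
  finally show ?thesis
    by (simp add: divide_le_eq less_divide_eq mult.commute add.commute)
qed

lemma nn_integral_split_nat:
  assumes [measurable]: "f \<in> borel_measurable M" "k \<in> measurable M (count_space UNIV)"
  shows "(\<integral>\<^sup>+x. f x \<partial>M) = (\<Sum>i::nat. \<integral>\<^sup>+x. (if k x = i then f x else 0) \<partial>M)"
proof -
  have "(\<Sum>i. if k x = i then f x else 0) = f x" for x
    by (subst suminf_finite[of "{k x}"]) auto
  then have "(\<integral>\<^sup>+x. f x \<partial>M) = (\<integral>\<^sup>+x. (\<Sum>i. if k x = i then f x else 0) \<partial>M)"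
    by simp
  also have "\<dots> = (\<Sum>i. \<integral>\<^sup>+x. (if k x = i then f x else 0) \<partial>M)"
    by (rule nn_integral_suminf) measurable
  finally show ?thesis .
qed

lemma powr_left_le_iff:
  fixes x y p :: real
  assumes "0 \<le> x" "0 \<le> y" "0 < p"
  shows "x powr p \<le> y powr p \<longleftrightarrow> x \<le> y"
  using assms powr_mono2[of p x y] powr_less_mono2[of p y x] by (auto simp: not_le[symmetric])

lemma exp_minus_integrable: "integrable lborel (\<lambda>z::real. indicator {0<..} z *\<^sub>R exp (- z))"
proof -
  interpret E: prob_space "density lborel (exponential_density 1)"
    by (rule prob_space_exponential_density) simp
  have "(\<integral>\<^sup>+z. ennreal (exponential_density 1 z) \<partial>lborel) = 1"
    using E.emeasure_space_1 by (simp add: emeasure_density)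
  then have "integrable lborel (exponential_density 1)"
    by (intro integrableI_nonneg) (auto simp: exponential_density_nonneg)
  then show ?thesis
    by (rule Bochner_Integration.integrable_bound)
      (auto simp: exponential_density_def split: split_indicator)
qed

context poisson_strengths
begin

text \<open>The supremum in \<open>ennreal\<close> is measurable without choosing a strongest
  station; where the maximum is attained, \<open>smallest_loss_eq\<close> recovers the loss of that
  station.\<close>

definition smallest_loss :: "'w \<Rightarrow> real" where
  "smallest_loss w = enn2real (SUP j. ennreal (P j w)) powr (- 1 / \<delta>)"

lemma smallest_loss_measurable [measurable]: "smallest_loss \<in> borel_measurable M"
  unfolding smallest_loss_def by measurable

lemma AE_strongest: "AE w in M. \<exists>k. 0 < P k w \<and> (\<forall>j. P j w \<le> P k w)"
  using AE_summable AE_infinite_positive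
proof eventually_elim
  case (elim w)
  then have "{j. 0 < P j w} \<noteq> {}"
    using infinite_imp_nonempty by blast
  then obtain i where "0 < P i w"
    by blast
  then show ?case
    using summable_attains_maximum[OF elim(1), of i UNIV] by auto
qed

lemma smallest_loss_eq:
  assumes "\<And>j. P j w \<le> P k w"
  shows "smallest_loss w = P k w powr (- 1 / \<delta>)"
proof -
  have "(SUP j. ennreal (P j w)) = ennreal (P k w)"
    using assms by (intro antisym SUP_least SUP_upper) (auto intro: ennreal_leI)
  then show ?thesis
    by (simp add: smallest_loss_def P_nonneg)
qed

text \<open>Turns the event into one condition per station, so that its indicator becomes a product
  over stations. The form \<open>s powr \<delta> * P j w \<le> 1\<close> also covers strength
  0.\<close>

lemma le_smallest_loss_iff:
  assumes k: "0 < P k w" "\<And>j. P j w \<le> P k w" and "0 \<le> s"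
  shows "s \<le> smallest_loss w \<longleftrightarrow> (\<forall>j. s powr \<delta> * P j w \<le> 1)"
proof -
  have "s \<le> smallest_loss w \<longleftrightarrow> s powr \<delta> \<le> (P k w powr (- 1 / \<delta>)) powr \<delta>"
    unfolding smallest_loss_eq[of w k, OF k(2)]
    using \<open>0 \<le> s\<close> \<delta> by (simp add: powr_left_le_iff)
  also have "(P k w powr (- 1 / \<delta>)) powr \<delta> = 1 / P k w"
  proof -
    have "- 1 / \<delta> * \<delta> = - 1"
      using \<delta> by simp
    then show ?thesis
      using k by (simp only: powr_powr) (simp add: powr_minus_divide)
  qed
  also have "s powr \<delta> \<le> 1 / P k w \<longleftrightarrow> s powr \<delta> * P k w \<le> 1"
    using k by (simp add: le_divide_eq)
  also have "\<dots> \<longleftrightarrow> (\<forall>j. s powr \<delta> * P j w \<le> 1)"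
    using k(2) by (meson mult_left_mono order_trans powr_ge_zero)
  finally show ?thesis .
qed

text \<open>The conditional Laplace transform, given the strengths, of the total faded power at
  argument \<open>T * y powr \<delta>\<close>: unit exponential fading gives
  \<open>1 / (1 + q)\<close> for each station, the serving one included.\<close>

definition fading_transform :: "real \<Rightarrow> real \<Rightarrow> 'w \<Rightarrow> real" where
  "fading_transform T y w = iprod (\<lambda>j. 1 / (1 + T * y powr \<delta> * P j w))"

lemma fading_transform_measurable [measurable (raw)]:
  assumes [measurable]: "f \<in> borel_measurable M"
  shows "(\<lambda>w. fading_transform T (f w) w) \<in> borel_measurable M"
  unfolding fading_transform_def by measurable

lemma fading_factor_bounds:
  assumes "T \<ge> 0"
  shows "0 \<le> 1 / (1 + T * y powr \<delta> * P j w)" "1 / (1 + T * y powr \<delta> * P j w) \<le> 1"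
  using assms P_nonneg[of j w] by (auto simp: divide_le_eq_1 intro!: divide_nonneg_nonneg add_nonneg_nonneg)

lemma fading_transform_bounds:
  assumes "T \<ge> 0"
  shows "0 \<le> fading_transform T y w" "fading_transform T y w \<le> 1"
  unfolding fading_transform_def
  by (rule iprod_bounds; use fading_factor_bounds[OF assms] in blast)+

text \<open>By \<open>le_smallest_loss_iff\<close> the indicator is absorbed into the test function,
  which is set to 0 for points below \<open>s\<close>; this produces the value 1 in the integrand of
  \<open>loss_exponent\<close>.\<close>

lemma expectation_fading_transform:
  assumes "T > 0" "0 \<le> y" "0 \<le> s"
  shows "(\<integral>w. indicator {w. s \<le> smallest_loss w} w * fading_transform T y w \<partial>M)
    = exp (- loss_exponent \<delta> T y s)"
proof -
  let ?b = "\<lambda>q. 1 / (1 + T * y powr \<delta> * max 0 q)"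
  let ?v = "\<lambda>q. if s powr \<delta> * max 0 q \<le> 1 then ?b q else 0"
  have b01: "0 \<le> ?b q" "?b q \<le> 1" for q
    using \<open>T > 0\<close> by (auto simp: divide_le_eq_1)
  then have v01: "0 \<le> ?v q" "?v q \<le> 1" for q
    by auto
  have eq: "1 - ?v (z powr - \<delta>) = (if z < s then 1 else T * y powr \<delta> / (z powr \<delta> + T * y powr \<delta>))"
    if "z > 0" for z
  proof -
    have p: "z powr \<delta> > 0"
      using that by simp
    have "s powr \<delta> * z powr - \<delta> \<le> 1 \<longleftrightarrow> s powr \<delta> \<le> z powr \<delta>"
      using p by (simp add: powr_minus field_simps)
    also have "\<dots> \<longleftrightarrow> \<not> z < s"
      using that \<open>0 \<le> s\<close> \<delta> by (simp add: powr_left_le_iff not_less)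
    moreover have "0 < z powr \<delta> + T * y powr \<delta>"
      using p \<open>T > 0\<close> by (intro add_pos_nonneg) auto
    then have "1 - 1 / (1 + T * y powr \<delta> * z powr - \<delta>) = T * y powr \<delta> / (z powr \<delta> + T * y powr \<delta>)"
      using p \<open>T > 0\<close> by (simp add: powr_minus divide_simps)
    ultimately show ?thesis
      by simp
  qed
  have int: "set_integrable lborel {0<..} (\<lambda>z. 1 - ?v (z powr - \<delta>))"
    using set_integrable_loss_exponent[of \<delta> T s y] \<delta> \<open>T > 0\<close>
    by (subst set_integrable_cong[OF refl refl eq]) auto
  have "(LBINT z:{0<..}. 1 - ?v (z powr - \<delta>)) = loss_exponent \<delta> T y s"
    unfolding loss_exponent_def by (rule set_lebesgue_integral_cong) (use eq in auto)
  then have "exp (- loss_exponent \<delta> T y s) = (\<integral>w. iprod (\<lambda>j. ?v (P j w)) \<partial>M)"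
    using laplace[of ?v] v01 int by auto
  also have "\<dots> = (\<integral>w. indicator {w. s \<le> smallest_loss w} w * fading_transform T y w \<partial>M)"
  proof (rule integral_cong_AE)
    show "AE w in M. iprod (\<lambda>j. ?v (P j w)) = indicator {w. s \<le> smallest_loss w} w * fading_transform T y w"
      using AE_strongest
    proof eventually_elim
      case (elim w)
      then obtain k where k: "0 < P k w" "\<And>j. P j w \<le> P k w"
        by blast
      show ?case
      proof (cases "\<forall>j. s powr \<delta> * P j w \<le> 1")
        case True
        then have "s \<le> smallest_loss w"
          using le_smallest_loss_iff[OF k \<open>0 \<le> s\<close>] by simp
        then show ?thesis
          using True P_nonneg by (simp add: fading_transform_def)
      next
        case False
        then have "\<not> s \<le> smallest_loss w"
          using le_smallest_loss_iff[OF k \<open>0 \<le> s\<close>] by simp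
        moreover obtain i where "\<not> s powr \<delta> * P i w \<le> 1"
          using False by blast
        then have "iprod (\<lambda>j. ?v (P j w)) = 0"
          using P_nonneg by (intro iprod_eq_0[of _ i] v01) simp_all
        ultimately show ?thesis
          by simp
      qed
    qed
  qed measurable
  finally show ?thesis ..
qed

text \<open>Both sides are constant in the discretised argument on each dyadic interval, where the identity is
  the fundamental theorem of calculus applied to \<open>expectation_fading_transform\<close> in the variable \<open>s\<close>.\<close>

lemma expectation_smallest_loss_discretised:
  assumes "T > 0" and \<phi>: "\<And>z. 0 \<le> \<phi> z" and [measurable]: "\<phi> \<in> borel_measurable borel"
  shows "(\<integral>\<^sup>+w. ennreal (\<phi> (dyadic n (smallest_loss w)) * fading_transform T (dyadic n (smallest_loss w)) w) \<partial>M)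
    = (\<integral>\<^sup>+z\<in>{0<..}. ennreal (\<phi> (dyadic n z) * (z powr \<delta> / (z powr \<delta> + T * dyadic n z powr \<delta>)
        * exp (- loss_exponent \<delta> T (dyadic n z) z))) \<partial>lborel)"
proof -
  let ?Z = smallest_loss
  let ?H = "fading_transform T"
  let ?L = "loss_exponent \<delta> T"
  let ?u = "\<lambda>y z. z powr \<delta> / (z powr \<delta> + T * y powr \<delta>) * exp (- ?L y z)"
  let ?k = "\<lambda>z::real. nat \<lfloor>2 ^ n * z\<rfloor>"
  have H: "0 \<le> ?H y w" "?H y w \<le> 1" for y w
    using fading_transform_bounds[of T] \<open>T > 0\<close> by auto
  have Z0: "0 \<le> ?Z w" for w
    by (simp add: smallest_loss_def)
  have [measurable]: "(\<lambda>w. ?k (?Z w)) \<in> measurable M (count_space UNIV)"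
    "?k \<in> measurable lborel (count_space UNIV)"
    by measurable
  have "(\<integral>\<^sup>+w. (if ?k (?Z w) = k then ennreal (\<phi> (dyadic n (?Z w)) * ?H (dyadic n (?Z w)) w) else 0) \<partial>M)
      = (\<integral>\<^sup>+z. (if ?k z = k then ennreal (\<phi> (dyadic n z) * ?u (dyadic n z) z) * indicator {0<..} z else 0) \<partial>lborel)" for k
  proof -
    let ?s = "real k / 2 ^ n" and ?t = "real (Suc k) / 2 ^ n"
    have st: "0 \<le> ?s" "?s \<le> ?t" "0 \<le> ?t"
      by (auto simp: divide_right_mono)
    \<comment> \<open>The indicator that \<open>smallest_loss\<close> lies in cell \<open>k\<close>,
      times the transform at the left endpoint: a difference of two variables whose means are known,
      both with the same constant \<open>y\<close>.\<close>
    let ?D = "\<lambda>w. indicator {w. ?s \<le> ?Z w} w * ?H ?s w - indicator {w. ?t \<le> ?Z w} w * ?H ?s w"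
    have int: "integrable M (\<lambda>w. indicator {w. r \<le> ?Z w} w * ?H ?s w)" for r
      by (rule integrable_const_bound[where B = 1]) (use H in \<open>auto simp: indicator_def\<close>)
    have D: "?D w = (if ?s \<le> ?Z w \<and> ?Z w < ?t then ?H ?s w else 0)" for w
      using st by (auto simp: indicator_def)
    have "(\<integral>\<^sup>+w. (if ?k (?Z w) = k then ennreal (\<phi> (dyadic n (?Z w)) * ?H (dyadic n (?Z w)) w) else 0) \<partial>M)
        = (\<integral>\<^sup>+w. ennreal (\<phi> ?s) * ennreal (?D w) \<partial>M)"
    proof (rule nn_integral_cong)
      fix w
      show "(if ?k (?Z w) = k then ennreal (\<phi> (dyadic n (?Z w)) * ?H (dyadic n (?Z w)) w) else 0)
        = ennreal (\<phi> ?s) * ennreal (?D w)"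
        unfolding D using dyadic_eq_iff[OF Z0[of w], of n k] \<phi> H
        by (auto simp: dyadic_def ennreal_mult)
    qed
    also have "\<dots> = ennreal (\<phi> ?s) * ennreal (\<integral>w. ?D w \<partial>M)"
    proof -
      have "0 \<le> ?D w" for w
        unfolding D using H by auto
      then show ?thesis
        using int by (subst nn_integral_cmult) (auto simp: nn_integral_eq_integral)
    qed
    also have "(\<integral>w. ?D w \<partial>M) = exp (- ?L ?s ?s) - exp (- ?L ?s ?t)"
      using expectation_fading_transform[OF \<open>T > 0\<close> st(1) st(1)]
        expectation_fading_transform[OF \<open>T > 0\<close> st(1) st(3)] int by simp
    also have "ennreal (\<dots>) = (\<integral>\<^sup>+z\<in>{?s..<?t} \<inter> {0<..}. ennreal (?u ?s z) \<partial>lborel)"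
      using exp_loss_exponent_diff[OF \<delta> \<open>T > 0\<close> st(1) st(1) st(2)] by simp
    also have "ennreal (\<phi> ?s) * \<dots> = (\<integral>\<^sup>+z. ennreal (\<phi> ?s) * (ennreal (?u ?s z) * indicator ({?s..<?t} \<inter> {0<..}) z) \<partial>lborel)"
      by (subst nn_integral_cmult) auto
    also have "\<dots> = (\<integral>\<^sup>+z. (if ?k z = k then ennreal (\<phi> (dyadic n z) * ?u (dyadic n z) z) * indicator {0<..} z else 0) \<partial>lborel)"
    proof (rule nn_integral_cong)
      fix z
      have u: "0 \<le> ?u y z" for y
        using \<open>T > 0\<close> by (intro mult_nonneg_nonneg divide_nonneg_nonneg add_nonneg_nonneg) auto
      show "ennreal (\<phi> ?s) * (ennreal (?u ?s z) * indicator ({?s..<?t} \<inter> {0<..}) z)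
        = (if ?k z = k then ennreal (\<phi> (dyadic n z) * ?u (dyadic n z) z) * indicator {0<..} z else 0)"
      proof (cases "z > 0")
        case z: True
        show ?thesis
        proof (cases "?k z = k")
          case True
          then have "dyadic n z = ?s" "z \<in> {?s..<?t} \<inter> {0<..}"
            using z dyadic_eq_iff[of z n k] by (auto simp: dyadic_def)
          then show ?thesis
            using True z by (simp only: ennreal_mult[OF \<phi> u]) (simp add: indicator_def)
        next
          case False
          then show ?thesis
            using z dyadic_eq_iff[of z n k] by (auto simp: indicator_def)
        qed
      qed auto
    qed
    finally show ?thesis .
  qed
  note eq = this
  have "(\<integral>\<^sup>+w. ennreal (\<phi> (dyadic n (?Z w)) * ?H (dyadic n (?Z w)) w) \<partial>M)
      = (\<Sum>k. \<integral>\<^sup>+w. (if ?k (?Z w) = k then ennreal (\<phi> (dyadic n (?Z w)) * ?H (dyadic n (?Z w)) w) else 0) \<partial>M)"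
    by (rule nn_integral_split_nat) measurable
  also have "\<dots> = (\<integral>\<^sup>+z\<in>{0<..}. ennreal (\<phi> (dyadic n z) * ?u (dyadic n z) z) \<partial>lborel)"
    unfolding eq by (rule nn_integral_split_nat[symmetric]) measurable
  finally show ?thesis .
qed

text \<open>Let \<open>n\<close> tend to infinity in the discretised identity; the integrands are
  bounded by 1 on the left and by \<open>exp (- z)\<close> on the right. At \<open>y = z\<close> the
  quotient in the density is \<open>1 / (1 + T)\<close>.\<close>

lemma expectation_smallest_loss:
  assumes "T > 0" and \<phi>: "\<And>z. 0 \<le> \<phi> z" "\<And>z. \<phi> z \<le> 1"
    and [measurable]: "\<phi> \<in> borel_measurable borel"
    and cont: "\<And>z. z > 0 \<Longrightarrow> isCont \<phi> z"
  shows "(\<integral>w. \<phi> (smallest_loss w) * fading_transform T (smallest_loss w) w \<partial>M)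
    = (LBINT z:{0<..}. \<phi> z * (1 / (1 + T) * exp (- loss_exponent \<delta> T z z)))"
proof -
  let ?Z = smallest_loss
  let ?H = "fading_transform T"
  let ?L = "loss_exponent \<delta> T"
  let ?u = "\<lambda>y z. z powr \<delta> / (z powr \<delta> + T * y powr \<delta>)"
  have H: "0 \<le> ?H y w" "?H y w \<le> 1" for y w
    using fading_transform_bounds[of T] \<open>T > 0\<close> by auto
  have u: "0 \<le> ?u y z" "?u y z \<le> 1" for y z :: real
  proof -
    have "0 \<le> z powr \<delta>" "0 \<le> T * y powr \<delta>"
      using \<open>T > 0\<close> by auto
    then show "0 \<le> ?u y z" "?u y z \<le> 1"
      unfolding divide_le_eq_1 by (simp, argo)
  qed
  have lim: "(\<lambda>n. \<phi> (dyadic n z)) \<longlonglongrightarrow> \<phi> z" if "z > 0" for z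
    using isCont_tendsto_compose[OF cont[OF that] dyadic_tendsto] that by simp
  have dpow: "(\<lambda>n. dyadic n z powr \<delta>) \<longlonglongrightarrow> z powr \<delta>" if "z > 0" for z
    using that by (intro tendsto_powr dyadic_tendsto tendsto_const) auto
  have left: "(\<lambda>n. \<integral>w. \<phi> (dyadic n (?Z w)) * ?H (dyadic n (?Z w)) w \<partial>M)
      \<longlonglongrightarrow> (\<integral>w. \<phi> (?Z w) * ?H (?Z w) w \<partial>M)"
  proof (rule integral_dominated_convergence[where w = "\<lambda>_. 1"])
    show "AE w in M. (\<lambda>n. \<phi> (dyadic n (?Z w)) * ?H (dyadic n (?Z w)) w) \<longlonglongrightarrow> \<phi> (?Z w) * ?H (?Z w) w"
      using AE_strongest
    proof eventually_elim
      case (elim w)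
      then obtain k where "0 < P k w" "\<And>j. P j w \<le> P k w"
        by blast
      then have Z: "?Z w > 0"
        using smallest_loss_eq[of w k] by simp
      have "(\<lambda>n. ?H (dyadic n (?Z w)) w) \<longlonglongrightarrow> ?H (?Z w) w"
        unfolding fading_transform_def
      proof (rule iprod_decreasing_limit)
        fix j
        have pos: "0 < 1 + T * y powr \<delta> * P j w" for y
          using \<open>T > 0\<close> P_nonneg[of j w] by (intro add_pos_nonneg) auto
        show "decseq (\<lambda>n. 1 / (1 + T * dyadic n (?Z w) powr \<delta> * P j w))"
        proof (rule decseq_SucI)
          fix n
          have "dyadic n (?Z w) powr \<delta> \<le> dyadic (Suc n) (?Z w) powr \<delta>"
            using dyadic_incseq[of "?Z w"] dyadic_bounds(1)[of "?Z w" n] Z \<delta>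
            by (intro powr_mono2) (auto simp: incseq_Suc_iff)
          then have "T * dyadic n (?Z w) powr \<delta> * P j w \<le> T * dyadic (Suc n) (?Z w) powr \<delta> * P j w"
            using \<open>T > 0\<close> P_nonneg[of j w] by (intro mult_right_mono mult_left_mono) auto
          then show "1 / (1 + T * dyadic (Suc n) (?Z w) powr \<delta> * P j w) \<le> 1 / (1 + T * dyadic n (?Z w) powr \<delta> * P j w)"
            using pos by (intro divide_left_mono) auto
        qed
        show "(\<lambda>n. 1 / (1 + T * dyadic n (?Z w) powr \<delta> * P j w)) \<longlonglongrightarrow> 1 / (1 + T * ?Z w powr \<delta> * P j w)"
          using pos[of "?Z w"] by (intro tendsto_intros dpow Z) auto
      qed (use fading_factor_bounds[of T] \<open>T > 0\<close> in auto)
      then show ?case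
        by (intro tendsto_mult lim Z)
    qed
    show "AE w in M. norm (\<phi> (dyadic n (?Z w)) * ?H (dyadic n (?Z w)) w) \<le> 1" for n
      using \<phi> H by (intro AE_I2) (auto simp: abs_mult intro!: mult_le_one)
  qed auto
  let ?g = "\<lambda>y z. indicator {0<..} z *\<^sub>R (\<phi> y * (?u y z * exp (- ?L y z)))"
  have bound: "norm (?g y z) \<le> indicator {0<..} z *\<^sub>R exp (- z)" for y z
  proof (cases "z > 0")
    case True
    then have "exp (- ?L y z) \<le> exp (- z)"
      using loss_exponent_ge[of \<delta> T z y] \<delta> \<open>T > 0\<close> by simp
    moreover have "\<phi> y * ?u y z \<le> 1"
      using \<phi> u by (intro mult_le_one)
    ultimately have "(\<phi> y * ?u y z) * exp (- ?L y z) \<le> 1 * exp (- z)"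
      by (intro mult_mono) auto
    moreover have "0 \<le> (\<phi> y * ?u y z) * exp (- ?L y z)"
      using \<phi> u by (intro mult_nonneg_nonneg) auto
    moreover have "indicator {0<..} z = (1::real)"
      using True by simp
    ultimately show ?thesis
      by (simp only: scaleR_one real_norm_def abs_of_nonneg mult.assoc mult_1)
  qed auto
  have right: "(\<lambda>n. \<integral>z. ?g (dyadic n z) z \<partial>lborel) \<longlonglongrightarrow> (\<integral>z. ?g z z \<partial>lborel)"
  proof (rule integral_dominated_convergence[OF _ _ exp_minus_integrable])
    have "(\<lambda>n. ?g (dyadic n z) z) \<longlonglongrightarrow> ?g z z" for z
    proof (cases "z > 0")
      case True
      have "z powr \<delta> + T * z powr \<delta> \<noteq> 0"
        using True \<open>T > 0\<close> by (intro less_imp_neq[symmetric] add_pos_nonneg) auto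
      moreover have "(\<lambda>n. ?L (dyadic n z) z) \<longlonglongrightarrow> ?L z z"
        using True \<delta> \<open>T > 0\<close>
        by (intro loss_exponent_tendsto dyadic_tendsto dyadic_bounds) auto
      ultimately show ?thesis
        using True by (intro tendsto_intros lim dpow)
    qed auto
    then show "AE z in lborel. (\<lambda>n. ?g (dyadic n z) z) \<longlonglongrightarrow> ?g z z"
      by simp
    show "AE z in lborel. norm (?g (dyadic n z) z) \<le> indicator {0<..} z *\<^sub>R exp (- z)" for n
      using bound by (intro AE_I2)
  qed measurable
  have eq: "(\<integral>w. \<phi> (dyadic n (?Z w)) * ?H (dyadic n (?Z w)) w \<partial>M) = (\<integral>z. ?g (dyadic n z) z \<partial>lborel)" for n
  proof -
    have g0: "0 \<le> ?g y z" for y z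
      using \<phi> u by (intro scaleR_nonneg_nonneg mult_nonneg_nonneg) auto
    have "(\<integral>\<^sup>+w. ennreal (\<phi> (dyadic n (?Z w)) * ?H (dyadic n (?Z w)) w) \<partial>M)
        = (\<integral>\<^sup>+z. ennreal (?g (dyadic n z) z) \<partial>lborel)"
      unfolding expectation_smallest_loss_discretised[OF \<open>T > 0\<close> \<phi>(1) \<open>\<phi> \<in> borel_measurable borel\<close>]
      by (intro nn_integral_cong) (auto simp: indicator_def)
    then show ?thesis
      using \<phi> H g0 by (subst (1 2) integral_eq_nn_integral) auto
  qed
  have "(\<integral>w. \<phi> (?Z w) * ?H (?Z w) w \<partial>M) = (\<integral>z. ?g z z \<partial>lborel)"
    using left right unfolding eq by (rule LIMSEQ_unique)
  also have "\<dots> = (LBINT z:{0<..}. \<phi> z * (1 / (1 + T) * exp (- ?L z z)))"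
    unfolding set_lebesgue_integral_def
  proof (intro Bochner_Integration.integral_cong refl)
    fix z :: real
    show "?g z z = indicator {0<..} z *\<^sub>R (\<phi> z * (1 / (1 + T) * exp (- ?L z z)))"
    proof (cases "z > 0")
      case True
      then have "z powr \<delta> / ((1 + T) * z powr \<delta>) = 1 / (1 + T)"
        by simp
      then have "?u z z = 1 / (1 + T)"
        by (simp add: algebra_simps)
      then show ?thesis
        by simp
    qed auto
  qed
  finally show ?thesis .
qed

end

section \<open>Order statistics\<close>

lemma inverse_ennreal_less_iff:
  assumes "0 \<le> q" "0 \<le> r"
  shows "inverse (ennreal q) < inverse (ennreal r) \<longleftrightarrow> r < q"
proof -
  consider "q = 0" | "q > 0" "r = 0" | "q > 0" "r > 0"
    using assms by linarith
  then show ?thesis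
  proof cases
    case 1
    then show ?thesis
      using assms by (simp add: not_less)
  next
    case 2
    then show ?thesis
      by (simp add: less_top[symmetric])
  next
    case 3
    then show ?thesis
      by (simp add: inverse_ennreal ennreal_less_iff)
  qed
qed

lemma inverse_ennreal_le_iff:
  assumes "0 \<le> q" "0 \<le> r"
  shows "inverse (ennreal q) \<le> inverse (ennreal r) \<longleftrightarrow> r \<le> q"
  using inverse_ennreal_less_iff[OF assms(2,1)] by (simp add: not_less[symmetric])

text \<open>Follows the recursion of \<open>order_loss\<close> with strengths in place of losses:
  the largest strength belongs to the smallest loss, and demanding a positive strength leaves out
  infinite losses.\<close>

primrec ranked :: "(nat \<Rightarrow> real) \<Rightarrow> nat \<Rightarrow> nat" where
  "ranked p 0 = (SOME k. 0 < p k \<and> (\<forall>j. p j \<le> p k))"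
| "ranked p (Suc n) = (SOME k. 0 < p k \<and> p k < p (ranked p n) \<and> (\<forall>j. p j < p (ranked p n) \<longrightarrow> p j \<le> p k))"

locale ranked_sequence =
  fixes p :: "nat \<Rightarrow> real"
  assumes nonneg: "\<And>j. 0 \<le> p j"
    and summable: "summable p"
    and no_ties: "\<And>i j. i \<noteq> j \<Longrightarrow> p i = p j \<Longrightarrow> p i = 0"
    and infinite: "infinite {j. 0 < p j}"
begin

lemma ranked_0: "0 < p (ranked p 0)" "p j \<le> p (ranked p 0)"
proof -
  obtain i where "0 < p i"
    using infinite_imp_nonempty[OF infinite] by auto
  then have "\<exists>k. 0 < p k \<and> (\<forall>j. p j \<le> p k)"
    using summable_attains_maximum[OF summable, of i UNIV] by auto
  from someI_ex[OF this] show "0 < p (ranked p 0)" "p j \<le> p (ranked p 0)"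
    by auto
qed

lemma finite_ge:
  assumes "0 < c"
  shows "finite {j. c \<le> p j}"
proof -
  have "\<forall>\<^sub>F j in sequentially. p j < c"
    using order_tendstoD(2)[OF summable_LIMSEQ_zero[OF summable] assms] .
  then obtain J where "\<And>j. j \<ge> J \<Longrightarrow> p j < c"
    by (auto simp: eventually_sequentially)
  then have "{j. c \<le> p j} \<subseteq> {..<J}"
    by (auto simp: not_le[symmetric])
  then show ?thesis
    by (rule finite_subset) simp
qed

text \<open>Only finitely many strengths reach \<open>c\<close>, so some of the infinitely many
  positive ones lie below it, and \<open>summable_attains_maximum\<close> finds the largest of
  these.\<close>

lemma next_rank_exists:
  assumes "0 < c"
  shows "\<exists>k. 0 < p k \<and> p k < c \<and> (\<forall>j. p j < c \<longrightarrow> p j \<le> p k)"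
proof -
  have "\<not> {j. 0 < p j} \<subseteq> {j. c \<le> p j}"
    using infinite finite_subset[OF _ finite_ge[OF assms]] by blast
  then have "\<exists>i. 0 < p i \<and> \<not> c \<le> p i"
    by blast
  then obtain i where "0 < p i" "p i < c"
    by (auto simp: not_le)
  then show ?thesis
    using summable_attains_maximum[OF summable, of i "{j. p j < c}"] by auto
qed

lemma ranked_pos: "0 < p (ranked p n)"
proof (induction n)
  case (Suc n)
  from someI_ex[OF next_rank_exists[OF Suc]] show ?case
    by simp
qed (rule ranked_0)

lemma ranked_Suc:
  shows "p (ranked p (Suc n)) < p (ranked p n)"
    "p j < p (ranked p n) \<Longrightarrow> p j \<le> p (ranked p (Suc n))"
  using someI_ex[OF next_rank_exists[OF ranked_pos[of n]]] by auto

lemma inj_ranked: "inj (ranked p)"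
proof -
  have "strict_mono (\<lambda>n. - p (ranked p n))"
    using ranked_Suc(1) by (simp add: strict_mono_Suc_iff del: ranked.simps)
  then have "inj (\<lambda>n. - p (ranked p n))"
    by (rule strict_mono_imp_inj_on)
  then show ?thesis
    by (auto simp: inj_on_def)
qed

text \<open>A positive strength that is never ranked would stay below all ranked ones, so infinitely
  many terms would be at least as large, against \<open>finite_ge\<close>.\<close>

lemma bij_ranked: "bij_betw (ranked p) UNIV {j. 0 < p j}"
  unfolding bij_betw_def
proof (intro conjI inj_ranked equalityI subsetI)
  fix j assume j: "j \<in> {j. 0 < p j}"
  show "j \<in> range (ranked p)"
  proof (rule ccontr)
    assume notin: "j \<notin> range (ranked p)"
    have neq: "p j \<noteq> p (ranked p n)" for n
      using no_ties[of j "ranked p n"] ranked_pos[of n] notin by auto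
    have less: "p j < p (ranked p n)" for n
    proof (induction n)
      case 0
      show ?case
        using ranked_0(2)[of j] neq[of 0] by (simp add: less_le)
    next
      case (Suc n)
      show ?case
        using ranked_Suc(2)[OF Suc] neq[of "Suc n"] by (simp add: less_le)
    qed
    have "range (ranked p) \<subseteq> {i. p j \<le> p i}"
      using less by (auto intro: less_imp_le)
    then show False
      using finite_ge[of "p j"] j range_inj_infinite[OF inj_ranked] by (auto dest: finite_subset)
  qed
qed (use ranked_pos in auto)

end

text \<open>One realisation of the network. The statements are deterministic; in the model the
  hypotheses hold almost surely.\<close>

locale ranked_network = ranked_sequence p for p :: "nat \<Rightarrow> real" +
  fixes l :: "real \<Rightarrow> real" and \<phi> :: "'a::real_normed_vector set" and s f :: "'a \<Rightarrow> real"
    and X :: "nat \<Rightarrow> 'a"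
  assumes bij: "bij_betw X UNIV \<phi>"
    and loss: "\<And>j. propagation_loss l s (X j) = inverse (ennreal (p j))"
begin

lemma INF_loss:
  assumes "k \<in> J" "\<And>j. j \<in> J \<Longrightarrow> p j \<le> p k"
  shows "(INF x\<in>X ` J. propagation_loss l s x) = inverse (ennreal (p k))"
  using assms
  by (intro antisym INF_greatest INF_lower2[of "X k"])
    (auto simp: loss inverse_ennreal_le_iff nonneg)

lemma order_loss_eq: "order_loss l \<phi> s n = inverse (ennreal (p (ranked p n)))"
proof (induction n)
  case 0
  have "\<phi> = X ` UNIV"
    using bij by (simp add: bij_betw_def)
  then show ?case
    using INF_loss[of "ranked p 0" UNIV] ranked_0(2) by simp
next
  case (Suc n)
  have "{x \<in> \<phi>. order_loss l \<phi> s n < propagation_loss l s x} = X ` {j. p j < p (ranked p n)}"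
    using bij unfolding Suc
    by (auto simp: bij_betw_def loss inverse_ennreal_less_iff nonneg)
  then show ?case
    using INF_loss[of "ranked p (Suc n)" "{j. p j < p (ranked p n)}"] ranked_Suc
    by (simp del: ranked.simps)
qed

lemma order_fading_eq: "order_fading l \<phi> s f n = f (X (ranked p n))"
proof -
  have "(THE x. x \<in> \<phi> \<and> propagation_loss l s x = order_loss l \<phi> s n) = X (ranked p n)"
  proof (rule the_equality)
    show "X (ranked p n) \<in> \<phi> \<and> propagation_loss l s (X (ranked p n)) = order_loss l \<phi> s n"
      using bij by (auto simp: order_loss_eq loss bij_betw_def)
    fix x assume x: "x \<in> \<phi> \<and> propagation_loss l s x = order_loss l \<phi> s n"
    then obtain j where j: "x = X j"
      using bij by (auto simp: bij_betw_def)
    with x have "inverse (ennreal (p j)) = inverse (ennreal (p (ranked p n)))"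
      by (simp add: loss order_loss_eq)
    then have "p j = p (ranked p n)"
      using inverse_ennreal_le_iff[of "p j" "p (ranked p n)"]
        inverse_ennreal_le_iff[of "p (ranked p n)" "p j"] nonneg by (auto intro: antisym)
    then have "j = ranked p n"
      using no_ties[of j "ranked p n"] ranked_pos[of n] by auto
    with j show "x = X (ranked p n)"
      by simp
  qed
  then show ?thesis
    by (simp add: order_fading_def)
qed

lemma received_power_eq: "received_power l \<phi> s f n = f (X (ranked p n)) * p (ranked p n)"
  using ranked_pos[of n] unfolding received_power_def order_fading_eq order_loss_eq
  by (simp add: inverse_ennreal divide_inverse)

text \<open>Summing in the order of the losses is a rearrangement, harmless for nonnegative terms;
  stations of zero strength are not ranked and contribute 0.\<close>

lemma total_power_eq:
  assumes f: "\<And>j. 0 \<le> f (X j)" and sum: "summable (\<lambda>j. f (X j) * p j)"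
  shows "total_power l \<phi> s f = (\<Sum>j. f (X j) * p j)"
proof -
  let ?g = "\<lambda>j. f (X j) * p j"
  have "(?g has_sum (\<Sum>j. ?g j)) UNIV"
    using sum f nonneg by (intro sums_nonneg_imp_has_sum summable_sums) auto
  also have "?this \<longleftrightarrow> (?g has_sum (\<Sum>j. ?g j)) {j. 0 < p j}"
    using nonneg by (intro has_sum_cong_neutral) (auto simp: less_le)
  also have "\<dots> \<longleftrightarrow> ((\<lambda>n. ?g (ranked p n)) has_sum (\<Sum>j. ?g j)) UNIV"
    by (rule has_sum_reindex_bij_betw[OF bij_ranked, symmetric])
  finally show ?thesis
    unfolding total_power_def received_power_eq
    by (intro sums_unique[symmetric] has_sum_imp_sums)
qed

text \<open>Clearing the denominator gives an inequality over the original enumeration, in which the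
  serving index \<open>k\<close> is the only trace of the ordering.\<close>

lemma SINR_greater_iff:
  assumes f: "\<And>j. 0 < f (X j)" and sum: "summable (\<lambda>j. f (X j) * p j)"
    and k: "\<And>j. p j \<le> p k" and "W \<ge> 0" "T > 0"
  shows "SINR l W \<phi> s f > T \<longleftrightarrow> T * (W + (\<Sum>j. if j = k then 0 else f (X j) * p j)) < f (X k) * p k"
proof -
  have "p k = p (ranked p 0)"
    using k ranked_0(2)[of k] by (auto intro: antisym)
  then have k0: "ranked p 0 = k"
    using no_ties[of k "ranked p 0"] ranked_pos[of 0] by (metis less_irrefl)
  let ?g = "\<lambda>j. f (X j) * p j"
  let ?h = "\<lambda>j. if j = k then 0 else ?g j"
  have h_sum: "summable ?h"
    by (rule summable_comparison_test'[OF sum, of 0]) (use f nonneg in \<open>auto simp: less_imp_le\<close>)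
  have "?g = (\<lambda>j. ?h j + (if j = k then ?g k else 0))"
    by auto
  then have "(\<Sum>j. ?g j) = (\<Sum>j. ?h j + (if j = k then ?g k else 0))"
    by metis
  also have "\<dots> = (\<Sum>j. ?h j) + ?g k"
    using h_sum sums_single[of k "\<lambda>_. ?g k"]
    by (subst suminf_add[symmetric]) (auto simp: sums_iff)
  finally have split: "(\<Sum>j. ?g j) = (\<Sum>j. ?h j) + ?g k" .
  \<comment> \<open>A second station makes the denominator positive even when
    \<open>W = 0\<close>.\<close>
  have "infinite ({j. 0 < p j} - {k})"
    using infinite by simp
  then obtain i where i: "0 < p i" "i \<noteq> k"
    using infinite_imp_nonempty by blast
  have "0 < ?h i"
    using f i by simp
  then have "0 < (\<Sum>j. ?h j)"
    using f nonneg by (intro suminf_pos2[OF h_sum, of i]) (auto simp: less_imp_le)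
  then have pos: "0 < W + (\<Sum>j. ?h j)"
    using \<open>W \<ge> 0\<close> by simp
  have "SINR l W \<phi> s f = ?g k / (W + (\<Sum>j. ?h j))"
    unfolding SINR_def received_power_eq k0 using f sum
    by (subst total_power_eq) (auto simp: less_imp_le split)
  then show ?thesis
    using pos by (simp add: less_divide_eq)
qed

end

section \<open>Coverage for fixed losses\<close>

lemma prob_space_exponential_1: "prob_space (density lborel (exponential_density 1))"
  by (rule prob_space_exponential_density) simp

lemma emeasure_exponential_greater:
  assumes "0 \<le> y"
  shows "emeasure (density lborel (exponential_density 1)) {x. y < x} = ennreal (exp (- y))"
proof -
  interpret E: prob_space "density lborel (exponential_density 1)"
    by (rule prob_space_exponential_1)
  have "distributed (density lborel (exponential_density 1)) lborel (\<lambda>x. x) (exponential_density 1)"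
    by (auto simp: distributed_def distr_id2)
  from E.exponential_distributedD_gt[OF this assms] show ?thesis
    by (simp add: E.emeasure_eq_measure)
qed

lemma nn_integral_exponential:
  "(\<integral>\<^sup>+x. ennreal x \<partial>density lborel (exponential_density 1)) = 1"
proof -
  let ?D = "density lborel (exponential_density 1)"
  interpret E: prob_space ?D
    by (rule prob_space_exponential_1)
  have "distributed ?D lborel (\<lambda>x. x) (exponential_density 1)"
    by (auto simp: distributed_def distr_id2)
  then have e: "(\<integral>x. x \<partial>?D) = 1"
    using E.exponential_distributed_expectation[of 1 "\<lambda>x. x"] by simp
  \<comment> \<open>A non-integrable function has integral 0 by convention, so the value 1 implies
    integrability.\<close>
  then have int: "integrable ?D (\<lambda>x. x)"
    using not_integrable_integral_eq by fastforce
  have "AE x in ?D. 0 \<le> x"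
    by (subst AE_density) (auto simp: exponential_density_def)
  then show ?thesis
    using e int by (subst nn_integral_eq_integral) auto
qed

lemma AE_exponential_pos: "AE x in density lborel (exponential_density 1). 0 < x"
  using AE_lborel_singleton[of 0] by (subst AE_density) (auto simp: exponential_density_def)

text \<open>Up to the factor \<open>1 / (1 + q)\<close>, the integrand times the density is the
  exponential density of rate \<open>1 + q\<close>. The cut-off \<open>max 0\<close> keeps the
  integrand in [0, 1] on all reals.\<close>

lemma integral_exp_exponential:
  assumes "0 \<le> q"
  shows "(\<integral>x. exp (- q * max 0 x) \<partial>density lborel (exponential_density 1)) = 1 / (1 + q)"
proof -
  interpret E: prob_space "density lborel (exponential_density (1 + q))"
    using assms by (intro prob_space_exponential_density) auto
  have one: "(\<integral>\<^sup>+x. ennreal (exponential_density (1 + q) x) \<partial>lborel) = 1"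
    using E.emeasure_space_1 by (simp add: emeasure_density)
  have "(\<integral>\<^sup>+x. ennreal (exp (- q * max 0 x)) \<partial>density lborel (exponential_density 1))
      = (\<integral>\<^sup>+x. ennreal (exponential_density 1 x) * ennreal (exp (- q * max 0 x)) \<partial>lborel)"
    by (subst nn_integral_density) auto
  also have "\<dots> = (\<integral>\<^sup>+x. ennreal (1 / (1 + q)) * ennreal (exponential_density (1 + q) x) \<partial>lborel)"
  proof (rule nn_integral_cong)
    fix x :: real
    show "ennreal (exponential_density 1 x) * ennreal (exp (- q * max 0 x))
        = ennreal (1 / (1 + q)) * ennreal (exponential_density (1 + q) x)"
    proof (cases "x < 0")
      case False
      have "exp (- x) * exp (- q * x) = exp (- x * (1 + q))"
        by (simp add: exp_add[symmetric] algebra_simps)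
      then show ?thesis
        using False assms by (simp add: exponential_density_def ennreal_mult[symmetric])
    qed (simp add: exponential_density_def)
  qed
  also have "\<dots> = ennreal (1 / (1 + q))"
    by (subst nn_integral_cmult) (auto simp: one)
  finally show ?thesis
    using assms by (subst integral_eq_nn_integral) auto
qed

text \<open>The mean of the faded sum is the sum of \<open>q\<close>, which is finite; hence the
  faded sum is finite almost surely.\<close>

lemma AE_fading:
  fixes q :: "nat \<Rightarrow> real"
  assumes q: "\<And>j. 0 \<le> q j" and sum: "summable q"
  shows "AE f in PiM UNIV (\<lambda>_. density lborel (exponential_density 1)).
    (\<forall>j. 0 < f j) \<and> summable (\<lambda>j. q j * f j)"
proof -
  let ?D = "density lborel (exponential_density 1)"
  let ?P = "PiM UNIV (\<lambda>_::nat. ?D)"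
  have pos: "AE f in ?P. \<forall>j. 0 < f j"
    unfolding AE_all_countable
    by (intro allI AE_PiM_component prob_space_exponential_1 AE_exponential_pos) auto
  have "(\<integral>\<^sup>+f. ennreal (q j * f j) \<partial>?P) = ennreal (q j)" for j
  proof -
    have "(\<integral>\<^sup>+f. ennreal (q j * f j) \<partial>?P) = (\<integral>\<^sup>+x. ennreal (q j * x) \<partial>distr ?P ?D (\<lambda>f. f j))"
      by (subst nn_integral_distr) auto
    also have "\<dots> = (\<integral>\<^sup>+x. ennreal (q j) * ennreal x \<partial>?D)"
      using q by (subst distr_PiM_component) (auto simp: prob_space_exponential_1 ennreal_mult')
    also have "\<dots> = ennreal (q j)"
      by (subst nn_integral_cmult) (auto simp: nn_integral_exponential)
    finally show ?thesis .
  qed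
  then have "(\<integral>\<^sup>+f. (\<Sum>j. ennreal (q j * f j)) \<partial>?P) = (\<Sum>j. ennreal (q j))"
    by (subst nn_integral_suminf) auto
  also have "\<dots> \<noteq> \<infinity>"
    using ennreal_suminf_neq_top[OF sum q] by simp
  finally have "AE f in ?P. (\<Sum>j. ennreal (q j * f j)) \<noteq> \<infinity>"
    by (intro nn_integral_PInf_AE) auto
  with pos show ?thesis
  proof eventually_elim
    case (elim f)
    then have "0 \<le> q j * f j" for j
      using q by (simp add: less_imp_le)
    then show ?case
      using elim summable_suminf_not_top[of "\<lambda>j. q j * f j"] by auto
  qed
qed

text \<open>Singles out the fading of one station, the serving one in the application, so that it
  can be integrated with all other fadings fixed.\<close>

lemma nn_integral_PiM_coordinate:
  fixes D :: "'b measure" and h :: "(nat \<Rightarrow> 'b) \<Rightarrow> ennreal"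
  assumes D: "prob_space D" and [measurable]: "h \<in> borel_measurable (PiM UNIV (\<lambda>_. D))"
  shows "(\<integral>\<^sup>+f. h f \<partial>PiM UNIV (\<lambda>_. D)) = (\<integral>\<^sup>+f. \<integral>\<^sup>+x. h (f(k := x)) \<partial>D \<partial>PiM (- {k}) (\<lambda>_. D))"
proof -
  interpret D: prob_space D by fact
  interpret P: prob_space "PiM (- {k}) (\<lambda>_. D)"
    by (rule prob_space_PiM) (rule D)
  interpret DP: pair_sigma_finite D "PiM (- {k}) (\<lambda>_. D)" ..
  have U: "insert k (- {k}) = UNIV"
    by auto
  have [measurable]: "(\<lambda>(x, f). f(k := x)) \<in> measurable (D \<Otimes>\<^sub>M PiM (- {k}) (\<lambda>_. D)) (PiM UNIV (\<lambda>_. D))"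
    using measurable_add_dim[of k "- {k}" "\<lambda>_. D"] unfolding U
    by (subst measurable_pair_swap_iff) (simp add: case_prod_beta')
  have "PiM UNIV (\<lambda>_. D) = distr (D \<Otimes>\<^sub>M PiM (- {k}) (\<lambda>_. D)) (PiM UNIV (\<lambda>_. D)) (\<lambda>(x, f). f(k := x))"
    using distr_pair_PiM_eq_PiM[of "- {k}" "\<lambda>_. D" k] D unfolding U by simp
  then have "(\<integral>\<^sup>+f. h f \<partial>PiM UNIV (\<lambda>_. D))
      = (\<integral>\<^sup>+f. h f \<partial>distr (D \<Otimes>\<^sub>M PiM (- {k}) (\<lambda>_. D)) (PiM UNIV (\<lambda>_. D)) (\<lambda>(x, f). f(k := x)))"
    by simp
  also have "\<dots> = (\<integral>\<^sup>+y. h ((snd y)(k := fst y)) \<partial>(D \<Otimes>\<^sub>M PiM (- {k}) (\<lambda>_. D)))"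
    by (subst nn_integral_distr) (auto simp: case_prod_beta')
  also have "\<dots> = (\<integral>\<^sup>+f. \<integral>\<^sup>+x. h (f(k := x)) \<partial>D \<partial>PiM (- {k}) (\<lambda>_. D))"
    using DP.nn_integral_snd[of "\<lambda>(x, f). h (f(k := x))"] by (simp add: case_prod_beta')
  finally show ?thesis .
qed

text \<open>By the lack of memory of \<open>f k\<close>, its tail probability is the Laplace transform of the
  noise and interference terms on the left.\<close>

lemma fading_coverage:
  fixes q :: "nat \<Rightarrow> real"
  assumes q: "\<And>j. 0 \<le> q j" and qk: "q k = 0" and sum: "summable q" and "0 \<le> c"
  shows "(\<integral>\<^sup>+f. indicator {f. c + (\<Sum>j. q j * f j) < f k} f
      \<partial>PiM UNIV (\<lambda>_. density lborel (exponential_density 1)))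
    = ennreal (exp (- c) * iprod (\<lambda>j. 1 / (1 + q j)))"
proof -
  let ?D = "density lborel (exponential_density 1)"
  let ?P = "PiM UNIV (\<lambda>_::nat. ?D)"
  interpret D: prob_space ?D
    by (rule prob_space_exponential_1)
  interpret P: prob_space ?P
    by (rule prob_space_PiM) (rule prob_space_exponential_1)
  \<comment> \<open>Outside the almost sure event the sum may be meaningless. The cut-off in
    \<open>max 0 (Y f)\<close> lets the tail formula apply for every \<open>f\<close>, and the one
    in \<open>max 0 (f j)\<close> keeps the factors of \<open>G\<close> in [0, 1].\<close>
  define Y where "Y f = c + (\<Sum>j. q j * max 0 (f j))" for f :: "nat \<Rightarrow> real"
  define G where "G f = exp (- c) * iprod (\<lambda>j. exp (- q j * max 0 (f j)))" for f :: "nat \<Rightarrow> real"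
  have [measurable]: "Y \<in> borel_measurable ?P"
    unfolding Y_def by measurable
  have YG: "exp (- Y f) = G f" if "summable (\<lambda>j. q j * max 0 (f j))" for f
  proof -
    have "(\<lambda>J. exp (- (\<Sum>j<J. q j * max 0 (f j)))) \<longlonglongrightarrow> exp (- (\<Sum>j. q j * max 0 (f j)))"
      by (intro tendsto_intros summable_LIMSEQ that)
    moreover have "exp (- (\<Sum>j<J. q j * max 0 (f j))) = (\<Prod>j<J. exp (- q j * max 0 (f j)))" for J
      by (simp only: exp_sum[OF finite_lessThan, symmetric] sum_negf[symmetric] mult_minus_left)
    ultimately have "(\<lambda>J. \<Prod>j<J. exp (- q j * max 0 (f j))) \<longlonglongrightarrow> exp (- (\<Sum>j. q j * max 0 (f j)))"
      by simp
    then have "iprod (\<lambda>j. exp (- q j * max 0 (f j))) = exp (- (\<Sum>j. q j * max 0 (f j)))"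
      unfolding iprod_def by (rule limI)
    then show ?thesis
      by (simp add: Y_def G_def exp_add[symmetric])
  qed
  \<comment> \<open>The threshold does not depend on the coordinate \<open>k\<close>, because
    \<open>q k = 0\<close>.\<close>
  have Yk: "Y (f(k := x)) = Y (f(k := 0))" for f x
    unfolding Y_def using qk by (intro arg_cong2[where f = "(+)"] refl suminf_cong) auto
  have good: "AE f in ?P. (\<forall>j. 0 < f j) \<and> summable (\<lambda>j. q j * f j)"
    by (rule AE_fading[OF q sum])
  have "(\<integral>\<^sup>+f. indicator {f. c + (\<Sum>j. q j * f j) < f k} f \<partial>?P)
      = (\<integral>\<^sup>+f. indicator {f. max 0 (Y f) < f k} f \<partial>?P)"
  proof (rule nn_integral_cong_AE)
    show "AE f in ?P. (indicator {f. c + (\<Sum>j. q j * f j) < f k} f :: ennreal)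
        = indicator {f. max 0 (Y f) < f k} f"
      using good
    proof eventually_elim
      case (elim f)
      then have "Y f = c + (\<Sum>j. q j * f j)"
        unfolding Y_def by (intro arg_cong2[where f = "(+)"] refl suminf_cong) (auto simp: max_def less_imp_le not_le[symmetric] dest: less_asym)
      then show ?case
        using elim by (auto simp: indicator_def)
    qed
  qed
  also have "\<dots> = (\<integral>\<^sup>+f. \<integral>\<^sup>+x. indicator {f. max 0 (Y f) < f k} (f(k := x)) \<partial>?D \<partial>PiM (- {k}) (\<lambda>_. ?D))"
    by (rule nn_integral_PiM_coordinate[OF prob_space_exponential_1]) measurable
  \<comment> \<open>The tail probability of \<open>f k\<close> is again constant in the coordinate
    \<open>k\<close>, so that coordinate can be put back and the integral returns to the full
    product space.\<close>
  also have "\<dots> = (\<integral>\<^sup>+f. \<integral>\<^sup>+x. ennreal (exp (- max 0 (Y (f(k := x))))) \<partial>?D \<partial>PiM (- {k}) (\<lambda>_. ?D))"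
  proof (rule nn_integral_cong)
    fix f
    define y where "y = max 0 (Y (f(k := 0)))"
    have y: "max 0 (Y (f(k := x))) = y" for x
      unfolding y_def by (subst Yk) (rule refl)
    have "(\<integral>\<^sup>+x. indicator {f. max 0 (Y f) < f k} (f(k := x)) \<partial>?D) = (\<integral>\<^sup>+x. indicator {x. y < x} x \<partial>?D)"
      by (intro nn_integral_cong) (simp only: indicator_def mem_Collect_eq y fun_upd_same)
    also have "\<dots> = ennreal (exp (- y))"
      by (subst nn_integral_indicator) (auto simp: emeasure_exponential_greater y_def)
    also have "\<dots> = (\<integral>\<^sup>+x. ennreal (exp (- max 0 (Y (f(k := x))))) \<partial>?D)"
      using D.emeasure_space_1 by (simp add: y)
    finally show "(\<integral>\<^sup>+x. indicator {f. max 0 (Y f) < f k} (f(k := x)) \<partial>?D)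
        = (\<integral>\<^sup>+x. ennreal (exp (- max 0 (Y (f(k := x))))) \<partial>?D)" .
  qed
  also have "\<dots> = (\<integral>\<^sup>+f. ennreal (exp (- max 0 (Y f))) \<partial>?P)"
    by (rule nn_integral_PiM_coordinate[OF prob_space_exponential_1, symmetric]) measurable
  also have "\<dots> = (\<integral>\<^sup>+f. ennreal (G f) \<partial>?P)"
  proof (rule nn_integral_cong_AE)
    show "AE f in ?P. ennreal (exp (- max 0 (Y f))) = ennreal (G f)"
      using good
    proof eventually_elim
      case (elim f)
      then have m: "max 0 (f j) = f j" for j
        by (simp add: less_imp_le max_def)
      have "0 \<le> q j * f j" for j
        using elim q[of j] by (simp add: less_imp_le)
      then have "0 \<le> Y f"
        using elim \<open>0 \<le> c\<close> unfolding Y_def m by (intro add_nonneg_nonneg suminf_nonneg) auto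
      then show ?case
        using YG[of f] elim m by simp
    qed
  qed
  also have "\<dots> = ennreal (\<integral>f. G f \<partial>?P)"
  proof (rule nn_integral_eq_integral)
    have b: "0 \<le> iprod (\<lambda>j. exp (- q j * max 0 (f j)))" "iprod (\<lambda>j. exp (- q j * max 0 (f j))) \<le> 1" for f
      by (rule iprod_bounds; use q in auto)+
    then show "AE f in ?P. 0 \<le> G f"
      unfolding G_def by auto
    have "norm (G f) \<le> 1" for f
      unfolding G_def using b \<open>0 \<le> c\<close> by (auto simp: abs_mult intro!: mult_le_one)
    then show "integrable ?P G"
      unfolding G_def by (intro P.integrable_const_bound[where B = 1]) auto
  qed
  also have "(\<integral>f. G f \<partial>?P) = exp (- c) * iprod (\<lambda>j. 1 / (1 + q j))"
  proof -
    have "(\<integral>f. iprod (\<lambda>j. exp (- q j * max 0 (f j))) \<partial>?P) = iprod (\<lambda>j. \<integral>x. exp (- q j * max 0 x) \<partial>?D)"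
      by (rule integral_iprod_PiM[OF prob_space_exponential_1]) (use q in auto)
    also have "\<dots> = iprod (\<lambda>j. 1 / (1 + q j))"
      by (simp only: integral_exp_exponential[OF q])
    finally show ?thesis
      unfolding G_def by (simp only: integral_mult_right_zero)
  qed
  finally show ?thesis .
qed

section \<open>Integrals\<close>

text \<open>The change of variables is made for absolutely integrable functions with respect to the
  completed measure; Borel measurability brings the result back to \<open>lborel\<close>.\<close>

lemma LBINT_substitution:
  fixes f g g' :: "real \<Rightarrow> real"
  assumes S [measurable]: "S \<in> sets borel" "g ` S \<in> sets borel"
    and der: "\<And>x. x \<in> S \<Longrightarrow> (g has_real_derivative g' x) (at x within S)" and inj: "inj_on g S"
    and [measurable]: "f \<in> borel_measurable borel" "g \<in> borel_measurable borel" "g' \<in> borel_measurable borel"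
    and int: "set_integrable lborel (g ` S) f"
  shows "(LBINT x:S. \<bar>g' x\<bar> * f (g x)) = (LBINT y:g ` S. f y)"
proof -
  have "f absolutely_integrable_on (g ` S)"
    using int unfolding set_integrable_def by (rule integrable_completion[THEN iffD2, rotated]) simp
  then have *: "(\<lambda>x. \<bar>g' x\<bar> * f (g x)) absolutely_integrable_on S \<and>
      integral S (\<lambda>x. \<bar>g' x\<bar> * f (g x)) = integral (g ` S) f"
    using S(1) by (subst has_absolute_integral_change_of_variables_1'[OF _ der inj]) auto
  then have "set_integrable lborel S (\<lambda>x. \<bar>g' x\<bar> * f (g x))"
    unfolding set_integrable_def by (subst (asm) integrable_completion) auto
  then have "(LBINT x:S. \<bar>g' x\<bar> * f (g x)) = integral S (\<lambda>x. \<bar>g' x\<bar> * f (g x))"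
    by (rule set_borel_integral_eq_integral(2))
  also have "\<dots> = integral (g ` S) f"
    using * by blast
  also have "\<dots> = (LBINT y:g ` S. f y)"
    using int by (rule set_borel_integral_eq_integral(2)[symmetric])
  finally show ?thesis
    by simp
qed

lemma powr_image_greaterThan_0:
  fixes p :: real
  assumes "p \<noteq> 0"
  shows "(\<lambda>x. x powr p) ` {0<..} = {0<..}"
proof (intro equalityI subsetI)
  fix y :: real assume "y \<in> {0<..}"
  then have "(y powr (1 / p)) powr p = y"
    using assms by (simp add: powr_powr)
  then show "y \<in> (\<lambda>x. x powr p) ` {0<..}"
    using \<open>y \<in> {0<..}\<close> by (intro image_eqI[of _ _ "y powr (1 / p)"]) auto
qed auto

lemma powr_image_unit_interval:
  fixes p :: real
  assumes "p < 0"
  shows "(\<lambda>x. x powr p) ` {0<..<1} = {1<..}"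
proof (intro equalityI subsetI)
  fix y assume "y \<in> (\<lambda>x. x powr p) ` {0<..<1}"
  then show "y \<in> {1<..}"
    using powr_less_mono2_neg[of p _ 1] assms by auto
next
  fix y :: real assume y: "y \<in> {1<..}"
  then have "(y powr (1 / p)) powr p = y"
    using assms by (simp add: powr_powr)
  moreover have "y powr (1 / p) < 1"
    using y assms by (intro powr_less_one) auto
  ultimately show "y \<in> (\<lambda>x. x powr p) ` {0<..<1}"
    using y by (intro image_eqI[of _ _ "y powr (1 / p)"]) auto
qed

lemma powr_inj_on:
  fixes p :: real
  assumes "p \<noteq> 0" "S \<subseteq> {0<..}"
  shows "inj_on (\<lambda>x. x powr p) S"
proof (rule inj_on_inverseI[where g = "\<lambda>y. y powr (1 / p)"])
  fix x assume "x \<in> S"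
  then show "(x powr p) powr (1 / p) = x"
    using assms by (auto simp: powr_powr)
qed

text \<open>Substituting \<open>r = z * x\<close> frees the integrand of \<open>z\<close>, so the
  exponent is linear in \<open>z\<close>. The summand 1 is the contribution of the interval below
  the cut-off.\<close>

lemma loss_exponent_diagonal:
  assumes "\<delta> > 1" "T > 0" "z > 0"
  shows "loss_exponent \<delta> T z z = z * (1 + (LBINT r:{1<..}. T / (r powr \<delta> + T)))"
proof -
  have "loss_exponent \<delta> T z z = z * loss_exponent \<delta> T 1 1"
  proof -
    define F where "F r = indicator {0<..} r *\<^sub>R (if r < z then 1 else T * z powr \<delta> / (r powr \<delta> + T * z powr \<delta>))" for r :: real
    have F: "F (0 + z * x) = indicator {0<..} x *\<^sub>R (if x < 1 then 1 else T * 1 powr \<delta> / (x powr \<delta> + T * 1 powr \<delta>))" for x :: real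
    proof (cases "x > 0")
      case True
      have p: "z powr \<delta> > 0"
        using \<open>z > 0\<close> by simp
      have "(z * x) powr \<delta> + T * z powr \<delta> = z powr \<delta> * (x powr \<delta> + T)"
        using True \<open>z > 0\<close> by (simp add: powr_mult algebra_simps)
      then have "T * z powr \<delta> / ((z * x) powr \<delta> + T * z powr \<delta>) = T / (x powr \<delta> + T)"
        using p by simp
      then show ?thesis
        using True \<open>z > 0\<close> by (simp add: F_def)
    qed (use \<open>z > 0\<close> in \<open>auto simp: F_def zero_less_mult_iff\<close>)
    have "(\<integral>r. F r \<partial>lborel) = z * (\<integral>x. F (0 + z * x) \<partial>lborel)"
      using \<open>z > 0\<close> by (subst lborel_integral_real_affine[of z F 0]) auto
    then show ?thesis
      unfolding F loss_exponent_def set_lebesgue_integral_def by (simp only: F_def)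
  qed
  also have "loss_exponent \<delta> T 1 1 = 1 + (LBINT r:{1<..}. T / (r powr \<delta> + T))"
  proof -
    have int: "integrable lborel (\<lambda>r. indicator {1<..} r *\<^sub>R (T / (r powr \<delta> + T)))"
      using set_integrable_subset[OF set_integrable_interference[of T \<delta>], of "{1<..}"] assms
      unfolding set_integrable_def by auto
    have "loss_exponent \<delta> T 1 1
        = (\<integral>r. indicator {0<..<1} r + indicator {1<..} r *\<^sub>R (T / (r powr \<delta> + T)) \<partial>lborel)"
      unfolding loss_exponent_def set_lebesgue_integral_def
    proof (rule integral_cong_AE)
      have "AE r in lborel. r \<noteq> (1::real)"
        by (rule AE_lborel_singleton)
      then show "AE r in lborel. indicator {0<..} r *\<^sub>R (if r < 1 then 1 else T * 1 powr \<delta> / (r powr \<delta> + T * 1 powr \<delta>))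
          = indicator {0<..<1} r + indicator {1<..} r *\<^sub>R (T / (r powr \<delta> + T))"
        by eventually_elim (auto simp: indicator_def)
    qed measurable
    also have "\<dots> = 1 + (LBINT r:{1<..}. T / (r powr \<delta> + T))"
      using int unfolding set_lebesgue_integral_def
      by (subst Bochner_Integration.integral_add) auto
    finally show ?thesis .
  qed
  finally show ?thesis .
qed

text \<open>The map \<open>r = w powr (- 1 / \<delta>)\<close> takes the unit interval onto
  \<open>{1<..}\<close> and produces Euler's integral. Here \<open>c - b = 1\<close>, so the power
  of \<open>1 - w\<close> has exponent 0, and the Gamma quotient is \<open>1 - 1 / \<delta>\<close>,
  which cancels the denominator.\<close>

lemma interference_integral_hyp2F1:
  fixes \<delta> T :: real
  assumes "\<delta> > 1" "T > 0"
  shows "(LBINT r:{1<..}. T / (r powr \<delta> + T))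
    = 1 / \<delta> * (T * hyp2F1 1 (1 - 1 / \<delta>) (2 - 1 / \<delta>) (- T) / (1 - 1 / \<delta>))"
proof -
  let ?I = "LBINT w:{0<..<1}. w powr (- 1 / \<delta>) / (1 + T * w)"
  have "(LBINT r:{1<..}. T / (r powr \<delta> + T))
      = (LBINT r:(\<lambda>w. w powr (- 1 / \<delta>)) ` {0<..<1}. T / (r powr \<delta> + T))"
    using assms by (subst powr_image_unit_interval) auto
  also have "\<dots> = (LBINT w:{0<..<1}. \<bar>(- 1 / \<delta>) * w powr (- 1 / \<delta> - 1)\<bar> * (T / ((w powr (- 1 / \<delta>)) powr \<delta> + T)))"
  proof (rule LBINT_substitution[symmetric, where f = "\<lambda>r. T / (r powr \<delta> + T)"
        and g = "\<lambda>w. w powr (- 1 / \<delta>)" and g' = "\<lambda>w. (- 1 / \<delta>) * w powr (- 1 / \<delta> - 1)"])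
    show "(\<lambda>w. w powr (- 1 / \<delta>)) ` {0<..<1} \<in> sets borel"
      using assms by (subst powr_image_unit_interval) auto
    show "set_integrable lborel ((\<lambda>w. w powr (- 1 / \<delta>)) ` {0<..<1}) (\<lambda>r. T / (r powr \<delta> + T))"
    proof (subst powr_image_unit_interval)
      show "set_integrable lborel {1<..} (\<lambda>r. T / (r powr \<delta> + T))"
        by (rule set_integrable_subset[OF set_integrable_interference[of T \<delta>]]) (use assms in auto)
    qed (use assms in auto)
    show "((\<lambda>w. w powr (- 1 / \<delta>)) has_real_derivative (- 1 / \<delta>) * w powr (- 1 / \<delta> - 1)) (at w within {0<..<1})"
      if "w \<in> {0<..<1}" for w
      by (rule has_field_derivative_at_within, rule has_real_derivative_powr) (use that in auto)
    show "inj_on (\<lambda>w. w powr (- 1 / \<delta>)) {0<..<1}"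
      using assms by (intro powr_inj_on) auto
  qed auto
  also have "\<dots> = (LBINT w:{0<..<1}. T / \<delta> * (w powr (- 1 / \<delta>) / (1 + T * w)))"
  proof (rule set_lebesgue_integral_cong)
    show "\<forall>w. w \<in> {0<..<1} \<longrightarrow>
      \<bar>(- 1 / \<delta>) * w powr (- 1 / \<delta> - 1)\<bar> * (T / ((w powr (- 1 / \<delta>)) powr \<delta> + T))
        = T / \<delta> * (w powr (- 1 / \<delta>) / (1 + T * w))"
    proof (intro allI impI)
      fix w :: real assume "w \<in> {0<..<1}"
      then have w: "w > 0"
        by simp
      have a: "\<bar>(- 1 / \<delta>) * w powr (- 1 / \<delta> - 1)\<bar> = w powr (- 1 / \<delta>) / (\<delta> * w)"
        using w assms by (simp add: abs_mult powr_diff)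
      have b: "(w powr (- 1 / \<delta>)) powr \<delta> = 1 / w"
      proof -
        have "- 1 / \<delta> * \<delta> = - 1"
          using assms by simp
        then show ?thesis
          using w by (simp only: powr_powr) (simp add: powr_minus_divide)
      qed
      have c: "T / (1 / w + T) = T * w / (1 + T * w)"
        using w assms by (simp add: field_simps)
      show "\<bar>(- 1 / \<delta>) * w powr (- 1 / \<delta> - 1)\<bar> * (T / ((w powr (- 1 / \<delta>)) powr \<delta> + T))
        = T / \<delta> * (w powr (- 1 / \<delta>) / (1 + T * w))"
        unfolding a b c using w by simp
    qed
  qed auto
  also have "\<dots> = T / \<delta> * ?I"
    by (rule set_integral_mult_right)
  also have "hyp2F1 1 (1 - 1 / \<delta>) (2 - 1 / \<delta>) (- T) = (1 - 1 / \<delta>) * ?I"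
  proof -
    have pos: "1 - 1 / \<delta> > 0"
      using assms by simp
    have "Gamma (2 - 1 / \<delta>) = (1 - 1 / \<delta>) * Gamma (1 - 1 / \<delta>)"
      using Gamma_plus1[of "1 - 1 / \<delta>"] pos by (auto simp: nonpos_Ints_def)
    moreover have "Gamma (1 - 1 / \<delta>) > 0"
      using pos by (rule Gamma_real_pos)
    ultimately have G: "Gamma (2 - 1 / \<delta>) / (Gamma (1 - 1 / \<delta>) * Gamma (2 - 1 / \<delta> - (1 - 1 / \<delta>))) = 1 - 1 / \<delta>"
      by simp
    have "(LBINT w:{0<..<1}. w powr (1 - 1 / \<delta> - 1) * (1 - w) powr (2 - 1 / \<delta> - (1 - 1 / \<delta>) - 1) * (1 - - T * w) powr - 1) = ?I"
    proof (rule set_lebesgue_integral_cong)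
      show "\<forall>w. w \<in> {0<..<1} \<longrightarrow> w powr (1 - 1 / \<delta> - 1) * (1 - w) powr (2 - 1 / \<delta> - (1 - 1 / \<delta>) - 1) * (1 - - T * w) powr - 1
          = w powr (- 1 / \<delta>) / (1 + T * w)"
        using assms by (auto simp: powr_minus_divide add_pos_pos)
    qed auto
    then show ?thesis
      unfolding hyp2F1_def G by simp
  qed
  ultimately show ?thesis
    using assms by simp
qed

text \<open>The Jacobian \<open>1 / \<delta> * t powr (1 / \<delta> - 1)\<close> supplies the
  prefactor and the power of \<open>t\<close> in the final formula.\<close>

lemma LBINT_powr_substitution:
  fixes \<delta> c \<kappa> :: real
  assumes "\<delta> > 0" and int: "set_integrable lborel {0<..} (\<lambda>z. exp (- c * z powr \<delta>) * exp (- \<kappa> * z))"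
  shows "(LBINT z:{0<..}. exp (- c * z powr \<delta>) * exp (- \<kappa> * z))
    = 1 / \<delta> * (LBINT t:{0<..}. t powr (1 / \<delta> - 1) * exp (- c * t) * exp (- \<kappa> * t powr (1 / \<delta>)))"
proof -
  let ?f = "\<lambda>z. exp (- c * z powr \<delta>) * exp (- \<kappa> * z)"
  have im: "(\<lambda>t. t powr (1 / \<delta>)) ` {0<..} = {0<..}"
    using assms by (intro powr_image_greaterThan_0) auto
  have "(LBINT z:{0<..}. ?f z) = (LBINT z:(\<lambda>t. t powr (1 / \<delta>)) ` {0<..}. ?f z)"
    unfolding im ..
  also have "\<dots> = (LBINT t:{0<..}. \<bar>(1 / \<delta>) * t powr (1 / \<delta> - 1)\<bar> * ?f (t powr (1 / \<delta>)))"
  proof (rule LBINT_substitution[symmetric, where f = ?f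
        and g = "\<lambda>t. t powr (1 / \<delta>)" and g' = "\<lambda>t. (1 / \<delta>) * t powr (1 / \<delta> - 1)"])
    show "(\<lambda>t. t powr (1 / \<delta>)) ` {0<..} \<in> sets borel"
      unfolding im by simp
    show "set_integrable lborel ((\<lambda>t. t powr (1 / \<delta>)) ` {0<..}) ?f"
      unfolding im by (rule int)
    show "((\<lambda>t. t powr (1 / \<delta>)) has_real_derivative (1 / \<delta>) * t powr (1 / \<delta> - 1)) (at t within {0<..})"
      if "t \<in> {0<..}" for t
      by (rule has_field_derivative_at_within, rule has_real_derivative_powr) (use that in auto)
    show "inj_on (\<lambda>t. t powr (1 / \<delta>)) {0<..}"
      using assms by (intro powr_inj_on) auto
  qed auto
  also have "\<dots> = (LBINT t:{0<..}. 1 / \<delta> * (t powr (1 / \<delta> - 1) * exp (- c * t) * exp (- \<kappa> * t powr (1 / \<delta>))))"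
    using \<open>\<delta> > 0\<close> by (intro set_lebesgue_integral_cong) (auto simp: abs_mult powr_powr)
  finally show ?thesis
    by simp
qed

section \<open>The coverage probability\<close>

text \<open>The coverage event need not lie in \<open>M\<close>; an almost surely equal event of
  \<open>M\<close> determines its probability.\<close>

lemma measure_completion_cong_AE:
  assumes B: "B \<in> sets M" and A: "A \<subseteq> space M" and AE: "AE w in M. w \<in> A \<longleftrightarrow> w \<in> B"
  shows "measure (completion M) A = measure M B"
proof -
  have AE': "AE w in completion M. w \<in> A \<longleftrightarrow> w \<in> B"
    using AE by (rule AE_completion)
  have "A \<in> sets (completion M)"
  proof (rule completion.in_sets_AE)
    show "AE w in completion M. w \<in> B \<longleftrightarrow> w \<in> A"
      using AE' by eventually_elim blast
  qed (use A B in auto)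
  then have "measure (completion M) A = measure (completion M) B"
    using B AE' by (intro measure_eq_AE) auto
  also have "\<dots> = measure M B"
    using B by simp
  finally show ?thesis .
qed

lemma coverage_probability_eq:
  fixes M :: "'w measure"
    and \<Phi> :: "'w \<Rightarrow> (real ^ 2) set"
    and S F :: "'w \<Rightarrow> real ^ 2 \<Rightarrow> real"
    and DS :: "real measure"
    and lam K \<delta> W a T :: real
  assumes M: "prob_space M" and lam: "lam > 0" and hp: "homogeneous_poisson_process M lam \<Phi>"
    and DS: "prob_space DS" "sets DS = sets borel" and S0: "AE s in DS. 0 \<le> s"
    and S_int: "integrable DS (\<lambda>s. s powr (1 / \<delta>))"
    and marks: "independent_iid_marks M \<Phi> S F DS (density lborel (exponential_density 1))"
    and "K > 0" "\<delta> > 1" "W \<ge> 0" "a > 0" "T > 0"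
    and a: "a = lam * pi * (\<integral>s. s powr (1 / \<delta>) \<partial>DS) / K\<^sup>2"
  shows "coverage_probability M (path_loss K (2 * \<delta>)) W \<Phi> S F T
    = (LBINT z:{0<..}. exp (- (T * W / a powr \<delta>) * z powr \<delta>) * exp (- loss_exponent \<delta> T z z))"
proof -
  interpret prob_space M by fact
  let ?l = "path_loss K (2 * \<delta>)"
  let ?DF = "density lborel (exponential_density 1)"
  let ?BX = "PiM UNIV (\<lambda>_. borel) :: (nat \<Rightarrow> real^2) measure"
  let ?B = "PiM UNIV (\<lambda>_. borel) :: (nat \<Rightarrow> real) measure"
  \<comment> \<open>For a loss \<open>L\<close> and \<open>z = a * L powr (1 / \<delta>)\<close>,
    the strength \<open>z powr - \<delta>\<close> is \<open>1 / (A * L)\<close>: the factor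
    \<open>A\<close> converts scaled into actual strengths.\<close>
  define A where "A = a powr \<delta>"
  have A: "A > 0"
    using \<open>a > 0\<close> by (simp add: A_def)
  obtain X where bij: "AE w in M. bij_betw (\<lambda>n. X n w) UNIV (\<Phi> w)"
    and X [measurable]: "\<And>n. X n \<in> borel_measurable M"
    and S [measurable]: "\<And>n. (\<lambda>w. S w (X n w)) \<in> borel_measurable M"
    and F [measurable]: "\<And>n. (\<lambda>w. F w (X n w)) \<in> borel_measurable M"
    and XS: "\<And>h. h \<in> borel_measurable (?BX \<Otimes>\<^sub>M ?B) \<Longrightarrow>
      (\<integral>\<^sup>+w. h (\<lambda>n. X n w, \<lambda>n. S w (X n w)) \<partial>M)
      = (\<integral>\<^sup>+w. \<integral>\<^sup>+s. h (\<lambda>n. X n w, s) \<partial>PiM UNIV (\<lambda>_. DS) \<partial>M)"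
    and XSF: "\<And>h. h \<in> borel_measurable (?BX \<Otimes>\<^sub>M (?B \<Otimes>\<^sub>M ?B)) \<Longrightarrow>
      (\<integral>\<^sup>+w. h (\<lambda>n. X n w, \<lambda>n. S w (X n w), \<lambda>n. F w (X n w)) \<partial>M)
      = (\<integral>\<^sup>+w. \<integral>\<^sup>+f. h (\<lambda>n. X n w, \<lambda>n. S w (X n w), f) \<partial>PiM UNIV (\<lambda>_. ?DF) \<partial>M)"
    using independent_iid_marksE[OF marks DS(1) prob_space_exponential_1 DS(2)]
    by auto
  have [measurable]: "(\<lambda>w n. X n w) \<in> measurable M ?BX" "(\<lambda>w n. S w (X n w)) \<in> measurable M ?B"
    "(\<lambda>w n. F w (X n w)) \<in> measurable M ?B"
    by (auto intro!: measurable_PiM_single')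
  \<comment> \<open>The absolute value makes the strengths nonnegative everywhere, as
    \<open>poisson_strengths\<close> demands, although the marks are nonnegative only almost
    surely.\<close>
  define p where "p x s j = \<bar>s j / A / ?l (norm (x j))\<bar>" for x :: "nat \<Rightarrow> real^2" and s :: "nat \<Rightarrow> real" and j
  have [measurable]: "(\<lambda>(x, s). p x s j) \<in> borel_measurable (?BX \<Otimes>\<^sub>M ?B)"
    "(\<lambda>(x, s, f). p x s j) \<in> borel_measurable (?BX \<Otimes>\<^sub>M (?B \<Otimes>\<^sub>M ?B))" for j
    unfolding p_def path_loss_def by measurable
  define P where "P j w = p (\<lambda>n. X n w) (\<lambda>n. S w (X n w)) j" for j w
  interpret poisson_strengths M P \<delta>
  proof
    show "P j \<in> borel_measurable M" for j
      unfolding P_def p_def path_loss_def by measurable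
    fix v :: "real \<Rightarrow> real"
    assume v [measurable]: "v \<in> borel_measurable borel" and v01: "\<And>x. 0 \<le> v x" "\<And>x. v x \<le> 1" "v 0 = 1"
      and int: "set_integrable lborel {0<..} (\<lambda>z. 1 - v (z powr - \<delta>))"
    show "(\<integral>w. iprod (\<lambda>j. v (P j w)) \<partial>M) = exp (- (LBINT z:{0<..}. 1 - v (z powr - \<delta>)))"
      using strength_laplace_functional[OF M hp lam bij X S XS DS S0 S_int \<open>K > 0\<close> _ \<open>a > 0\<close> a,
          where v = "\<lambda>q. v \<bar>q\<bar>"] v01 int \<open>\<delta> > 1\<close>
      by (simp add: P_def p_def A_def)
  qed (use \<open>\<delta> > 1\<close> in \<open>auto simp: P_def p_def\<close>)
  \<comment> \<open>A station at the origin would have loss 0, whereas \<open>p\<close> gives it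
    strength 0 through division by zero. A single point has Lebesgue measure 0, so almost surely
    there is none.\<close>
  have X0: "AE w in M. \<forall>j. X j w \<noteq> 0"
  proof -
    have [measurable]: "(\<lambda>w. card (\<Phi> w \<inter> {0})) \<in> measurable M (count_space UNIV)"
      and "prob {w \<in> space M. card (\<Phi> w \<inter> {0}) = k}
        = (lam * measure lborel {0 :: real^2}) ^ k / fact k * exp (- (lam * measure lborel {0 :: real^2}))" for k
      using hp unfolding homogeneous_poisson_process_def by auto
    from this(2)[of 0] have "prob {w \<in> space M. card (\<Phi> w \<inter> {0}) = 0} = 1"
      by simp
    moreover have "{w \<in> space M. card (\<Phi> w \<inter> {0}) = 0} \<in> sets M"
      by measurable
    ultimately have "AE w in M. w \<in> {w \<in> space M. card (\<Phi> w \<inter> {0}) = 0}"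
      by (subst AE_in_set_eq_1)
    then show ?thesis
      using bij
    proof eventually_elim
      case (elim w)
      then have "0 \<notin> \<Phi> w"
        by auto
      then show ?case
        using elim(2) by (metis bij_betwE UNIV_I)
    qed
  qed
  have S_nonneg: "AE w in M. \<forall>j. 0 \<le> S w (X j w)"
    unfolding AE_all_countable
  proof
    fix j
    let ?h = "\<lambda>(x :: nat \<Rightarrow> real^2, s :: nat \<Rightarrow> real). indicator {s. s j < 0} s :: ennreal"
    have [measurable]: "?h \<in> borel_measurable (?BX \<Otimes>\<^sub>M ?B)"
      by measurable
    have "AE s in PiM UNIV (\<lambda>_. DS). 0 \<le> s j"
      by (rule AE_PiM_component) (use DS S0 in auto)
    then have z: "(\<integral>\<^sup>+s. indicator {s. s j < 0} s \<partial>PiM UNIV (\<lambda>_. DS)) = 0"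
      by (intro nn_integral_0_iff_AE[THEN iffD2] nn_integral_zero')
        (auto simp: indicator_def)
    have "(\<integral>\<^sup>+w. indicator {s. s j < 0} (\<lambda>n. S w (X n w)) \<partial>M) = 0"
      using XS[of ?h] by (simp add: z)
    then show "AE w in M. 0 \<le> S w (X j w)"
      by (subst (asm) nn_integral_0_iff_AE) (auto simp: indicator_def not_less elim!: eventually_mono split: if_splits)
  qed
  \<comment> \<open>\<open>AE_fading\<close> concerns independent fading for fixed strengths; it is
    carried over to the model by integrating the indicator of its failure with
    \<open>XSF\<close>.\<close>
  have F_good: "AE w in M. (\<forall>j. 0 < F w (X j w)) \<and> summable (\<lambda>j. P j w * F w (X j w))"
  proof -
    let ?G = "\<lambda>x s f. (\<forall>j. 0 < f j) \<and> (\<Sum>j. ennreal (p x s j * f j)) \<noteq> \<infinity>"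
    let ?h = "\<lambda>(x, s, f). if ?G x s f then 0 else 1 :: ennreal"
    have [measurable]: "?h \<in> borel_measurable (?BX \<Otimes>\<^sub>M (?B \<Otimes>\<^sub>M ?B))"
      by measurable
    have "(\<integral>\<^sup>+w. ?h (\<lambda>n. X n w, \<lambda>n. S w (X n w), \<lambda>n. F w (X n w)) \<partial>M)
        = (\<integral>\<^sup>+w. \<integral>\<^sup>+f. ?h (\<lambda>n. X n w, \<lambda>n. S w (X n w), f) \<partial>PiM UNIV (\<lambda>_. ?DF) \<partial>M)"
      by (rule XSF) measurable
    also have "\<dots> = (\<integral>\<^sup>+w. 0 \<partial>M)"
    proof (rule nn_integral_cong_AE)
      show "AE w in M. (\<integral>\<^sup>+f. ?h (\<lambda>n. X n w, \<lambda>n. S w (X n w), f) \<partial>PiM UNIV (\<lambda>_. ?DF)) = 0"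
        using AE_summable
      proof eventually_elim
        case (elim w)
        have "AE f in PiM UNIV (\<lambda>_. ?DF). ?h (\<lambda>n. X n w, \<lambda>n. S w (X n w), f) = 0"
          using AE_fading[OF P_nonneg elim]
        proof eventually_elim
          case (elim f)
          then have "0 \<le> P j w * f j" for j
            using P_nonneg by (simp add: less_imp_le)
          with conjunct2[OF elim] have "(\<Sum>j. ennreal (P j w * f j)) \<noteq> \<infinity>"
            unfolding infinity_ennreal_def by (rule ennreal_suminf_neq_top)
          with conjunct1[OF elim] show ?case
            unfolding P_def by simp
        qed
        then show ?case
          by (rule nn_integral_zero')
      qed
    qed
    finally have "(\<integral>\<^sup>+w. ?h (\<lambda>n. X n w, \<lambda>n. S w (X n w), \<lambda>n. F w (X n w)) \<partial>M) = 0"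
      by simp
    moreover have "(\<lambda>w. ?h (\<lambda>n. X n w, \<lambda>n. S w (X n w), \<lambda>n. F w (X n w))) \<in> borel_measurable M"
      by measurable
    ultimately have "AE w in M. ?h (\<lambda>n. X n w, \<lambda>n. S w (X n w), \<lambda>n. F w (X n w)) = 0"
      using nn_integral_0_iff_AE by blast
    then show ?thesis
    proof eventually_elim
      case (elim w)
      then have f: "\<And>j. 0 < F w (X j w)" "(\<Sum>j. ennreal (P j w * F w (X j w))) \<noteq> \<infinity>"
        by (auto simp: P_def split: if_splits)
      then show ?case
        using P_nonneg by (auto intro!: summable_suminf_not_top simp: less_imp_le)
    qed
  qed
  \<comment> \<open>Dividing the coverage condition by the power of the serving station
    \<open>k\<close> isolates \<open>f k\<close>; these are the resulting weights of the
    interferers.\<close>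
  define q where "q x s k j = (if j = k then 0 else T / p x s k * p x s j)" for x s k j
  \<comment> \<open>The serving station appears under an existential quantifier, which keeps the
    event measurable on the sequence space where \<open>XSF\<close> applies; without ties the
    witness is unique.\<close>
  define E where "E x s f \<longleftrightarrow> (\<exists>k. 0 < p x s k \<and> (\<forall>j. p x s j \<le> p x s k) \<and>
    T * W / A / p x s k + (\<Sum>j. q x s k j * f j) < f k)" for x s and f :: "nat \<Rightarrow> real"
  have E_iff: "E (\<lambda>n. X n w) (\<lambda>n. S w (X n w)) f \<longleftrightarrow>
      T * W / A / P k w + (\<Sum>j. q (\<lambda>n. X n w) (\<lambda>n. S w (X n w)) k j * f j) < f k"
    if k: "0 < P k w" "\<And>j. P j w \<le> P k w" and ties: "\<forall>i j. i \<noteq> j \<longrightarrow> P i w = P j w \<longrightarrow> P i w = 0"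
    for w k f
  proof
    assume "E (\<lambda>n. X n w) (\<lambda>n. S w (X n w)) f"
    then obtain k' where k': "0 < P k' w" "\<And>j. P j w \<le> P k' w"
      "T * W / A / P k' w + (\<Sum>j. q (\<lambda>n. X n w) (\<lambda>n. S w (X n w)) k' j * f j) < f k'"
      unfolding E_def P_def[symmetric] by blast
    have "P k' w = P k w"
      using k(2) k'(2) by (rule antisym)
    then have "k' = k"
      using k(1) ties by (metis less_irrefl)
    with k'(3) show "T * W / A / P k w + (\<Sum>j. q (\<lambda>n. X n w) (\<lambda>n. S w (X n w)) k j * f j) < f k"
      by simp
  next
    assume "T * W / A / P k w + (\<Sum>j. q (\<lambda>n. X n w) (\<lambda>n. S w (X n w)) k j * f j) < f k"
    with k show "E (\<lambda>n. X n w) (\<lambda>n. S w (X n w)) f"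
      unfolding E_def P_def[symmetric] by blast
  qed
  have [measurable]: "Measurable.pred (?BX \<Otimes>\<^sub>M (?B \<Otimes>\<^sub>M ?B)) (\<lambda>(x, s, f). E x s f)"
    unfolding E_def q_def by measurable
  let ?E = "{w \<in> space M. E (\<lambda>n. X n w) (\<lambda>n. S w (X n w)) (\<lambda>n. F w (X n w))}"
  have "(\<lambda>w. (\<lambda>n. X n w, \<lambda>n. S w (X n w), \<lambda>n. F w (X n w))) \<in> measurable M (?BX \<Otimes>\<^sub>M (?B \<Otimes>\<^sub>M ?B))"
    by measurable
  from measurable_compose[OF this \<open>Measurable.pred _ _\<close>] have E_sets [measurable]: "?E \<in> sets M"
    by simp
  have "coverage_probability M ?l W \<Phi> S F T = prob ?E"
    unfolding coverage_probability_def
  proof (rule measure_completion_cong_AE[OF E_sets])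
    show "AE w in M. w \<in> {w \<in> space M. T < SINR ?l W (\<Phi> w) (S w) (F w)} \<longleftrightarrow> w \<in> ?E"
      using AE_space bij X0 S_nonneg F_good AE_summable AE_no_ties AE_infinite_positive AE_strongest
    proof eventually_elim
      case (elim w)
      obtain k where k: "0 < P k w" "\<And>j. P j w \<le> P k w"
        using elim(9) by blast
      \<comment> \<open>Multiplying by \<open>A\<close> undoes the scaling: these are the
        reciprocals of the actual losses.\<close>
      interpret N: ranked_network "\<lambda>j. A * P j w" ?l "\<Phi> w" "S w" "F w" "\<lambda>n. X n w"
      proof
        show "infinite {j. 0 < A * P j w}"
          using elim(8) A by (simp add: zero_less_mult_iff)
        show "A * P i w = 0" if "i \<noteq> j" "A * P i w = A * P j w" for i j
          using elim(7) that A by auto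
        fix j
        have l: "?l (norm (X j w)) > 0"
          using elim(3) \<open>K > 0\<close> by (simp add: path_loss_def)
        have s: "0 \<le> S w (X j w)"
          using elim(4) by blast
        have eq: "A * P j w = S w (X j w) / ?l (norm (X j w))"
          using A l s by (simp add: P_def p_def)
        show "propagation_loss ?l (S w) (X j w) = inverse (ennreal (A * P j w))"
        proof (cases "S w (X j w) = 0")
          case True
          then show ?thesis
            using l by (simp add: propagation_loss_def eq ennreal_divide_zero)
        next
          case False
          then show ?thesis
            using l s by (simp add: propagation_loss_def eq inverse_ennreal divide_ennreal)
        qed
      qed (use elim A P_nonneg in auto)
      have eqsum: "(\<Sum>j. q (\<lambda>n. X n w) (\<lambda>n. S w (X n w)) k j * F w (X j w))
          = T / (A * P k w) * (\<Sum>j. if j = k then 0 else F w (X j w) * (A * P j w))"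
      proof (subst suminf_mult[symmetric])
        have "summable (\<lambda>j. A * (P j w * F w (X j w)))"
          using elim(5) by (intro summable_mult) auto
        then show "summable (\<lambda>j. if j = k then 0 else F w (X j w) * (A * P j w))"
          by (rule summable_comparison_test'[of _ 0])
            (use elim(5) A P_nonneg in \<open>auto simp: abs_mult less_imp_le mult_ac\<close>)
      qed (use A k in \<open>auto simp: q_def P_def intro!: suminf_cong\<close>)
      have "T < SINR ?l W (\<Phi> w) (S w) (F w) \<longleftrightarrow>
          T * (W + (\<Sum>j. if j = k then 0 else F w (X j w) * (A * P j w))) < F w (X k w) * (A * P k w)"
      proof (rule N.SINR_greater_iff)
        have "summable (\<lambda>j. A * (P j w * F w (X j w)))"
          using elim(5) by (intro summable_mult) auto
        then show "summable (\<lambda>j. F w (X j w) * (A * P j w))"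
          by (simp add: mult_ac)
      qed (use elim(5) k A \<open>W \<ge> 0\<close> \<open>T > 0\<close> in auto)
      also have "\<dots> \<longleftrightarrow> T * W / A / P k w + (\<Sum>j. q (\<lambda>n. X n w) (\<lambda>n. S w (X n w)) k j * F w (X j w)) < F w (X k w)"
      proof -
        have "T * W / A / P k w + (\<Sum>j. q (\<lambda>n. X n w) (\<lambda>n. S w (X n w)) k j * F w (X j w))
            = T * (W + (\<Sum>j. if j = k then 0 else F w (X j w) * (A * P j w))) / (A * P k w)"
          unfolding eqsum by (simp add: add_divide_distrib distrib_left)
        then show ?thesis
          using A k by (simp add: pos_divide_less_eq)
      qed
      also have "\<dots> \<longleftrightarrow> w \<in> ?E"
        using elim(1) E_iff[OF k elim(7)] by simp
      finally show ?case
        using elim(1) by simp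
    qed
  qed auto
  also have "ennreal (prob ?E) = (\<integral>\<^sup>+w. (if E (\<lambda>n. X n w) (\<lambda>n. S w (X n w)) (\<lambda>n. F w (X n w)) then 1 else 0) \<partial>M)"
    unfolding emeasure_eq_measure[symmetric] nn_integral_indicator[OF E_sets, symmetric]
    by (intro nn_integral_cong) (simp add: indicator_def)
  also have "\<dots> = (\<integral>\<^sup>+w. \<integral>\<^sup>+f. (if E (\<lambda>n. X n w) (\<lambda>n. S w (X n w)) f then 1 else 0) \<partial>PiM UNIV (\<lambda>_. ?DF) \<partial>M)"
  proof -
    let ?h = "\<lambda>y. if case y of (x, s, f) \<Rightarrow> E x s f then 1 else 0 :: ennreal"
    have "?h \<in> borel_measurable (?BX \<Otimes>\<^sub>M (?B \<Otimes>\<^sub>M ?B))"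
      by measurable
    from XSF[OF this] show ?thesis
      by simp
  qed
  finally have cov: "ennreal (coverage_probability M ?l W \<Phi> S F T)
      = (\<integral>\<^sup>+w. \<integral>\<^sup>+f. (if E (\<lambda>n. X n w) (\<lambda>n. S w (X n w)) f then 1 else 0) \<partial>PiM UNIV (\<lambda>_. ?DF) \<partial>M)" .
  define \<phi> where "\<phi> z = exp (- (T * W / A) * z powr \<delta>)" for z :: real
  have \<phi>: "0 \<le> \<phi> z" "\<phi> z \<le> 1" for z
    using A \<open>T > 0\<close> \<open>W \<ge> 0\<close> by (auto simp: \<phi>_def)
  have [measurable]: "\<phi> \<in> borel_measurable borel"
    unfolding \<phi>_def by measurable
  have \<phi>_cont: "isCont \<phi> z" if "z > 0" for z
    unfolding \<phi>_def using that by (intro continuous_intros) auto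
  let ?H = "\<lambda>w. fading_transform T (smallest_loss w) w"
  have H: "0 \<le> ?H w" "?H w \<le> 1" for w
    using fading_transform_bounds[of T] \<open>T > 0\<close> by auto
  note cov
  also have "(\<integral>\<^sup>+w. \<integral>\<^sup>+f. (if E (\<lambda>n. X n w) (\<lambda>n. S w (X n w)) f then 1 else 0) \<partial>PiM UNIV (\<lambda>_. ?DF) \<partial>M)
      = (\<integral>\<^sup>+w. ennreal ((1 + T) * (\<phi> (smallest_loss w) * ?H w)) \<partial>M)"
  proof (rule nn_integral_cong_AE)
    show "AE w in M. (\<integral>\<^sup>+f. (if E (\<lambda>n. X n w) (\<lambda>n. S w (X n w)) f then 1 else 0) \<partial>PiM UNIV (\<lambda>_. ?DF))
        = ennreal ((1 + T) * (\<phi> (smallest_loss w) * ?H w))"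
      using AE_summable AE_no_ties AE_strongest
    proof eventually_elim
      case (elim w)
      obtain k where k: "0 < P k w" "\<And>j. P j w \<le> P k w"
        using elim(3) by blast
      let ?q = "q (\<lambda>n. X n w) (\<lambda>n. S w (X n w)) k"
      let ?c = "T * W / A / P k w"
      have "E (\<lambda>n. X n w) (\<lambda>n. S w (X n w)) f \<longleftrightarrow> ?c + (\<Sum>j. ?q j * f j) < f k" for f
        by (rule E_iff[OF k elim(2)])
      then have "(\<integral>\<^sup>+f. (if E (\<lambda>n. X n w) (\<lambda>n. S w (X n w)) f then 1 else 0) \<partial>PiM UNIV (\<lambda>_. ?DF))
          = (\<integral>\<^sup>+f. indicator {f. ?c + (\<Sum>j. ?q j * f j) < f k} f \<partial>PiM UNIV (\<lambda>_. ?DF))"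
        by (intro nn_integral_cong) (simp add: indicator_def)
      also have "\<dots> = ennreal (exp (- ?c) * iprod (\<lambda>j. 1 / (1 + ?q j)))"
      proof (rule fading_coverage)
        show q0: "0 \<le> ?q j" for j
          using k P_nonneg \<open>T > 0\<close> by (simp add: q_def P_def[symmetric])
        show "summable ?q"
        proof (rule summable_comparison_test'[of "\<lambda>j. T / P k w * P j w" 0])
          show "norm (?q j) \<le> T / P k w * P j w" for j
            using k P_nonneg[of j w] \<open>T > 0\<close> by (simp add: q_def P_def[symmetric])
        qed (use elim in \<open>auto intro: summable_mult\<close>)
      qed (use k A \<open>T > 0\<close> \<open>W \<ge> 0\<close> in \<open>auto simp: q_def\<close>)
      also have "exp (- ?c) * iprod (\<lambda>j. 1 / (1 + ?q j)) = (1 + T) * (\<phi> (smallest_loss w) * ?H w)"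
      proof -
        have "- 1 / \<delta> * \<delta> = - 1"
          using \<open>\<delta> > 1\<close> by simp
        then have Z: "smallest_loss w powr \<delta> = 1 / P k w"
          unfolding smallest_loss_eq[of w k, OF k(2)] using k
          by (simp only: powr_powr) (simp add: powr_minus_divide)
        \<comment> \<open>At \<open>y = smallest_loss w\<close> the factor of the serving station is
          \<open>1 / (1 + T)\<close>; the other factors are those of the interferers in
          \<open>fading_coverage\<close>.\<close>
        let ?u = "\<lambda>j. 1 / (1 + T * smallest_loss w powr \<delta> * P j w)"
        have "?u(k := 1) = (\<lambda>j. 1 / (1 + ?q j))"
          by (auto simp: q_def Z P_def[symmetric] fun_eq_iff)
        moreover have "?u k = 1 / (1 + T)"
          using k by (simp add: Z)
        ultimately have "?H w = 1 / (1 + T) * iprod (\<lambda>j. 1 / (1 + ?q j))"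
          unfolding fading_transform_def
          using iprod_split[of ?u k] fading_factor_bounds[of T] \<open>T > 0\<close> by auto
        moreover have "\<phi> (smallest_loss w) = exp (- ?c)"
          by (simp add: \<phi>_def Z)
        ultimately show ?thesis
          using \<open>T > 0\<close> by simp
      qed
      finally show ?case .
    qed
  qed
  also have "\<dots> = ennreal (\<integral>w. (1 + T) * (\<phi> (smallest_loss w) * ?H w) \<partial>M)"
  proof (rule nn_integral_eq_integral)
    show "AE w in M. 0 \<le> (1 + T) * (\<phi> (smallest_loss w) * ?H w)"
      using \<phi> H \<open>T > 0\<close> by auto
    show "integrable M (\<lambda>w. (1 + T) * (\<phi> (smallest_loss w) * ?H w))"
      using \<phi> H by (intro integrable_mult_right integrable_const_bound[where B = 1])
        (auto simp: abs_mult intro!: mult_le_one)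
  qed
  also have "(\<integral>w. (1 + T) * (\<phi> (smallest_loss w) * ?H w) \<partial>M)
      = (1 + T) * (LBINT z:{0<..}. \<phi> z * (1 / (1 + T) * exp (- loss_exponent \<delta> T z z)))"
    using expectation_smallest_loss[OF \<open>T > 0\<close> \<phi> _ \<phi>_cont] by simp
  also have "\<dots> = (LBINT z:{0<..}. (1 + T) * (\<phi> z * (1 / (1 + T) * exp (- loss_exponent \<delta> T z z))))"
    by (rule set_integral_mult_right[symmetric])
  also have "\<dots> = (LBINT z:{0<..}. \<phi> z * exp (- loss_exponent \<delta> T z z))"
    using \<open>T > 0\<close> by (intro set_lebesgue_integral_cong) auto
  finally show ?thesis
  proof (subst (asm) ennreal_inj)
    show "0 \<le> coverage_probability M ?l W \<Phi> S F T"
      by (simp add: coverage_probability_def)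
    show "0 \<le> (LBINT z:{0<..}. \<phi> z * exp (- loss_exponent \<delta> T z z))"
      unfolding set_lebesgue_integral_def using \<phi>
      by (intro Bochner_Integration.integral_nonneg) auto
  qed (simp add: \<phi>_def A_def)
qed

theorem theorem8:
  fixes M :: "'w measure"
    and \<Phi> :: "'w \<Rightarrow> (real ^ 2) set"
    and S F :: "'w \<Rightarrow> real ^ 2 \<Rightarrow> real"
    and DS :: "real measure"
    and lam K \<beta> W a T :: real
  assumes "prob_space M"
    and "lam > 0" and "homogeneous_poisson_process M lam \<Phi>"
    and "prob_space DS" and "sets DS = sets borel"
    and "AE s in DS. 0 \<le> s"
    and "integrable DS (\<lambda>s. s)" and "(\<integral>s. s \<partial>DS) = 1"
    and "integrable DS (\<lambda>s. s powr (2 / \<beta>))"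
    and "independent_iid_marks M \<Phi> S F DS (density lborel (exponential_density 1))"
    and "K > 0" and "\<beta> > 2" and "W \<ge> 0"
    and "a = lam * pi * (\<integral>s. s powr (2 / \<beta>) \<partial>DS) / K\<^sup>2"
    and "T > 0"
  shows "coverage_probability M (path_loss K \<beta>) W \<Phi> S F T =
    2 / \<beta> * (LBINT t:{0<..}. t powr (2 / \<beta> - 1)
      * exp (- t * T * W * a powr (- \<beta> / 2))
      * exp (- (t powr (2 / \<beta>)))
      * exp (- (2 / \<beta>) * (T * t powr (2 / \<beta>)
          * hyp2F1 1 (1 - 2 / \<beta>) (2 - 2 / \<beta>) (- T) / (1 - 2 / \<beta>))))"
proof -
  define \<delta> where "\<delta> = \<beta> / 2"
  have \<delta>: "\<delta> > 1" "\<beta> = 2 * \<delta>" "2 / \<beta> = 1 / \<delta>"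
    using \<open>\<beta> > 2\<close> by (auto simp: \<delta>_def)
  note integ = \<open>integrable DS (\<lambda>s. s powr (2 / \<beta>))\<close>[unfolded \<delta>(3)]
  \<comment> \<open>Mean 1 prevents the shadowing from vanishing almost surely, which makes
    \<open>a\<close> positive.\<close>
  have "(\<integral>s. s powr (1 / \<delta>) \<partial>DS) > 0"
  proof -
    have "(\<integral>s. s powr (1 / \<delta>) \<partial>DS) \<noteq> 0"
    proof
      assume "(\<integral>s. s powr (1 / \<delta>) \<partial>DS) = 0"
      then have "AE s in DS. s powr (1 / \<delta>) = 0"
        using integ by (subst (asm) integral_nonneg_eq_0_iff_AE) auto
      then have "AE s in DS. s = 0"
        by eventually_elim simp
      then have "(\<integral>s. s \<partial>DS) = (\<integral>s. 0 \<partial>DS)"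
        using assms(5) by (intro integral_cong_AE) (auto cong: measurable_cong_sets)
      then show False
        using \<open>(\<integral>s. s \<partial>DS) = 1\<close> by simp
    qed
    then show ?thesis
      by (simp add: less_le Bochner_Integration.integral_nonneg)
  qed
  then have "a > 0"
    using assms by (simp add: \<delta>(3))
  define h where "h = hyp2F1 1 (1 - 1 / \<delta>) (2 - 1 / \<delta>) (- T)"
  \<comment> \<open>The slope of the linear function \<open>loss_exponent \<delta> T z z\<close> of
    \<open>z\<close>: the summand 1 stems from the void below the serving station, the rest from the
    interference.\<close>
  define \<kappa> where "\<kappa> = 1 + 1 / \<delta> * (T * h / (1 - 1 / \<delta>))"
  have L: "loss_exponent \<delta> T z z = \<kappa> * z" if "z > 0" for z
    using loss_exponent_diagonal[OF \<delta>(1) \<open>T > 0\<close> that] interference_integral_hyp2F1[OF \<delta>(1) \<open>T > 0\<close>]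
    by (simp add: \<kappa>_def h_def mult.commute)
  define c where "c = T * W / a powr \<delta>"
  have c: "0 \<le> c"
    using assms by (simp add: c_def)
  have int: "set_integrable lborel {0<..} (\<lambda>z. exp (- c * z powr \<delta>) * exp (- \<kappa> * z))"
    unfolding set_integrable_def
  proof (rule Bochner_Integration.integrable_bound[OF exp_minus_integrable])
    have "norm (indicator {0<..} z *\<^sub>R (exp (- c * z powr \<delta>) * exp (- \<kappa> * z))) \<le> norm (indicator {0<..} z *\<^sub>R exp (- z))" for z
    proof (cases "z > 0")
      case True
      \<comment> \<open>By \<open>L\<close> and \<open>loss_exponent_ge\<close>,
        \<open>\<kappa> * z\<close> is at least \<open>z\<close>, so no estimate of \<open>h\<close>
        is called for.\<close>
      have "exp (- c * z powr \<delta>) * exp (- \<kappa> * z) \<le> 1 * exp (- z)"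
        using c L[OF True] loss_exponent_ge[of \<delta> T z z] \<delta> \<open>T > 0\<close> True by (intro mult_mono) auto
      then show ?thesis
        using True by simp
    qed auto
    then show "AE z in lborel. norm (indicator {0<..} z *\<^sub>R (exp (- c * z powr \<delta>) * exp (- \<kappa> * z))) \<le> norm (indicator {0<..} z *\<^sub>R exp (- z))"
      by simp
  qed auto
  have "coverage_probability M (path_loss K \<beta>) W \<Phi> S F T
      = (LBINT z:{0<..}. exp (- c * z powr \<delta>) * exp (- loss_exponent \<delta> T z z))"
    unfolding \<delta>(2) c_def
    by (rule coverage_probability_eq) (use assms \<open>a > 0\<close> \<delta> integ in auto)
  also have "\<dots> = (LBINT z:{0<..}. exp (- c * z powr \<delta>) * exp (- \<kappa> * z))"
    by (intro set_lebesgue_integral_cong) (auto simp: L)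
  also have "\<dots> = 1 / \<delta> * (LBINT t:{0<..}. t powr (1 / \<delta> - 1) * exp (- c * t) * exp (- \<kappa> * t powr (1 / \<delta>)))"
    using \<delta>(1) int by (intro LBINT_powr_substitution) auto
  also have "\<dots> = 1 / \<delta> * (LBINT t:{0<..}. t powr (1 / \<delta> - 1)
      * exp (- t * T * W * a powr (- \<beta> / 2))
      * exp (- (t powr (1 / \<delta>)))
      * exp (- (1 / \<delta>) * (T * t powr (1 / \<delta>) * h / (1 - 1 / \<delta>))))"
  proof -
    have "a powr (- \<beta> / 2) = 1 / a powr \<delta>"
      by (simp add: \<delta>_def powr_minus_divide)
    then have 1: "- c * t = - t * T * W * a powr (- \<beta> / 2)" for t
      by (simp add: c_def)
    have 2: "- \<kappa> * t powr (1 / \<delta>)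
        = - (t powr (1 / \<delta>)) + - (1 / \<delta>) * (T * t powr (1 / \<delta>) * h / (1 - 1 / \<delta>))" for t
      by (simp add: \<kappa>_def algebra_simps)
    show ?thesis
      unfolding 1 2 exp_add by (simp only: mult.assoc)
  qed
  finally show ?thesis
    unfolding h_def \<delta>(3) .
qed

end
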